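(* All Lie algebras are over $\mathbb{R}$, and $b_k$ denotes the $k$-th Betti number (with trivial real coefficients). The following hold. (i) $b_1(\mathrm{aff}(\mathbb{R})) = 1$ and $b_2(\mathrm{aff}(\mathbb{R})) = 0$. (ii) For every integer $n > 2$ and every $0 \le k \le n$, $$b_k\left(\mathrm{aff}(\mathbb{R}) \oplus \mathbb{R}^{n-2}\right) = \binom{n-1}{k}.$$ (iii) For every integer $m \ge 1$, with $n = 2m+1$, and every $0 \le k \le m$, $$b_k(\mathfrak{h}_{2m+1}) = b_{n-k}(\mathfrak{h}_{2m+1}) = \binom{2m}{k} - \binom{2m}{k-2}.$$ (iv) For every integer $n > 3$ and every $0 \le k \le n$, $$b_k\left(\mathfrak{h}_3 \oplus \mathbb{R}^{n-3}\right) = \binom{n-1}{k} + \binom{n-2}{k-2}.$$ For all integers $m, n$ with $n > 2m+1 > 3$ and every $0 \le k \le m$, $$b_k\left(\mathfrak{h}_{2m+1} \oplus \mathbb{R}^{n-2m-1}\right) = b_{n-k}\left(\mathfrak{h}_{2m+1} \oplus \mathbb{R}^{n-2m-1}\right) = \binom{n-1}{k} - \binom{n-1}{k-2}.$$ For all integers $m, n$ with $n > 2m+1 > 3$ and every $k$ with $m+1 \le k \le \left[\frac{n}{2}\right]$, $$b_k\left(\mathfrak{h}_{2m+1} \oplus \mathbb{R}^{n-2m-1}\right) = b_{n-k}\left(\mathfrak{h}_{2m+1} \oplus \mathbb{R}^{n-2m-1}\right) = \sum_{i=0}^{\min\{k,2m+1\}} \left( \binom{2m}{i - \left[\frac{i}{m+1}\right]}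 - \binom{2m}{i + 3\left[\frac{i}{m+1}\right] - 2} \right) \binom{n-2m-1}{k-i}.$$
   Context: $\mathrm{aff}(\mathbb{R})$ is the 2-dimensional real Lie algebra with basis $\{X, Y\}$ and bracket $[X,Y] = Y$. For $m \ge 1$, $\mathfrak{h}_{2m+1}$ is the real Heisenberg Lie algebra of dimension $2m+1$ with basis $\{Z, X_1, \dots, X_m, X_{m+1}, \dots, X_{2m}\}$ and brackets $[X_i, X_{m+i}] = Z$ for $1 \le i \le m$, all other brackets of basis elements (apart from those implied by antisymmetry) being zero. $\mathbb{R}^{r}$ denotes the $r$-dimensional commutative real Lie algebra and $\oplus$ is the direct sum of Lie algebras. (Up to isomorphism, the algebras $\mathrm{aff}(\mathbb{R})$, $\mathrm{aff}(\mathbb{R})\oplus\mathbb{R}^{n-2}$, $\mathfrak{h}_{2m+1}$, $\mathfrak{h}_{2m+1}\oplus\mathbb{R}^{n-2m-1}$ are exactly the so-called $MD(n,1)$-algebras, i.e. the $n$-dimensional real solvable Lie algebras with 1-dimensional derived ideal.) For a finite-dimensional real Lie algebra $\mathfrak{g}$, $b_k(\mathfrak{g}) = \dim_{\mathbb{R}} H^k(\mathfrak{g}, \mathbb{R})$, where $H^k(\mathfrak{g},\mathbb{R})$ is the $k$-th Chevalley–Eilenberg cohomology with trivial coefficients, i.e. the cohomology of the complex $\Lambda^k(\mathfrak{g}^* )$ of skew-symmetric $k$-linear forms with differential $$\delta f(X_0, \dots, X_k) = \sum_{0 \le i < j \le k} (-1)^{i+j} f([X_i, X_j], X_0, \dots,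 \widehat{X_i}, \dots, \widehat{X_j}, \dots, X_k).$$ Here $[x]$, applied to a real number $x$, is the integer part (floor) of $x$, and $\binom{a}{b} := 0$ whenever $b < 0$ or $b > a$. *)

theory Defs
  imports
    "HOL-Analysis.Analysis"
    "HOL-Library.Function_Algebras"
    "HOL-Library.Set_Algebras"
    "HOL-Library.FuncSet"
begin

instantiation "fun" :: (type, real_vector) real_vector
begin

definition scaleR_fun :: "real \<Rightarrow> ('a \<Rightarrow> 'b) \<Rightarrow> 'a \<Rightarrow> 'b" where
  "scaleR_fun c f = (\<lambda>x. c *\<^sub>R f x)"

instance
  by standard (simp_all add: scaleR_fun_def plus_fun_def fun_eq_iff algebra_simps)

end

lemma scaleR_fun_apply [simp]: "(c *\<^sub>R f) x = c *\<^sub>R f x"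
  by (simp add: scaleR_fun_def)

definition quotient_space :: "'v::real_vector set \<Rightarrow> 'v set \<Rightarrow> 'v set set" where
  "quotient_space Z B = (\<lambda>z. z +o B) ` Z"

text \<open>The linear combination of cosets in \<open>Z / B\<close>. The summand \<open>B\<close>, the zero of the quotient,
  changes nothing unless all coefficients vanish, when the elementwise sum alone would be \<open>{0}\<close>.\<close>

definition coset_lincomb :: "'v::real_vector set \<Rightarrow> 'v set set \<Rightarrow> ('v set \<Rightarrow> real) \<Rightarrow> 'v set" where
  "coset_lincomb B S c = (\<Sum>C\<in>S. (*\<^sub>R) (c C) ` C) + B"

definition quotient_basis :: "'v::real_vector set \<Rightarrow> 'v set \<Rightarrow> 'v set set \<Rightarrow> bool" where
  "quotient_basis Z B S \<longleftrightarrow> finite S \<and> S \<subseteq> quotient_space Z B \<and>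
     (\<forall>C\<in>quotient_space Z B. \<exists>!c. c \<in> S \<rightarrow>\<^sub>E UNIV \<and> C = coset_lincomb B S c)"

definition quotient_dim :: "'v::real_vector set \<Rightarrow> 'v set \<Rightarrow> nat" where
  "quotient_dim Z B = (THE d. \<exists>S. quotient_basis Z B S \<and> card S = d)"

record 'a lie_alg =
  carr :: "'a set"
  brk :: "'a \<Rightarrow> 'a \<Rightarrow> 'a"

definition lie_algebra :: "'a::real_vector lie_alg \<Rightarrow> bool" where
  "lie_algebra g \<longleftrightarrow> subspace (carr g) \<and>
     (\<forall>x\<in>carr g. \<forall>y\<in>carr g. brk g x y \<in> carr g) \<and>
     (\<forall>x\<in>carr g. \<forall>y\<in>carr g. \<forall>z\<in>carr g. \<forall>c.
        brk g (x + y) z = brk g x z + brk g y z \<and> brk g x (y + z) = brk g x y + brk g x z \<and>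
        brk g (c *\<^sub>R x) y = c *\<^sub>R brk g x y \<and> brk g x (c *\<^sub>R y) = c *\<^sub>R brk g x y) \<and>
     (\<forall>x\<in>carr g. brk g x x = 0) \<and>
     (\<forall>x\<in>carr g. \<forall>y\<in>carr g. \<forall>z\<in>carr g.
        brk g x (brk g y z) + brk g y (brk g z x) + brk g z (brk g x y) = 0)"

definition dsum_lie :: "'a lie_alg \<Rightarrow> 'b lie_alg \<Rightarrow> ('a \<times> 'b) lie_alg"  (infixr "\<oplus>\<^sub>L" 65) where
  "g \<oplus>\<^sub>L h = \<lparr>carr = carr g \<times> carr h, brk = (\<lambda>(x, u) (y, v). (brk g x y, brk h u v))\<rparr>"

lemma lie_algebra_dsum:
  assumes "lie_algebra g" and "lie_algebra h"
  shows "lie_algebra (g \<oplus>\<^sub>L h)"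
  using assms unfolding lie_algebra_def dsum_lie_def
  by (auto simp: subspace_Times zero_prod_def)

text \<open>\<open>(a, b)\<close> stands for \<open>a X + b Y\<close>.\<close>

definition aff_lie :: "(real \<times> real) lie_alg" where
  "aff_lie = \<lparr>carr = UNIV, brk = (\<lambda>(a, b) (c, d). (0, a * d - b * c))\<rparr>"

lemma lie_algebra_aff: "lie_algebra aff_lie"
  unfolding lie_algebra_def aff_lie_def
  by (auto simp: zero_prod_def algebra_simps)

lemma aff_lie_basis: "brk aff_lie (1, 0) (0, 1) = (0, 1)"
  by (simp add: aff_lie_def)

text \<open>\<open>\<real>\<^sup>d\<close> as a subspace of the sequences, so that \<open>d\<close> is a term and can be quantified over.\<close>

definition coord_space :: "nat \<Rightarrow> (nat \<Rightarrow> real) set" where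
  "coord_space d = {v. \<forall>i\<ge>d. v i = 0}"

definition coord_vec :: "nat \<Rightarrow> nat \<Rightarrow> real" where
  "coord_vec i = (\<lambda>j. if j = i then 1 else 0)"

lemma subspace_coord_space: "subspace (coord_space d)"
  by (auto simp: subspace_def coord_space_def)

definition abelian_lie :: "nat \<Rightarrow> (nat \<Rightarrow> real) lie_alg" where
  "abelian_lie r = \<lparr>carr = coord_space r, brk = (\<lambda>v w. 0)\<rparr>"

lemma lie_algebra_abelian: "lie_algebra (abelian_lie r)"
  unfolding lie_algebra_def abelian_lie_def
  by (auto simp: subspace_coord_space subspace_0)

text \<open>Coordinate \<open>0\<close> belongs to \<open>Z\<close>, coordinate \<open>i\<close> with \<open>1 \<le> i \<le> 2 m\<close> to \<open>X\<^sub>i\<close>.\<close>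

definition heisenberg_lie :: "nat \<Rightarrow> (nat \<Rightarrow> real) lie_alg" where
  "heisenberg_lie m = \<lparr>carr = coord_space (2 * m + 1),
     brk = (\<lambda>v w. (\<Sum>i=1..m. v i * w (m + i) - v (m + i) * w i) *\<^sub>R coord_vec 0)\<rparr>"

lemma lie_algebra_heisenberg: "lie_algebra (heisenberg_lie m)"
proof -
  have "subspace (carr (heisenberg_lie m))"
    by (simp add: heisenberg_lie_def subspace_coord_space del: mult_2)
  then show ?thesis
    unfolding lie_algebra_def heisenberg_lie_def
    by (auto simp: coord_space_def coord_vec_def fun_eq_iff algebra_simps
        sum.distrib sum_subtractf sum_distrib_left)
qed

lemma heisenberg_lie_basis:
  assumes "i < j"
  shows "brk (heisenberg_lie m) (coord_vec i) (coord_vec j) =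
    (if i \<in> {1..m} \<and> j = m + i then coord_vec 0 else 0)"
proof -
  have "(\<Sum>l=1..m. coord_vec i l * coord_vec j (m + l) - coord_vec i (m + l) * coord_vec j l) =
      (\<Sum>l=1..m. if l = i then (if j = m + i then 1 else 0) else 0)"
    using assms by (intro sum.cong) (auto simp: coord_vec_def)
  then show ?thesis
    by (simp add: heisenberg_lie_def)
qed

text \<open>A \<open>k\<close>-linear form takes the list of its \<open>k\<close> arguments. Every other list is sent to \<open>0\<close>,
  so that forms on \<open>carr g\<close> correspond to unique HOL functions.\<close>

definition arg_lists :: "'a lie_alg \<Rightarrow> nat \<Rightarrow> 'a list set" where
  "arg_lists g k = {xs. length xs = k \<and> set xs \<subseteq> carr g}"

definition cochains :: "'a::real_vector lie_alg \<Rightarrow> nat \<Rightarrow> ('a list \<Rightarrow> real) set" where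
  "cochains g k = {f.
     (\<forall>xs. xs \<notin> arg_lists g k \<longrightarrow> f xs = 0) \<and>
     (\<forall>xs\<in>arg_lists g k. \<forall>i<k. \<forall>x\<in>carr g. \<forall>y\<in>carr g. \<forall>c.
        f (xs[i := x + y]) = f (xs[i := x]) + f (xs[i := y]) \<and>
        f (xs[i := c *\<^sub>R x]) = c * f (xs[i := x])) \<and>
     (\<forall>xs\<in>arg_lists g k. \<forall>j<k. \<forall>i<j. f (xs[i := xs ! j, j := xs ! i]) = - f xs)}"

definition ce_diff :: "'a lie_alg \<Rightarrow> nat \<Rightarrow> ('a list \<Rightarrow> real) \<Rightarrow> 'a list \<Rightarrow> real" where
  "ce_diff g k f = (\<lambda>xs. if xs \<in> arg_lists g (Suc k)
     then (\<Sum>j\<le>k. \<Sum>i<j. (-1) ^ (i + j) * f (brk g (xs ! i) (xs ! j) # nths xs (- {i, j})))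
     else 0)"

definition cocycles :: "'a::real_vector lie_alg \<Rightarrow> nat \<Rightarrow> ('a list \<Rightarrow> real) set" where
  "cocycles g k = {f \<in> cochains g k. ce_diff g k f = 0}"

definition coboundaries :: "'a::real_vector lie_alg \<Rightarrow> nat \<Rightarrow> ('a list \<Rightarrow> real) set" where
  "coboundaries g k = (case k of 0 \<Rightarrow> {0} | Suc l \<Rightarrow> ce_diff g l ` cochains g l)"

definition betti :: "'a::real_vector lie_alg \<Rightarrow> nat \<Rightarrow> nat" where
  "betti g k = quotient_dim (cocycles g k) (coboundaries g k)"

text \<open>Integer arguments, since truncated subtraction on \<open>nat\<close> would turn \<open>k - 2\<close> into \<open>0\<close>.\<close>

definition binom :: "int \<Rightarrow> int \<Rightarrow> int" where
  "binom a b = (if 0 \<le> b \<and> b \<le> a then int (nat a choose nat b) else 0)"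

end

theory Submission
  imports Defs
begin

text \<open>Alternating forms are determined by their values on the increasing lists of basis vectors, so
  a \<open>k\<close>-cochain is a real function on the \<open>k\<close>-subsets of the index set of a basis, and
  \<open>b\<^sub>k\<close> is \<open>n choose k\<close> minus the ranks of two consecutive differentials. For
  \<open>aff(\<real>) \<oplus> \<real>\<^sup>r\<close> the differential only removes an index, and the ranks can be read off.
  For \<open>\<hh>\<^bsub>2m+1\<^esub> \<oplus> \<real>\<^sup>r\<close> it removes the form dual to \<open>Z\<close> and multiplies by the
  symplectic form \<open>\<omega>\<close>. Multiplication \<open>U\<close> by \<open>\<omega>\<close> and its adjoint \<open>D\<close> satisfy the
  \<open>sl\<^sub>2\<close> relation \<open>D U - U D = m - l\<close>, where \<open>l\<close> is the degree in the \<open>2 m\<close> symplectic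
  variables (the hard Lefschetz argument). Hence \<open>U\<close> is injective for \<open>l < m\<close> and surjective onto
  degrees \<open>l \<ge> m + 2\<close>, which gives its rank as the cardinality of a family of subsets.\<close>

section \<open>Dimension of a quotient space\<close>

text \<open>The cochain spaces lie in an infinite-dimensional function space, so the dimension
  arguments carry a finite set \<open>W\<close> whose span contains the space in question. That the
  differential squares to zero is checked in coordinates, where it amounts to the fact that an index
  once removed cannot be removed again. No decomposition into irreducible sl2-modules is made.
  \<open>U\<close> and \<open>D\<close> are adjoint for the standard inner product of functions on
  subsets, so the sl2 relation compares their norms, and the sign of \<open>m - l\<close> does the
  rest. As \<open>U\<close> raises the level by 2, the levels below \<open>m\<close> are embedded
  into levels up to \<open>m + 1\<close>, while the levels from \<open>m\<close> on cover exactly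
  those from \<open>m + 2\<close> on. The two targets do not overlap, so the rank is a plain count
  of subsets. The abelian summand only adds indices that \<open>U\<close> and \<open>D\<close> leave
  alone. It is therefore carried along throughout, and the Kunneth convolution of Betti numbers with
  binomial coefficients comes out at the end, when subsets are sorted by level.\<close>

lemma finite_basis_extend:
  fixes V :: "'v::real_vector set"
  assumes "subspace V" "V \<subseteq> span W" "finite W" "independent C" "C \<subseteq> V"
  obtains D where "C \<inter> D = {}" "C \<union> D \<subseteq> V" "independent (C \<union> D)" "V \<subseteq> span (C \<union> D)"
    "finite C" "finite D" "card C + card D = dim V"
proof -
  obtain E where E: "C \<subseteq> E" "E \<subseteq> V" "independent E" "V \<subseteq> span E"
    using maximal_independent_subset_extend[OF assms(5,4)] by metis
  have fin: "finite E"
    using independent_span_bound[OF assms(3) E(3)] E(2) assms(2) by blast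
  have card: "card E = dim V"
    using basis_card_eq_dim[OF E(2,4,3)] .
  have fins: "finite C" "finite (E - C)"
    using fin E(1) finite_subset by blast+
  have "C \<inter> (E - C) = {}" "C \<union> (E - C) = E"
    using E(1) by auto
  moreover have "card C + card (E - C) = dim V"
    using card fin E(1) by (metis card_Diff_subset card_mono fins(1) le_add_diff_inverse)
  ultimately show thesis
    using that[of "E - C"] E fins by simp
qed

lemma dim_image_inj:
  fixes f :: "'v::real_vector \<Rightarrow> 'w::real_vector"
  assumes "linear f" "subspace V" "V \<subseteq> span W" "finite W" "inj_on f V"
  shows "dim (f ` V) = dim V"
proof -
  obtain D where D: "D \<subseteq> V" "independent D" "V \<subseteq> span D" "finite D" "card D = dim V"
    using finite_basis_extend[OF assms(2-4), of "{}"] independent_empty by auto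
  have sp: "span D = V"
    using D(1,3) assms(2) by (simp add: span_minimal subset_antisym)
  have "independent (f ` D)"
    using linear_independent_injective_image[OF assms(1) D(2)] assms(5) sp by simp
  moreover have "f ` V \<subseteq> span (f ` D)"
    using linear_span_image[OF assms(1), of D] sp by simp
  moreover have "card (f ` D) = card D"
    using assms(5) D(1) by (meson card_image inj_on_subset)
  ultimately show ?thesis
    using D(1,5) by (intro dim_unique[of "f ` D"]) auto
qed

text \<open>A basis \<open>C\<close> of the kernel is completed by \<open>D\<close> to a basis of
  \<open>V\<close>. On \<open>span D\<close> the map is injective and has the same image as on
  \<open>V\<close>, so \<open>card D\<close> is the rank.\<close>

lemma rank_nullity:
  fixes f :: "'v::real_vector \<Rightarrow> 'w::real_vector"
  assumes f: "linear f" and V: "subspace V" "V \<subseteq> span W" "finite W"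
  shows "dim {x \<in> V. f x = 0} + dim (f ` V) = dim V"
proof -
  let ?K = "{x \<in> V. f x = 0}"
  have K: "subspace ?K"
    using V(1) by (auto simp: subspace_def linear_0[OF f] linear_add[OF f] linear_scale[OF f])
  have KW: "?K \<subseteq> span W"
    using V(2) by auto
  obtain C where C: "C \<subseteq> ?K" "independent C" "?K \<subseteq> span C" "card C = dim ?K"
    by (rule basis_exists)
  have "C \<subseteq> V" using C(1) by auto
  then obtain D where D: "C \<inter> D = {}" "C \<union> D \<subseteq> V" "independent (C \<union> D)" "V \<subseteq> span (C \<union> D)"
    "finite C" "finite D" "card C + card D = dim V"
    using finite_basis_extend[OF V C(2)] by metis
  have spK: "span C = ?K"
    using C(1,3) K by (simp add: span_minimal subset_antisym)
  have DV: "span D \<subseteq> V"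
    using D(2) V(1) by (simp add: span_minimal)
  have inter: "x = 0" if "x \<in> span C" "x \<in> span D" for x
  proof -
    from that(1) obtain u where u: "x = (\<Sum>v\<in>C. u v *\<^sub>R v)"
      by (auto simp: span_finite[OF D(5)])
    from that(2) obtain w where w: "x = (\<Sum>v\<in>D. w v *\<^sub>R v)"
      by (auto simp: span_finite[OF D(6)])
    \<comment> \<open>Coefficients of \<open>x\<close> on \<open>C\<close> and of \<open>- x\<close>
      on \<open>D\<close>: the combined sum is zero, so independence of \<open>C \<union> D\<close>
      kills all of them.\<close>
    define h where "h v = (if v \<in> C then u v else - w v)" for v
    have "(\<Sum>v\<in>C \<union> D. h v *\<^sub>R v) = (\<Sum>v\<in>C. h v *\<^sub>R v) + (\<Sum>v\<in>D. h v *\<^sub>R v)"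
      using D(1,5,6) by (intro sum.union_disjoint) auto
    also have "(\<Sum>v\<in>C. h v *\<^sub>R v) = x"
      by (simp add: u h_def)
    also have "(\<Sum>v\<in>D. h v *\<^sub>R v) = - x"
      unfolding w sum_negf[symmetric] using D(1) by (intro sum.cong) (auto simp: h_def)
    finally have s0: "(\<Sum>v\<in>C \<union> D. h v *\<^sub>R v) = 0"
      by simp
    have "h v = 0" if "v \<in> C \<union> D" for v
      using D(3,5,6) s0 that by (metis dependent_finite finite_UnI)
    then have "u v = 0" if "v \<in> C" for v
      using that h_def by (metis UnI1)
    then show "x = 0"
      by (simp add: u)
  qed
  have inj: "inj_on f (span D)"
  proof (rule inj_onI)
    fix x y assume xy: "x \<in> span D" "y \<in> span D" "f x = f y"
    then have "x - y \<in> span D" by (simp add: span_diff)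
    moreover from this xy DV have "x - y \<in> ?K"
      by (auto simp: linear_diff[OF f])
    ultimately show "x = y"
      using inter[of "x - y"] spK by auto
  qed
  have indD: "independent D"
    using D(3) independent_mono by blast
  have im: "f ` V = f ` span D"
  proof
    show "f ` span D \<subseteq> f ` V" using DV by auto
    show "f ` V \<subseteq> f ` span D"
    proof
      fix y assume "y \<in> f ` V"
      then obtain x where x: "x \<in> V" "y = f x" by auto
      then have "x \<in> span (C \<union> D)" using D(4) by auto
      then obtain a b where ab: "x = a + b" "a \<in> span C" "b \<in> span D"
        by (auto simp: span_Un)
      then have "f x = f b"
        using spK by (auto simp: linear_add[OF f])
      then show "y \<in> f ` span D" using x(2) ab(3) by auto
    qed
  qed
  have "dim (f ` span D) = dim (span D)"
    using dim_image_inj[OF f subspace_span _ D(6) inj] by simp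
  also have "\<dots> = card D"
    using indD by (rule dim_span_eq_card_independent)
  finally show ?thesis
    using im D(7) C(4) by simp
qed

section \<open>Linear combinations of cosets and the size of a quotient basis\<close>

text \<open>For \<open>c = 0\<close> the scaled coset collapses to a single point; the coset
  \<open>s +o B\<close> next to it restores the full translate. An induction over a linear
  combination thus always needs a full coset as its last summand.\<close>

lemma scaleR_elt_coset:
  fixes B :: "'v::real_vector set"
  assumes "subspace B"
  shows "(*\<^sub>R) c ` (r +o B) + (s +o B) = (c *\<^sub>R r + s) +o B" (is "?L = ?R")
proof
  show "?L \<subseteq> ?R"
  proof
    fix x assume "x \<in> ?L"
    then obtain b b' where b: "b \<in> B" "b' \<in> B" "x = c *\<^sub>R (r + b) + (s + b')"
      by (auto simp: set_plus_def elt_set_plus_def)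
    then have "x = (c *\<^sub>R r + s) + (c *\<^sub>R b + b')"
      by (simp add: algebra_simps)
    then show "x \<in> ?R"
      using b assms by (metis set_plus_intro2 subspace_add subspace_scale)
  qed
  show "?R \<subseteq> ?L"
  proof
    fix x assume "x \<in> ?R"
    then obtain b where b: "b \<in> B" "x = c *\<^sub>R r + s + b"
      by (auto simp: elt_set_plus_def)
    then have "x = c *\<^sub>R (r + 0) + (s + b)"
      by (simp add: algebra_simps)
    then show "x \<in> ?L"
      using b(1) subspace_0[OF assms] by (metis image_eqI set_plus_intro set_plus_intro2)
  qed
qed

lemma coset_lincomb_eq:
  fixes B :: "'v::real_vector set"
  assumes B: "subspace B" and "finite S" and "\<And>C. C \<in> S \<Longrightarrow> C = p C +o B"
  shows "coset_lincomb B S c = (\<Sum>C\<in>S. c C *\<^sub>R p C) +o B"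
  unfolding coset_lincomb_def using assms(2,3)
proof (induction S rule: finite_induct)
  case empty
  then show ?case by simp
next
  case (insert C S)
  have "(\<Sum>D\<in>insert C S. (*\<^sub>R) (c D) ` D) + B
      = (*\<^sub>R) (c C) ` C + ((\<Sum>D\<in>S. (*\<^sub>R) (c D) ` D) + B)"
    using insert.hyps by (simp add: add.assoc)
  also have "(\<Sum>D\<in>S. (*\<^sub>R) (c D) ` D) + B = (\<Sum>D\<in>S. c D *\<^sub>R p D) +o B"
    using insert by blast
  also have "(*\<^sub>R) (c C) ` C = (*\<^sub>R) (c C) ` (p C +o B)"
    using insert.prems by (metis insertI1)
  finally show ?case
    using insert.hyps scaleR_elt_coset[OF B] by simp
qed

lemma elt_coset_eq_iff:
  fixes B :: "'v::real_vector set"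
  assumes "subspace B"
  shows "x +o B = y +o B \<longleftrightarrow> x - y \<in> B"
proof
  assume "x +o B = y +o B"
  then have "x \<in> y +o B"
    using subspace_0[OF assms] by (metis add.right_neutral set_plus_intro2)
  then show "x - y \<in> B" by (simp add: set_minus_plus)
next
  assume xy: "x - y \<in> B"
  have "(z - x \<in> B) = (z - y \<in> B)" for z
  proof
    assume "z - x \<in> B"
    from subspace_add[OF assms this xy] show "z - y \<in> B" by simp
  next
    assume "z - y \<in> B"
    from subspace_diff[OF assms this xy] show "z - x \<in> B" by simp
  qed
  then show "x +o B = y +o B"
    by (intro set_eqI) (simp flip: set_minus_plus)
qed

text \<open>Representatives of the basis cosets, joined to a basis of \<open>B\<close>, form a basis
  of \<open>Z\<close>: uniqueness of coefficients gives independence modulo \<open>B\<close>,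
  existence gives spanning.\<close>

lemma quotient_basis_card:
  fixes Z B :: "'v::real_vector set"
  assumes Z: "subspace Z" and B: "subspace B" "B \<subseteq> Z" and W: "Z \<subseteq> span W" "finite W"
    and S: "quotient_basis Z B S"
  shows "card S + dim B = dim Z"
proof -
  have fS: "finite S" and SZ: "S \<subseteq> quotient_space Z B"
    and ex1: "\<And>C. C \<in> quotient_space Z B \<Longrightarrow> \<exists>!c. c \<in> S \<rightarrow>\<^sub>E UNIV \<and> C = coset_lincomb B S c"
    using S by (auto simp: quotient_basis_def)
  have "\<forall>C\<in>S. \<exists>z. z \<in> Z \<and> C = z +o B"
    using SZ by (auto simp: quotient_space_def)
  then obtain p where p: "\<And>C. C \<in> S \<Longrightarrow> p C \<in> Z" "\<And>C. C \<in> S \<Longrightarrow> C = p C +o B"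
    by metis
  have lc: "coset_lincomb B S c = (\<Sum>C\<in>S. c C *\<^sub>R p C) +o B" for c
    using coset_lincomb_eq[OF B(1) fS p(2)] .
  have inj: "inj_on p S"
    using p(2) by (metis inj_onI)
  obtain C0 where C0: "C0 \<subseteq> B" "independent C0" "B \<subseteq> span C0" "card C0 = dim B"
    by (rule basis_exists)
  have C0Z: "C0 \<subseteq> span W" using C0(1) B(2) W(1) by auto
  have fC0: "finite C0"
    using independent_span_bound[OF W(2) C0(2) C0Z] by blast
  have spC0: "span C0 = B"
    using C0(1,3) B(1) by (simp add: span_minimal subset_antisym)
  \<comment> \<open>Both \<open>c\<close> and the zero function represent the coset
    \<open>B\<close>. They are restricted to \<open>S\<close> because uniqueness is asserted among
    extensional functions.\<close>
  have zero: "c C = 0" if "(\<Sum>C\<in>S. c C *\<^sub>R p C) \<in> B" "C \<in> S" for c C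
  proof -
    let ?c = "restrict c S" and ?z = "restrict (\<lambda>_. 0) S"
    have s: "(\<Sum>C\<in>S. ?c C *\<^sub>R p C) = (\<Sum>C\<in>S. c C *\<^sub>R p C)"
      by (intro sum.cong) auto
    have s0: "(\<Sum>C\<in>S. ?z C *\<^sub>R p C) = 0"
      by (intro sum.neutral) auto
    have "(0::'v) \<in> Z" using Z by (rule subspace_0)
    then have 1: "0 +o B \<in> quotient_space Z B" by (auto simp only: quotient_space_def)
    have a: "0 +o B = coset_lincomb B S ?c"
      unfolding lc s using that(1) elt_coset_eq_iff[OF B(1), of 0] subspace_neg[OF B(1)]
      by (metis diff_0)
    have b: "0 +o B = coset_lincomb B S ?z"
      unfolding lc s0 ..
    have "?c = ?z"
    proof -
      from ex1[OF 1] obtain d where d: "\<forall>c. c \<in> S \<rightarrow>\<^sub>E UNIV \<and> 0 +o B = coset_lincomb B S c \<longrightarrow> c = d"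
        by (elim ex1E) blast
      have "?c = d" by (rule d[rule_format]) (intro conjI a, simp)
      moreover have "?z = d" by (rule d[rule_format]) (intro conjI b, simp)
      ultimately show ?thesis by simp
    qed
    then have "?c C = ?z C" by (rule fun_cong)
    then show ?thesis using that(2) by simp
  qed
  \<comment> \<open>A representative inside \<open>B\<close> would be a combination with one
    coefficient equal to 1, against \<open>zero\<close>.\<close>
  have disj: "C0 \<inter> p ` S = {}"
  proof (rule ccontr)
    assume "C0 \<inter> p ` S \<noteq> {}"
    then obtain C where C: "C \<in> S" "p C \<in> B" using C0(1) by auto
    have "(\<Sum>D\<in>S. (if D = C then 1 else 0) *\<^sub>R p D) = (\<Sum>D\<in>S. if D = C then p D else 0)"
      by (intro sum.cong) auto
    also have "\<dots> = p C" using fS C(1) by simp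
    finally have "(\<Sum>D\<in>S. (if D = C then 1 else 0) *\<^sub>R p D) \<in> B" using C(2) by simp
    from zero[OF this C(1)] show False by simp
  qed
  have ind: "independent (C0 \<union> p ` S)"
  proof
    assume "dependent (C0 \<union> p ` S)"
    then obtain u where u: "\<exists>v\<in>C0 \<union> p ` S. u v \<noteq> 0" "(\<Sum>v\<in>C0 \<union> p ` S. u v *\<^sub>R v) = 0"
      using dependent_finite[of "C0 \<union> p ` S"] fC0 fS by blast
    have "(\<Sum>v\<in>C0 \<union> p ` S. u v *\<^sub>R v) = (\<Sum>v\<in>C0. u v *\<^sub>R v) + (\<Sum>C\<in>S. u (p C) *\<^sub>R p C)"
      using sum.union_disjoint[OF fC0 _ disj] fS by (simp add: sum.reindex[OF inj])
    then have eq: "(\<Sum>C\<in>S. u (p C) *\<^sub>R p C) = - (\<Sum>v\<in>C0. u v *\<^sub>R v)"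
      using u(2) by (simp add: eq_neg_iff_add_eq_0 add.commute)
    have "(\<Sum>v\<in>C0. u v *\<^sub>R v) \<in> B"
      using C0(1) by (intro subspace_sum[OF B(1)] subspace_scale[OF B(1)]) auto
    then have "(\<Sum>C\<in>S. u (p C) *\<^sub>R p C) \<in> B"
      unfolding eq using B(1) by (rule subspace_neg[rotated])
    note z = zero[OF this]
    then have "(\<Sum>v\<in>C0. u v *\<^sub>R v) = 0" using eq by simp
    then have "\<forall>v\<in>C0. u v = 0" using C0(2) dependent_finite[OF fC0] by meson
    then show False using u(1) z by auto
  qed
  have sub: "C0 \<union> p ` S \<subseteq> Z" using C0(1) B(2) p(1) by auto
  have sp: "Z \<subseteq> span (C0 \<union> p ` S)"
  proof
    fix z assume "z \<in> Z"
    then have "z +o B \<in> quotient_space Z B" by (auto simp: quotient_space_def)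
    from ex1[OF this] obtain c where "z +o B = coset_lincomb B S c" by blast
    then have b: "z - (\<Sum>C\<in>S. c C *\<^sub>R p C) \<in> B"
      unfolding lc elt_coset_eq_iff[OF B(1)] .
    have "(\<Sum>C\<in>S. c C *\<^sub>R p C) \<in> span (p ` S)"
      by (intro span_sum span_scale span_base) auto
    with b have "(\<Sum>C\<in>S. c C *\<^sub>R p C) + (z - (\<Sum>C\<in>S. c C *\<^sub>R p C)) \<in> span (C0 \<union> p ` S)"
      using spC0 by (intro span_add) (meson subsetD span_mono Un_upper1 Un_upper2)+
    then show "z \<in> span (C0 \<union> p ` S)" by simp
  qed
  have "card (C0 \<union> p ` S) = dim Z"
    using basis_card_eq_dim[OF sub sp ind] .
  then show ?thesis
    using card_Un_disjoint[OF fC0 _ disj] fS card_image[OF inj] C0(4) by simp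
qed

text \<open>The basis consists of the cosets of the vectors \<open>D\<close> that complete a basis
  of \<open>B\<close> to one of \<open>Z\<close>.\<close>

lemma quotient_basis_exists:
  fixes Z B :: "'v::real_vector set"
  assumes Z: "subspace Z" and B: "subspace B" "B \<subseteq> Z" and W: "Z \<subseteq> span W" "finite W"
  shows "\<exists>S. quotient_basis Z B S"
proof -
  obtain C where C: "C \<subseteq> B" "independent C" "B \<subseteq> span C" "card C = dim B"
    by (rule basis_exists)
  have CZ: "C \<subseteq> Z" using C(1) B(2) by auto
  obtain D where D: "C \<inter> D = {}" "C \<union> D \<subseteq> Z" "independent (C \<union> D)" "Z \<subseteq> span (C \<union> D)"
    "finite C" "finite D" "card C + card D = dim Z"
    by (rule finite_basis_extend[OF Z W C(2) CZ])
  have spC: "span C = B"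
    using C(1,3) B(1) by (simp add: span_minimal subset_antisym)
  define q where "q r = r +o B" for r
  have zero: "u r = 0" if "(\<Sum>r\<in>D. u r *\<^sub>R r) \<in> B" "r \<in> D" for u r
  proof -
    from that(1) obtain w where w: "(\<Sum>r\<in>D. u r *\<^sub>R r) = (\<Sum>r\<in>C. w r *\<^sub>R r)"
      unfolding spC[symmetric] span_finite[OF D(5)] by auto
    define h where "h v = (if v \<in> D then u v else - w v)" for v
    have "(\<Sum>v\<in>C \<union> D. h v *\<^sub>R v) = (\<Sum>v\<in>C. h v *\<^sub>R v) + (\<Sum>v\<in>D. h v *\<^sub>R v)"
      using D(1,5,6) by (intro sum.union_disjoint) auto
    also have "(\<Sum>v\<in>D. h v *\<^sub>R v) = (\<Sum>v\<in>D. u v *\<^sub>R v)"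
      by (simp add: h_def)
    also have "(\<Sum>v\<in>C. h v *\<^sub>R v) = - (\<Sum>v\<in>C. w v *\<^sub>R v)"
      unfolding sum_negf[symmetric] using D(1) by (intro sum.cong) (auto simp: h_def)
    finally have s0: "(\<Sum>v\<in>C \<union> D. h v *\<^sub>R v) = 0"
      using w by simp
    have "h r = 0"
      using D(3,5,6) s0 that by (metis dependent_finite finite_UnI UnI2)
    then show ?thesis using that(2) by (simp add: h_def)
  qed
  have inj: "inj_on q D"
  proof (rule inj_onI)
    fix x y assume xy: "x \<in> D" "y \<in> D" "q x = q y"
    then have mem: "x - y \<in> B" by (simp add: q_def elt_coset_eq_iff[OF B(1)])
    show "x = y"
    proof (rule ccontr)
      assume ne: "x \<noteq> y"
      have "(\<Sum>r\<in>D. ((if r = x then 1 else 0) - (if r = y then 1 else 0)) *\<^sub>R r)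
          = (\<Sum>r\<in>D. if r = x then r else 0) - (\<Sum>r\<in>D. if r = y then r else 0)"
        unfolding sum_subtractf[symmetric] by (intro sum.cong) auto
      also have "\<dots> = x - y" using D(6) xy by simp
      finally have "(\<Sum>r\<in>D. ((if r = x then 1 else 0) - (if r = y then 1 else 0)) *\<^sub>R r) \<in> B"
        using mem by simp
      from zero[OF this xy(1)] ne show False by simp
    qed
  qed
  define p where "p = inv_into D q"
  have pq: "p (q r) = r" if "r \<in> D" for r
    using inj that by (simp add: p_def)
  have fS: "finite (q ` D)" using D(6) by simp
  have pS: "E = p E +o B" if "E \<in> q ` D" for E
    using that pq by (auto simp: q_def)
  have lc: "coset_lincomb B (q ` D) c = (\<Sum>r\<in>D. c (q r) *\<^sub>R r) +o B" for c
  proof -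
    have "(\<Sum>E\<in>q ` D. c E *\<^sub>R p E) = (\<Sum>r\<in>D. c (q r) *\<^sub>R r)"
      unfolding sum.reindex[OF inj] by (intro sum.cong) (auto simp: pq)
    then show ?thesis using coset_lincomb_eq[OF B(1) fS pS] by simp
  qed
  have "quotient_basis Z B (q ` D)"
    unfolding quotient_basis_def
  proof (intro conjI ballI)
    show "finite (q ` D)" by (fact fS)
    show "q ` D \<subseteq> quotient_space Z B" using D(2) by (auto simp: q_def quotient_space_def)
    fix E assume "E \<in> quotient_space Z B"
    then obtain z where z: "z \<in> Z" "E = z +o B" by (auto simp: quotient_space_def)
    then have "z \<in> span (C \<union> D)" using D(4) by auto
    then obtain a b where ab: "z = a + b" "a \<in> span C" "b \<in> span D"
      unfolding span_Un by blast
    from ab(3) obtain u where u: "b = (\<Sum>r\<in>D. u r *\<^sub>R r)"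
      unfolding span_finite[OF D(6)] by auto
    define c where "c = restrict (u \<circ> p) (q ` D)"
    show "\<exists>!c. c \<in> (q ` D) \<rightarrow>\<^sub>E UNIV \<and> E = coset_lincomb B (q ` D) c"
    proof (rule ex1I[of _ c], intro conjI)
      show "c \<in> (q ` D) \<rightarrow>\<^sub>E UNIV" by (simp add: c_def)
      have "(\<Sum>r\<in>D. c (q r) *\<^sub>R r) = b"
        unfolding u by (intro sum.cong) (auto simp: c_def pq)
      then show "E = coset_lincomb B (q ` D) c"
        unfolding lc z(2) elt_coset_eq_iff[OF B(1)] using ab(1,2) spC by simp
      fix c' assume c': "c' \<in> (q ` D) \<rightarrow>\<^sub>E UNIV \<and> E = coset_lincomb B (q ` D) c'"
      then have "(\<Sum>r\<in>D. c' (q r) *\<^sub>R r) +o B = (\<Sum>r\<in>D. c (q r) *\<^sub>R r) +o B"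
        using \<open>E = coset_lincomb B (q ` D) c\<close> unfolding lc by metis
      then have "(\<Sum>r\<in>D. (c' (q r) - c (q r)) *\<^sub>R r) \<in> B"
        unfolding elt_coset_eq_iff[OF B(1)] by (simp add: sum_subtractf scaleR_diff_left)
      from zero[OF this] have "c' (q r) = c (q r)" if "r \<in> D" for r using that by simp
      then show "c' = c"
        using c' by (intro PiE_ext[of c' "q ` D" "\<lambda>_. UNIV" c]) (auto simp: c_def)
    qed
  qed
  then show ?thesis by blast
qed

text \<open>The definite description in \<open>quotient_dim\<close> is meaningful because all
  quotient bases have the same size. The additive form stays clear of truncated subtraction.\<close>

lemma quotient_dim_plus_dim:
  fixes Z B :: "'v::real_vector set"
  assumes "subspace Z" "subspace B" "B \<subseteq> Z" "Z \<subseteq> span W" "finite W"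
  shows "quotient_dim Z B + dim B = dim Z"
proof -
  note card = quotient_basis_card[OF assms]
  obtain S where S: "quotient_basis Z B S"
    using quotient_basis_exists[OF assms] by blast
  have "quotient_dim Z B = card S"
    unfolding quotient_dim_def
  proof (rule the_equality)
    show "\<exists>T. quotient_basis Z B T \<and> card T = card S" using S by blast
    fix d assume "\<exists>T. quotient_basis Z B T \<and> card T = d"
    then obtain T where "quotient_basis Z B T" "d = card T" by blast
    then show "d = card S" using card[OF S] card[of T] by simp
  qed
  then show ?thesis using card[OF S] by simp
qed

section \<open>The differential of a cochain is a cochain\<close>

text \<open>Split lists replace list updates from here on, since deletion of positions by
  \<open>nths\<close> distributes over \<open>us @ x # vs\<close>.\<close>

lemma cochain_lin:
  assumes "subspace (carr g)" "f \<in> cochains g k" "us @ x # vs \<in> arg_lists g k" "y \<in> carr g"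
  shows "f (us @ (a *\<^sub>R x + b *\<^sub>R y) # vs) = a * f (us @ x # vs) + b * f (us @ y # vs)"
proof -
  let ?xs = "us @ x # vs"
  have x: "x \<in> carr g" and l: "length us < k"
    using assms(3) by (auto simp: arg_lists_def)
  have "f (?xs[length us := a *\<^sub>R x + b *\<^sub>R y])
      = f (?xs[length us := a *\<^sub>R x]) + f (?xs[length us := b *\<^sub>R y])"
    using assms(2-4) l x subspace_scale[OF assms(1)] unfolding cochains_def by blast
  also have "f (?xs[length us := a *\<^sub>R x]) = a * f (?xs[length us := x])"
    using assms(2-4) l x unfolding cochains_def by blast
  also have "f (?xs[length us := b *\<^sub>R y]) = b * f (?xs[length us := y])"
    using assms(2-4) l x unfolding cochains_def by blast
  finally show ?thesis by simp
qed

lemma swap_update_append: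
  "(us @ x # ws @ y # vs)[length us := y, length us + Suc (length ws) := x] = us @ y # ws @ x # vs"
  by (simp add: list_update_append)

lemma cochain_swap:
  assumes "f \<in> cochains g k" "us @ x # ws @ y # vs \<in> arg_lists g k"
  shows "f (us @ y # ws @ x # vs) = - f (us @ x # ws @ y # vs)"
proof -
  let ?xs = "us @ x # ws @ y # vs" and ?i = "length us" and ?j = "length us + Suc (length ws)"
  have "?j < k" "?i < ?j"
    using assms(2) by (auto simp: arg_lists_def)
  then have "f (?xs[?i := ?xs ! ?j, ?j := ?xs ! ?i]) = - f ?xs"
    using assms unfolding cochains_def by blast
  moreover have "?xs ! ?i = x" "?xs ! ?j = y"
    by (simp_all add: nth_append)
  ultimately show ?thesis
    by (simp only: swap_update_append)
qed

lemma cochain_dup: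
  assumes "f \<in> cochains g k" "us @ x # ws @ x # vs \<in> arg_lists g k"
  shows "f (us @ x # ws @ x # vs) = 0"
  using cochain_swap[OF assms] by simp

text \<open>The entry \<open>c\<close> leaves the gap, the induction hypothesis handles the shorter
  gap, and \<open>c\<close> returns: three changes of sign. Closure of \<open>L\<close> under
  permutations keeps every intermediate list in \<open>L\<close>.\<close>

lemma adjacent_swap_imp_swap:
  fixes f :: "'a list \<Rightarrow> real"
  assumes "\<And>us x y vs. us @ x # y # vs \<in> L \<Longrightarrow> f (us @ y # x # vs) = - f (us @ x # y # vs)"
    and "\<And>xs ys. mset xs = mset ys \<Longrightarrow> xs \<in> L \<Longrightarrow> ys \<in> L"
    and "us @ x # ws @ y # vs \<in> L"
  shows "f (us @ y # ws @ x # vs) = - f (us @ x # ws @ y # vs)"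
  using assms(3)
proof (induction ws arbitrary: us)
  case Nil
  then show ?case using assms(1)[of us x y vs] by simp
next
  case (Cons c ws)
  have 1: "(us @ [c]) @ x # ws @ y # vs \<in> L" and 2: "us @ c # y # ws @ x # vs \<in> L"
    by (rule assms(2)[OF _ Cons.prems], simp)+
  have "f (us @ y # (c # ws) @ x # vs) = - f (us @ c # y # ws @ x # vs)"
    using assms(1)[OF 2] by simp
  also have "f (us @ c # y # ws @ x # vs) = - f (us @ c # x # ws @ y # vs)"
    using Cons.IH[OF 1] by simp
  also have "f (us @ c # x # ws @ y # vs) = - f (us @ x # c # ws @ y # vs)"
    using assms(1)[of us x c "ws @ y # vs"] Cons.prems by simp
  finally show ?case by simp
qed

text \<open>Antisymmetry is demanded for adjacent arguments only, because the effect of such a swap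
  on the summands of the differential is easy to follow.\<close>

lemma cochainsI:
  assumes "subspace (carr g)"
    and zero: "\<And>xs. xs \<notin> arg_lists g k \<Longrightarrow> f xs = 0"
    and lin: "\<And>us x y vs a b. us @ x # vs \<in> arg_lists g k \<Longrightarrow> y \<in> carr g \<Longrightarrow>
      f (us @ (a *\<^sub>R x + b *\<^sub>R y) # vs) = a * f (us @ x # vs) + b * f (us @ y # vs)"
    and adj: "\<And>us x y vs. us @ x # y # vs \<in> arg_lists g k \<Longrightarrow>
      f (us @ y # x # vs) = - f (us @ x # y # vs)"
  shows "f \<in> cochains g k"
  unfolding cochains_def
proof (intro CollectI conjI ballI allI impI)
  fix xs assume "xs \<notin> arg_lists g k"
  then show "f xs = 0" by (rule zero)
next
  fix xs i x y c
  assume xs: "xs \<in> arg_lists g k" and i: "i < k" and x: "x \<in> carr g" and y: "y \<in> carr g"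
  have len: "length xs = k" using xs by (simp add: arg_lists_def)
  have up: "xs[i := z] = take i xs @ z # drop (Suc i) xs" for z
    using i len by (simp add: upd_conv_take_nth_drop)
  have mem: "take i xs @ x # drop (Suc i) xs \<in> arg_lists g k"
    using xs i x by (auto simp: arg_lists_def dest: in_set_takeD in_set_dropD)
  show "f (xs[i := x + y]) = f (xs[i := x]) + f (xs[i := y])"
    using lin[OF mem y, of 1 1] unfolding up by simp
  show "f (xs[i := c *\<^sub>R x]) = c * f (xs[i := x])"
    using lin[OF mem x, of c 0] unfolding up by simp
next
  fix xs j i
  assume xs: "xs \<in> arg_lists g k" and j: "j < k" and i: "i < j"
  define us ws vs where "us = take i xs" and "ws = take (j - Suc i) (drop (Suc i) xs)"
    and "vs = drop (Suc j) xs"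
  have len: "length xs = k" using xs by (simp add: arg_lists_def)
  have "drop (Suc i) xs = ws @ drop (j - Suc i) (drop (Suc i) xs)"
    unfolding ws_def by (rule append_take_drop_id[symmetric])
  also have "drop (j - Suc i) (drop (Suc i) xs) = xs ! j # vs"
    using i j len by (simp add: vs_def Cons_nth_drop_Suc)
  finally have "drop (Suc i) xs = ws @ xs ! j # vs" .
  then have eq: "xs = us @ xs ! i # ws @ xs ! j # vs"
    using i j len unfolding us_def by (metis id_take_nth_drop less_trans)
  have l: "length us = i" "length us + Suc (length ws) = j"
    using i j len by (auto simp: us_def ws_def)
  have perm: "ys \<in> arg_lists g k" if "mset xs = mset ys" "xs \<in> arg_lists g k" for xs ys
    using that by (auto simp: arg_lists_def dest: mset_eq_length mset_eq_setD)
  have "xs[i := xs ! j, j := xs ! i] = us @ xs ! j # ws @ xs ! i # vs"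
    using swap_update_append[of us "xs ! i" ws "xs ! j" vs] l eq by metis
  moreover have "us @ xs ! i # ws @ xs ! j # vs \<in> arg_lists g k"
    using xs eq by metis
  then have "f (us @ xs ! j # ws @ xs ! i # vs) = - f (us @ xs ! i # ws @ xs ! j # vs)"
    by (rule adjacent_swap_imp_swap[rotated 2]) (fact adj, fact perm)
  ultimately show "f (xs[i := xs ! j, j := xs ! i]) = - f xs"
    using eq by metis
qed

section \<open>The single summands of the differential\<close>

definition index_pairs :: "nat \<Rightarrow> (nat \<times> nat) set" where
  "index_pairs k = {(i, j). i < j \<and> j \<le> k}"

definition ce_term :: "'a lie_alg \<Rightarrow> ('a list \<Rightarrow> real) \<Rightarrow> 'a list \<Rightarrow> nat \<times> nat \<Rightarrow> real" where
  "ce_term g f xs = (\<lambda>(i, j). (-1) ^ (i + j) * f (brk g (xs ! i) (xs ! j) # nths xs (- {i, j})))"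

lemma finite_index_pairs [simp]: "finite (index_pairs k)"
  by (rule finite_subset[of _ "{..k} \<times> {..k}"]) (auto simp: index_pairs_def)

text \<open>As one sum over pairs, the differential can be reindexed by a transposition of
  positions.\<close>

lemma ce_diff_eq:
  "xs \<in> arg_lists g (Suc k) \<Longrightarrow> ce_diff g k f xs = sum (ce_term g f xs) (index_pairs k)"
proof -
  assume xs: "xs \<in> arg_lists g (Suc k)"
  have "(\<Sum>j\<le>k. \<Sum>i<j. ce_term g f xs (i, j)) = (\<Sum>(j, i)\<in>(SIGMA j:{..k}. {..<j}). ce_term g f xs (i, j))"
    by (simp add: sum.Sigma)
  also have "\<dots> = sum (ce_term g f xs) (index_pairs k)"
    by (rule sum.reindex_bij_witness[of _ "\<lambda>(i, j). (j, i)" "\<lambda>(j, i). (i, j)"])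
      (auto simp: index_pairs_def)
  finally show ?thesis
    using xs by (simp add: ce_diff_def ce_term_def)
qed

lemma nths_append_Cons:
  "nths (us @ x # vs) A =
    nths us A @ (if length us \<in> A then [x] else []) @ nths vs {j. j + Suc (length us) \<in> A}"
  by (simp add: nths_append nths_Cons)

lemma length_nths_Compl_pair:
  assumes "(i, j) \<in> index_pairs k" "length xs = Suc k"
  shows "Suc (length (nths xs (- {i, j}))) = k"
proof -
  have "{l. l < length xs \<and> l \<in> - {i, j}} = {..k} - {i, j}"
    using assms by auto
  moreover have "card ({..k} - {i, j}) = card {..k} - card {i, j}"
    using assms by (intro card_Diff_subset) (auto simp: index_pairs_def)
  moreover have "1 \<le> k" using assms by (auto simp: index_pairs_def)
  ultimately show ?thesis
    using assms by (auto simp: length_nths index_pairs_def)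
qed

lemma ce_term_arg:
  assumes "lie_algebra g" "(i, j) \<in> index_pairs k" "xs \<in> arg_lists g (Suc k)" "z \<in> carr g"
  shows "z # nths xs (- {i, j}) \<in> arg_lists g k"
  using assms length_nths_Compl_pair[OF assms(2), of xs] set_nths_subset[of xs "- {i, j}"]
  by (auto simp: arg_lists_def)

lemma brk_closed: "lie_algebra g \<Longrightarrow> x \<in> carr g \<Longrightarrow> y \<in> carr g \<Longrightarrow> brk g x y \<in> carr g"
  by (simp add: lie_algebra_def)

lemma brk_lin1:
  assumes "lie_algebra g" "x \<in> carr g" "y \<in> carr g" "z \<in> carr g"
  shows "brk g (a *\<^sub>R x + b *\<^sub>R y) z = a *\<^sub>R brk g x z + b *\<^sub>R brk g y z"
proof -
  have "a *\<^sub>R x \<in> carr g" "b *\<^sub>R y \<in> carr g"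
    using assms by (auto simp: lie_algebra_def subspace_scale)
  then show ?thesis using assms by (simp add: lie_algebra_def)
qed

lemma brk_lin2:
  assumes "lie_algebra g" "x \<in> carr g" "y \<in> carr g" "z \<in> carr g"
  shows "brk g z (a *\<^sub>R x + b *\<^sub>R y) = a *\<^sub>R brk g z x + b *\<^sub>R brk g z y"
proof -
  have "a *\<^sub>R x \<in> carr g" "b *\<^sub>R y \<in> carr g"
    using assms by (auto simp: lie_algebra_def subspace_scale)
  then show ?thesis using assms by (simp add: lie_algebra_def)
qed

lemma brk_skew:
  assumes "lie_algebra g" "x \<in> carr g" "y \<in> carr g"
  shows "brk g y x = - brk g x y"
proof -
  have s: "x + y \<in> carr g" and z: "brk g x x = 0" "brk g y y = 0" "brk g (x + y) (x + y) = 0"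
    using assms by (auto simp: lie_algebra_def subspace_add)
  have "brk g (x + y) (x + y) = brk g x (x + y) + brk g y (x + y)"
    using brk_lin1[OF assms s, of 1 1] by simp
  also have "\<dots> = (brk g x x + brk g x y) + (brk g y x + brk g y y)"
    using brk_lin2[OF assms assms(2), of 1 1] brk_lin2[OF assms assms(3), of 1 1] by simp
  finally show ?thesis using z by (simp add: eq_neg_iff_add_eq_0 add.commute)
qed

text \<open>The varied argument is the left entry of the bracket, the right entry, or one of the
  remaining arguments. In the first two cases it reaches \<open>f\<close> only through the bracket
  in head position; in the third the bracket is constant.\<close>

lemma ce_term_lin:
  assumes g: "lie_algebra g" and f: "f \<in> cochains g k" and ij: "p \<in> index_pairs k"
    and mem: "us @ x # vs \<in> arg_lists g (Suc k)" and y: "y \<in> carr g"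
  shows "ce_term g f (us @ (a *\<^sub>R x + b *\<^sub>R y) # vs) p =
    a * ce_term g f (us @ x # vs) p + b * ce_term g f (us @ y # vs) p"
proof -
  obtain i j where p: "p = (i, j)" by force
  have lt: "i < j" "j \<le> k" "length (us @ x # vs) = Suc k"
    using ij p mem by (auto simp: index_pairs_def arg_lists_def)
  have sub: "subspace (carr g)" using g by (simp add: lie_algebra_def)
  have x: "x \<in> carr g" and in_carr: "\<And>l. l \<le> k \<Longrightarrow> (us @ x # vs) ! l \<in> carr g"
  proof -
    show "x \<in> carr g" using mem by (simp add: arg_lists_def)
    have "set (us @ x # vs) \<subseteq> carr g" using mem by (simp only: arg_lists_def mem_Collect_eq)
    moreover have "l < length (us @ x # vs)" if "l \<le> k" for l
      using that lt(3) by linarith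
    ultimately show "(us @ x # vs) ! l \<in> carr g" if "l \<le> k" for l
      using that nth_mem by blast
  qed
  define z where "z = a *\<^sub>R x + b *\<^sub>R y"
  let ?A = "- {i, j}"
  let ?W = "nths vs {n. n + Suc (length us) \<in> ?A}"
  have nth_same: "(us @ w # vs) ! l = (us @ x # vs) ! l" if "l \<noteq> length us" for l w
    using that by (auto simp: nth_append nth_Cons split: nat.splits)
  consider "i = length us" | "j = length us" | "i \<noteq> length us" "j \<noteq> length us" by blast
  then show ?thesis
  proof cases
    case 1
    let ?v = "(us @ x # vs) ! j"
    have v: "?v \<in> carr g" using in_carr lt by simp
    have t: "ce_term g f (us @ w # vs) p = (-1) ^ (i + j) * f (brk g w ?v # nths us ?A @ ?W)" for w
      using 1 lt(1) nth_same[of j w] by (simp add: ce_term_def p nths_append_Cons)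
    have "brk g x ?v # nths us ?A @ ?W \<in> arg_lists g k"
      using ce_term_arg[OF g ij[unfolded p] mem brk_closed[OF g x v]] 1 by (simp add: nths_append_Cons)
    from cochain_lin[OF sub f, of "[]", simplified, OF this brk_closed[OF g y v]]
    show ?thesis
      unfolding t brk_lin1[OF g x y v] by (simp add: algebra_simps)
  next
    case 2
    let ?v = "(us @ x # vs) ! i"
    have v: "?v \<in> carr g" using in_carr lt by simp
    have t: "ce_term g f (us @ w # vs) p = (-1) ^ (i + j) * f (brk g ?v w # nths us ?A @ ?W)" for w
      using 2 lt(1) nth_same[of i w] by (simp add: ce_term_def p nths_append_Cons)
    have "brk g ?v x # nths us ?A @ ?W \<in> arg_lists g k"
      using ce_term_arg[OF g ij[unfolded p] mem brk_closed[OF g v x]] 2 by (simp add: nths_append_Cons)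
    from cochain_lin[OF sub f, of "[]", simplified, OF this brk_closed[OF g v y]]
    show ?thesis
      unfolding t brk_lin2[OF g x y v] by (simp add: algebra_simps)
  next
    case 3
    let ?u = "brk g ((us @ x # vs) ! i) ((us @ x # vs) ! j)"
    have u: "?u \<in> carr g" using in_carr lt by (intro brk_closed[OF g]) auto
    have t: "ce_term g f (us @ w # vs) p = (-1) ^ (i + j) * f ((?u # nths us ?A) @ w # ?W)" for w
      using 3 nth_same[of i w] nth_same[of j w] by (simp add: ce_term_def p nths_append_Cons)
    have "(?u # nths us ?A) @ x # ?W \<in> arg_lists g k"
      using ce_term_arg[OF g ij[unfolded p] mem u] 3 by (simp add: nths_append_Cons)
    from cochain_lin[OF sub f this y]
    show ?thesis
      unfolding t by (simp add: algebra_simps)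
  qed
qed

text \<open>If the bracket uses neither swapped position, the pair stays fixed and the sign comes
  from \<open>f\<close>. If it uses exactly one, \<open>f\<close> receives the same arguments as
  before, while \<open>i + j\<close> changes by one. Both positions are used only by the excluded
  pair.\<close>

lemma ce_term_adjacent_swap:
  assumes g: "lie_algebra g" and f: "f \<in> cochains g k" and ij: "(i, j) \<in> index_pairs k"
    and mem: "us @ x # y # vs \<in> arg_lists g (Suc k)"
    and ne: "(i, j) \<noteq> (length us, Suc (length us))"
  defines "\<tau> \<equiv> Transposition.transpose (length us) (Suc (length us))"
  shows "ce_term g f (us @ y # x # vs) (\<tau> i, \<tau> j) = - ce_term g f (us @ x # y # vs) (i, j)"
proof -
  let ?l = "length us" and ?xs = "us @ x # y # vs" and ?ys = "us @ y # x # vs"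
  have lt: "i < j" "j \<le> k" "length ?xs = Suc k"
    using ij mem by (auto simp: index_pairs_def arg_lists_def)
  have nth: "?ys ! \<tau> n = ?xs ! n" for n
    by (auto simp: \<tau>_def Transposition.transpose_def nth_append nth_Cons split: nat.splits)
  let ?W = "nths vs {n. n + Suc (Suc ?l) \<in> - {i, j}}" and ?U = "nths us (- {i, j})"
  have dec: "nths (us @ c # d # vs) (- {\<tau> i, \<tau> j}) =
     ?U @ (if \<tau> ?l \<in> {i, j} then [] else [c]) @ (if \<tau> (Suc ?l) \<in> {i, j} then [] else [d]) @ ?W" for c d
  proof -
    have in_iff: "n \<in> - {\<tau> i, \<tau> j} \<longleftrightarrow> \<tau> n \<in> - {i, j}" for n
      by (auto simp: \<tau>_def)
    have U: "nths us (- {\<tau> i, \<tau> j}) = ?U"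
      unfolding nths_def
      by (intro arg_cong[of _ _ "map fst"] filter_cong refl)
        (auto simp: in_set_zip \<tau>_def Transposition.transpose_def split: if_splits)
    have W: "{n. n + Suc (Suc ?l) \<in> - {\<tau> i, \<tau> j}} = {n. n + Suc (Suc ?l) \<in> - {i, j}}"
      by (auto simp: \<tau>_def Transposition.transpose_def split: if_splits)
    have "nths (us @ c # d # vs) A = nths us A @ (if ?l \<in> A then [c] else []) @
        (if Suc ?l \<in> A then [d] else []) @ nths vs {n. n + Suc (Suc ?l) \<in> A}" for A
      by (simp add: nths_append_Cons nths_Cons)
    from this[of "- {\<tau> i, \<tau> j}"] show ?thesis
      unfolding U W unfolding in_iff by simp
  qed
  have dec0: "nths ?xs (- {i, j}) =
     ?U @ (if ?l \<in> {i, j} then [] else [x]) @ (if Suc ?l \<in> {i, j} then [] else [y]) @ ?W"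
    by (simp add: nths_append_Cons nths_Cons)
  define u where "u = brk g (?xs ! i) (?xs ! j)"
  have ucarr: "u \<in> carr g"
    unfolding u_def using mem lt nth_mem[of i ?xs] nth_mem[of j ?xs]
    by (intro brk_closed[OF g]) (auto simp: arg_lists_def)
  note arg = ce_term_arg[OF g ij mem ucarr]
  have \<tau>l: "\<tau> ?l = Suc ?l" "\<tau> (Suc ?l) = ?l" by (simp_all add: \<tau>_def)
  have "ce_term g f ?ys (\<tau> i, \<tau> j) = (-1) ^ (\<tau> i + \<tau> j) * f (u # nths ?ys (- {\<tau> i, \<tau> j}))"
    by (simp add: ce_term_def u_def nth)
  also have "\<dots> = - ((-1) ^ (i + j) * f (u # nths ?xs (- {i, j})))"
  proof -
    consider "?l \<notin> {i, j}" "Suc ?l \<notin> {i, j}" | "?l \<in> {i, j}" "Suc ?l \<notin> {i, j}"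
      | "?l \<notin> {i, j}" "Suc ?l \<in> {i, j}"
    proof -
      have "\<not> (?l \<in> {i, j} \<and> Suc ?l \<in> {i, j})" using ne lt(1) by auto
      then show thesis using that by blast
    qed
    then show ?thesis
    proof cases
      case 1
      then have "\<tau> i = i" "\<tau> j = j" by (auto simp: \<tau>_def Transposition.transpose_def)
      moreover have "(u # ?U) @ x # [] @ y # ?W \<in> arg_lists g k"
        using arg 1 unfolding dec0 by simp
      from cochain_swap[OF f this] have "f ((u # ?U) @ y # x # ?W) = - f ((u # ?U) @ x # y # ?W)"
        by simp
      ultimately show ?thesis unfolding dec dec0 \<tau>l using 1 by simp
    next
      case 2
      then have "(- 1 :: real) ^ (\<tau> i + \<tau> j) = - ((- 1) ^ (i + j))"
        using lt(1) by (auto simp: \<tau>_def Transposition.transpose_def)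
      then show ?thesis unfolding dec dec0 \<tau>l using 2 by simp
    next
      case 3
      then have "(- 1 :: real) ^ (\<tau> i + \<tau> j) = - ((- 1) ^ (i + j))"
        using lt(1) by (auto simp: \<tau>_def Transposition.transpose_def)
      then show ?thesis unfolding dec dec0 \<tau>l using 3 by simp
    qed
  qed
  finally show ?thesis by (simp add: ce_term_def u_def)
qed

lemma ce_diff_cochain:
  assumes g: "lie_algebra g" and f: "f \<in> cochains g k"
  shows "ce_diff g k f \<in> cochains g (Suc k)"
proof (rule cochainsI)
  show sub: "subspace (carr g)" using g by (simp add: lie_algebra_def)
  show "ce_diff g k f xs = 0" if "xs \<notin> arg_lists g (Suc k)" for xs
    using that by (simp add: ce_diff_def)
  fix us x y vs
  {
    fix a b
    assume mem: "us @ x # vs \<in> arg_lists g (Suc k)" and y: "y \<in> carr g"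
    then have "us @ (a *\<^sub>R x + b *\<^sub>R y) # vs \<in> arg_lists g (Suc k)"
      and "us @ y # vs \<in> arg_lists g (Suc k)"
      using sub by (auto simp: arg_lists_def subspace_add subspace_scale)
    with mem show "ce_diff g k f (us @ (a *\<^sub>R x + b *\<^sub>R y) # vs) =
        a * ce_diff g k f (us @ x # vs) + b * ce_diff g k f (us @ y # vs)"
      by (simp add: ce_diff_eq ce_term_lin[OF g f _ mem y] sum.distrib sum_distrib_left)
  }
  assume mem: "us @ x # y # vs \<in> arg_lists g (Suc k)"
  then have mem': "us @ y # x # vs \<in> arg_lists g (Suc k)"
    by (auto simp: arg_lists_def)
  let ?xs = "us @ x # y # vs" and ?ys = "us @ y # x # vs"
  let ?p = "(length us, Suc (length us))"
  define \<tau> where "\<tau> = Transposition.transpose (length us) (Suc (length us))"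
  have p: "?p \<in> index_pairs k" using mem by (auto simp: index_pairs_def arg_lists_def)
  \<comment> \<open>Here the swap merely reverses the bracket, so the sign is that of
    \<open>brk_skew\<close>.\<close>
  have "ce_term g f ?ys ?p = - ce_term g f ?xs ?p"
  proof -
    have xy: "x \<in> carr g" "y \<in> carr g" using mem by (auto simp: arg_lists_def)
    have eq: "nths ?ys (- {length us, Suc (length us)}) = nths ?xs (- {length us, Suc (length us)})"
      by (simp add: nths_append_Cons nths_Cons)
    have nth: "(us @ c # d # vs) ! Suc (length us) = d" for c d :: 'a
      by (simp add: nth_append)
    have b: "brk g x y \<in> carr g" using brk_closed[OF g xy] .
    from ce_term_arg[OF g p mem b] b
    have "f (- brk g x y # nths ?xs (- {length us, Suc (length us)})) =
        - f (brk g x y # nths ?xs (- {length us, Suc (length us)}))"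
      using cochain_lin[OF sub f, of "[]" "brk g x y" _ "brk g x y" "-1" 0] by simp
    then show ?thesis
      using brk_skew[OF g xy] unfolding ce_term_def eq prod.case nth by simp
  qed
  \<comment> \<open>The involution \<open>\<tau>\<close> permutes the other pairs: the removed pair
    is the only one whose order it reverses.\<close>
  moreover have "sum (ce_term g f ?ys) (index_pairs k - {?p}) =
      (\<Sum>q\<in>index_pairs k - {?p}. - ce_term g f ?xs q)"
  proof (rule sum.reindex_bij_witness[where i = "map_prod \<tau> \<tau>" and j = "map_prod \<tau> \<tau>"])
    have closed: "map_prod \<tau> \<tau> q \<in> index_pairs k - {?p}" if "q \<in> index_pairs k - {?p}" for q
    proof -
      have "Suc (length us) \<le> k" using p by (auto simp: index_pairs_def)
      then show ?thesis
        using that by (auto simp: index_pairs_def \<tau>_def Transposition.transpose_def split: if_splits)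
    qed
    have inv: "map_prod \<tau> \<tau> (map_prod \<tau> \<tau> q) = q" for q
      by (cases q) (simp add: \<tau>_def)
    fix q assume q: "q \<in> index_pairs k - {?p}"
    show "map_prod \<tau> \<tau> q \<in> index_pairs k - {?p}" by (rule closed[OF q])
    show "map_prod \<tau> \<tau> q \<in> index_pairs k - {?p}" by (rule closed[OF q])
    show "map_prod \<tau> \<tau> (map_prod \<tau> \<tau> q) = q" by (rule inv)
    show "map_prod \<tau> \<tau> (map_prod \<tau> \<tau> q) = q" by (rule inv)
    obtain i j where ij: "map_prod \<tau> \<tau> q = (i, j)" by force
    have eq: "(\<tau> i, \<tau> j) = q" using inv[of q] ij by simp
    have "(i, j) \<in> index_pairs k" "(i, j) \<noteq> ?p" using closed[OF q] ij by auto
    from ce_term_adjacent_swap[OF g f this(1) mem this(2)]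
    have "ce_term g f ?ys q = - ce_term g f ?xs (i, j)"
      using eq unfolding \<tau>_def by simp
    then show "- ce_term g f ?xs (map_prod \<tau> \<tau> q) = ce_term g f ?ys q"
      using ij by simp
  qed
  ultimately show "ce_diff g k f ?ys = - ce_diff g k f ?xs"
    unfolding ce_diff_eq[OF mem] ce_diff_eq[OF mem']
    by (simp add: sum.remove[OF finite_index_pairs p] sum_negf)
qed

section \<open>Cochains in coordinates\<close>

definition supported :: "'b set \<Rightarrow> ('b \<Rightarrow> real) set" where
  "supported A = {\<phi>. \<forall>x. x \<notin> A \<longrightarrow> \<phi> x = 0}"

lemma subspace_supported: "subspace (supported A)"
  by (auto simp: subspace_def supported_def)

lemma sum_fun_apply: "(\<Sum>a\<in>A. f a) x = (\<Sum>a\<in>A. f a x :: 'c :: comm_monoid_add)"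
  by (induction A rule: infinite_finite_induct) simp_all

lemma sum_indicator_supported:
  fixes \<phi> :: "'b \<Rightarrow> real"
  assumes "finite A" "\<phi> \<in> supported A"
  shows "\<phi> = (\<Sum>a\<in>A. \<phi> a *\<^sub>R indicator {a})"
proof
  fix x
  have "(\<Sum>a\<in>A. \<phi> a *\<^sub>R indicator {a} :: 'b \<Rightarrow> real) x = (\<Sum>a\<in>A. \<phi> a * indicator {a} x)"
    by (simp add: sum_fun_apply)
  also have "\<dots> = (\<Sum>a\<in>A. if a = x then \<phi> a else 0)"
    by (intro sum.cong) (auto simp: indicator_def)
  also have "\<dots> = \<phi> x"
    using assms by (auto simp: supported_def)
  finally show "\<phi> x = (\<Sum>a\<in>A. \<phi> a *\<^sub>R indicator {a} :: 'b \<Rightarrow> real) x" by simp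
qed

lemma
  assumes "finite A"
  shows supported_span: "supported A \<subseteq> span ((\<lambda>a. indicator {a} :: 'b \<Rightarrow> real) ` A)"
    and dim_supported: "dim (supported A) = card A"
proof -
  let ?d = "\<lambda>a::'b. indicator {a} :: 'b \<Rightarrow> real"
  have inj: "inj_on ?d A"
  proof (rule inj_onI)
    fix x y :: 'b assume "?d x = ?d y"
    then have "?d x x = ?d y x" by (rule fun_cong)
    then show "x = y" by (auto simp: indicator_def split: if_splits)
  qed
  show sp: "supported A \<subseteq> span (?d ` A)"
  proof
    fix \<phi> :: "'b \<Rightarrow> real" assume "\<phi> \<in> supported A"
    show "\<phi> \<in> span (?d ` A)"
      by (subst sum_indicator_supported[OF assms \<open>\<phi> \<in> supported A\<close>])
        (intro span_sum span_scale span_base imageI)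
  qed
  have "independent (?d ` A)"
  proof
    assume "dependent (?d ` A)"
    then obtain u where u: "\<exists>v\<in>?d ` A. u v \<noteq> 0" "(\<Sum>v\<in>?d ` A. u v *\<^sub>R v) = 0"
      using dependent_finite[of "?d ` A"] assms by blast
    have "u (?d a) = 0" if "a \<in> A" for a
    proof -
      define \<phi> where "\<phi> x = (if x \<in> A then u (?d x) else 0)" for x
      have "\<phi> = (\<Sum>a\<in>A. \<phi> a *\<^sub>R ?d a)"
        by (rule sum_indicator_supported[OF assms]) (simp add: supported_def \<phi>_def)
      also have "\<dots> = (\<Sum>a\<in>A. u (?d a) *\<^sub>R ?d a)"
        by (intro sum.cong) (auto simp: \<phi>_def)
      also have "\<dots> = 0" using u(2) sum.reindex[OF inj, of "\<lambda>v. u v *\<^sub>R v"] by simp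
      finally have "\<phi> a = 0" by simp
      then show ?thesis using that by (simp add: \<phi>_def)
    qed
    then show False using u(1) by auto
  qed
  moreover have "?d ` A \<subseteq> supported A" by (auto simp: supported_def indicator_def)
  moreover have "card (?d ` A) = card A" using inj by (rule card_image)
  ultimately show "dim (supported A) = card A"
    using basis_card_eq_dim[OF _ sp] by metis
qed

definition ksubs :: "nat \<Rightarrow> nat \<Rightarrow> nat set set" where
  "ksubs n k = {S. S \<subseteq> {..<n} \<and> card S = k}"

lemma finite_ksubs [simp]: "finite (ksubs n k)"
  by (rule finite_subset[of _ "Pow {..<n}"]) (auto simp: ksubs_def)

lemma card_ksubs: "card (ksubs n k) = n choose k"
  using n_subsets[of "{..<n}" k] by (simp add: ksubs_def)

text \<open>Absolute values spare the sign of the sorting permutation. They suffice because the aim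
  is only to transfer the vanishing of a value from the sorted list to the unsorted one.\<close>

lemma abs_insort_invariant:
  fixes h :: "nat list \<Rightarrow> real"
  assumes adj: "\<And>us x y vs. us @ x # y # vs \<in> L \<Longrightarrow> \<bar>h (us @ y # x # vs)\<bar> = \<bar>h (us @ x # y # vs)\<bar>"
    and perm: "\<And>xs ys. mset xs = mset ys \<Longrightarrow> xs \<in> L \<Longrightarrow> ys \<in> L"
    and "us @ x # xs \<in> L"
  shows "\<bar>h (us @ insort x xs)\<bar> = \<bar>h (us @ x # xs)\<bar>"
  using assms(3)
proof (induction xs arbitrary: us)
  case (Cons y xs)
  have "(us @ [y]) @ x # xs \<in> L" by (rule perm[OF _ Cons.prems]) simp
  from Cons.IH[OF this] adj[OF Cons.prems] show ?case by simp
qed simp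

lemma abs_sort_invariant:
  fixes h :: "nat list \<Rightarrow> real"
  assumes adj: "\<And>us x y vs. us @ x # y # vs \<in> L \<Longrightarrow> \<bar>h (us @ y # x # vs)\<bar> = \<bar>h (us @ x # y # vs)\<bar>"
    and perm: "\<And>xs ys. mset xs = mset ys \<Longrightarrow> xs \<in> L \<Longrightarrow> ys \<in> L"
    and "us @ xs \<in> L"
  shows "\<bar>h (us @ sort xs)\<bar> = \<bar>h (us @ xs)\<bar>"
  using assms(3)
proof (induction xs arbitrary: us)
  case (Cons x xs)
  have "us @ x # sort xs \<in> L" by (rule perm[OF _ Cons.prems]) simp
  from abs_insort_invariant[where L = L and h = h, OF adj perm this] Cons.IH[of "us @ [x]"] Cons.prems
  show ?case by simp
qed simp

text \<open>The placeholder \<open>0\<close> in the last hypothesis says that the other arguments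
  are admissible, whatever fills the slot.\<close>

lemma cochain_sum:
  assumes sub: "subspace (carr g)" and f: "f \<in> cochains g k" and "finite I"
    and y: "\<And>i. i \<in> I \<Longrightarrow> y i \<in> carr g" and mem: "us @ 0 # vs \<in> arg_lists g k"
  shows "f (us @ (\<Sum>i\<in>I. c i *\<^sub>R y i) # vs) = (\<Sum>i\<in>I. c i * f (us @ y i # vs))"
  using \<open>finite I\<close> y
proof (induction I rule: finite_induct)
  case empty
  show ?case
    using cochain_lin[OF sub f mem subspace_0[OF sub], of 0 0] by simp
next
  case (insert i I)
  have s: "(\<Sum>i\<in>I. c i *\<^sub>R y i) \<in> carr g"
    using insert.prems by (intro subspace_sum[OF sub] subspace_scale[OF sub]) auto
  then have "us @ (\<Sum>i\<in>I. c i *\<^sub>R y i) # vs \<in> arg_lists g k"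
    using mem by (auto simp: arg_lists_def)
  from cochain_lin[OF sub f this, of "y i" 1 "c i"] insert show ?case
    by (simp add: add.commute)
qed

lemma subspace_cochains: "subspace (cochains g k)"
  unfolding subspace_def cochains_def by (auto simp: algebra_simps)

lemma linear_ce_diff: "linear (ce_diff g k)"
proof (rule linearI)
  show "ce_diff g k (f + h) = ce_diff g k f + ce_diff g k h" for f h
    by (rule ext) (simp add: ce_diff_def algebra_simps sum.distrib)
  show "ce_diff g k (c *\<^sub>R f) = c *\<^sub>R ce_diff g k f" for c f
    by (rule ext) (simp add: ce_diff_def sum_distrib_left mult.left_commute)
qed

section \<open>Alternating forms relative to a numbered basis\<close>

text \<open>The functionals \<open>cf i\<close> form the dual basis. They are linear on the whole
  type, whereas \<open>expand\<close> is confined to the carrier. The numbering matters: it decides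
  which lists are increasing, and with that the signs in the coordinate form of the
  differential.\<close>

locale lie_basis =
  fixes g :: "'a::real_vector lie_alg" and n :: nat and e :: "nat \<Rightarrow> 'a" and cf :: "nat \<Rightarrow> 'a \<Rightarrow> real"
  assumes lie: "lie_algebra g"
    and e_carr: "i < n \<Longrightarrow> e i \<in> carr g"
    and cf_linear: "i < n \<Longrightarrow> linear (cf i)"
    and cf_e: "i < n \<Longrightarrow> j < n \<Longrightarrow> cf i (e j) = (if i = j then 1 else 0)"
    and expand: "x \<in> carr g \<Longrightarrow> x = (\<Sum>i<n. cf i x *\<^sub>R e i)"
begin

lemma subspace_carr: "subspace (carr g)"
  using lie by (simp add: lie_algebra_def)

lemma map_e_arg: "length is = k \<Longrightarrow> set is \<subseteq> {..<n} \<Longrightarrow> map e is \<in> arg_lists g k"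
  by (auto simp: arg_lists_def intro!: e_carr)

text \<open>The induction works from the right: the last general argument is expanded in the basis
  and joins the block \<open>map e is\<close>.\<close>

lemma cochain_determined_by_basis_lists:
  assumes f: "f \<in> cochains g k"
    and zero: "\<And>is. length is = k \<Longrightarrow> set is \<subseteq> {..<n} \<Longrightarrow> f (map e is) = 0"
    and "us @ map e is \<in> arg_lists g k" "set is \<subseteq> {..<n}"
  shows "f (us @ map e is) = 0"
  using assms(3,4)
proof (induction us arbitrary: "is" rule: rev_induct)
  case Nil
  then show ?case using zero by (simp add: arg_lists_def)
next
  case (snoc x us)
  have x: "x \<in> carr g" and mem: "us @ 0 # map e is \<in> arg_lists g k"
    using snoc.prems subspace_0[OF subspace_carr] by (auto simp: arg_lists_def)
  have "f ((us @ [x]) @ map e is) = f (us @ (\<Sum>i<n. cf i x *\<^sub>R e i) # map e is)"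
    using expand[OF x] by simp
  also have "\<dots> = (\<Sum>i<n. cf i x * f (us @ e i # map e is))"
    using e_carr by (intro cochain_sum[OF subspace_carr f _ _ mem]) auto
  also have "\<dots> = 0"
  proof (rule sum.neutral, rule ballI)
    fix i assume "i \<in> {..<n}"
    then have "us @ map e (i # is) \<in> arg_lists g k" "set (i # is) \<subseteq> {..<n}"
      using snoc.prems e_carr by (auto simp: arg_lists_def)
    from snoc.IH[OF this] show "cf i x * f (us @ e i # map e is) = 0" by simp
  qed
  finally show ?case .
qed

definition coord :: "nat \<Rightarrow> ('a list \<Rightarrow> real) \<Rightarrow> nat set \<Rightarrow> real" where
  "coord k f S = (if S \<in> ksubs n k then f (map e (sorted_list_of_set S)) else 0)"

lemma linear_coord: "linear (coord k)"
  by (rule linearI) (auto simp: coord_def fun_eq_iff)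

lemma coord_supported: "coord k f \<in> supported (ksubs n k)"
  by (simp add: coord_def supported_def)

text \<open>A list of basis vectors with a repetition gives 0 by alternation. One without has, up to
  sign, the value at its sorted version, which is a coordinate.\<close>

lemma coord_eq_0:
  assumes f: "f \<in> cochains g k" and z: "coord k f = 0"
  shows "f = 0"
proof
  fix xs
  have basis: "f (map e is) = 0" if "is": "length is = k" "set is \<subseteq> {..<n}" for "is"
  proof (cases "distinct is")
    case True
    let ?L = "{is. length is = k \<and> set is \<subseteq> {..<n}}"
    let ?h = "\<lambda>is. f (map e is)"
    have adj: "\<bar>?h (us @ y # x # vs)\<bar> = \<bar>?h (us @ x # y # vs)\<bar>" if "us @ x # y # vs \<in> ?L" for us x y vs
    proof -
      from that have "map e us @ e x # [] @ e y # map e vs \<in> arg_lists g k"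
        using e_carr by (auto simp: arg_lists_def)
      from cochain_swap[OF f this] show ?thesis by simp
    qed
    have perm: "ys \<in> ?L" if "mset xs = mset ys" "xs \<in> ?L" for xs ys
      using that by (auto dest: mset_eq_length mset_eq_setD)
    have "\<bar>?h ([] @ sort is)\<bar> = \<bar>?h ([] @ is)\<bar>"
      by (rule abs_sort_invariant[where L = ?L and h = ?h, OF adj perm]) (use "is" in auto)
    moreover have "sort is = sorted_list_of_set (set is)"
      using True by (simp add: sorted_list_of_set_sort_remdups distinct_remdups_id)
    moreover have "set is \<in> ksubs n k"
      using True "is" by (auto simp: ksubs_def distinct_card)
    then have "f (map e (sorted_list_of_set (set is))) = 0"
      using fun_cong[OF z, of "set is"] by (simp add: coord_def)
    ultimately show ?thesis by simp
  next
    case False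
    then obtain xs ys zs y where d: "is = xs @ [y] @ ys @ [y] @ zs"
      using not_distinct_decomp by blast
    then have "map e xs @ e y # map e ys @ e y # map e zs \<in> arg_lists g k"
      using map_e_arg[OF "is"] by simp
    from cochain_dup[OF f this] show ?thesis by (simp add: d)
  qed
  show "f xs = 0 xs"
  proof (cases "xs \<in> arg_lists g k")
    case True
    then show ?thesis using cochain_determined_by_basis_lists[OF f basis, of xs "[]"] by simp
  next
    case False
    then show ?thesis using f by (simp add: cochains_def)
  qed
qed

lemma inj_on_coord: "inj_on (coord k) (cochains g k)"
proof (rule inj_onI)
  fix f h assume a: "f \<in> cochains g k" "h \<in> cochains g k" "coord k f = coord k h"
  then have "coord k (f - h) = 0" by (simp add: linear_diff[OF linear_coord])
  moreover have "f - h \<in> cochains g k" using a subspace_cochains subspace_diff by blast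
  ultimately show "f = h" using coord_eq_0 by fastforce
qed

text \<open>The wedge product of the dual functionals with indices in \<open>S\<close>, written as a
  Leibniz determinant.\<close>

definition basis_form :: "nat \<Rightarrow> nat set \<Rightarrow> 'a list \<Rightarrow> real" where
  "basis_form k S xs = (if xs \<in> arg_lists g k then
     (\<Sum>p | p permutes {..<k}. of_int (sign p) * (\<Prod>i<k. cf (sorted_list_of_set S ! p i) (xs ! i))) else 0)"

lemma nth_sorted_list_ksubs:
  assumes "S \<in> ksubs n k" "i < k"
  shows "sorted_list_of_set S ! i \<in> S" "sorted_list_of_set S ! i < n"
proof -
  have "finite S" using assms finite_subset by (auto simp: ksubs_def)
  then show "sorted_list_of_set S ! i \<in> S"
    using assms nth_mem[of i "sorted_list_of_set S"] by (simp add: ksubs_def)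
  then show "sorted_list_of_set S ! i < n" using assms by (auto simp: ksubs_def)
qed

lemma basis_form_cochain:
  assumes S: "S \<in> ksubs n k"
  shows "basis_form k S \<in> cochains g k"
  unfolding cochains_def
proof (intro CollectI conjI ballI allI impI)
  let ?s = "\<lambda>p i. sorted_list_of_set S ! p i"
  fix xs assume "xs \<notin> arg_lists g k"
  then show "basis_form k S xs = 0" by (simp add: basis_form_def)
next
  let ?s = "\<lambda>p i. sorted_list_of_set S ! p i"
  fix xs i x y c
  assume xs: "xs \<in> arg_lists g k" and i: "i < k" and x: "x \<in> carr g" and y: "y \<in> carr g"
  \<comment> \<open>In each Leibniz term exactly one factor sees the argument at place
    \<open>i\<close>.\<close>
  have up: "basis_form k S (xs[i := z]) = (\<Sum>p | p permutes {..<k}.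
      cf (?s p i) z * (of_int (sign p) * (\<Prod>l\<in>{..<k} - {i}. cf (?s p l) (xs ! l))))"
    if "z \<in> carr g" for z
  proof -
    have m: "xs[i := z] \<in> arg_lists g k"
      using xs that set_update_subset_insert[of xs i z] by (auto simp: arg_lists_def)
    have "(\<Prod>l<k. cf (?s p l) (xs[i := z] ! l))
        = cf (?s p i) z * (\<Prod>l\<in>{..<k} - {i}. cf (?s p l) (xs ! l))" for p
      using xs i by (subst prod.remove[of _ i]) (auto simp: arg_lists_def intro!: prod.cong)
    then show ?thesis using m by (simp add: basis_form_def mult.left_commute)
  qed
  have lin: "linear (cf (?s p i))" if "p permutes {..<k}" for p
    using that i S by (intro cf_linear nth_sorted_list_ksubs(2)[of _ k]) (use permutes_in_image[of p "{..<k}" i] in auto)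
  have "x + y \<in> carr g" "c *\<^sub>R x \<in> carr g"
    using x y subspace_carr by (auto simp: subspace_add subspace_scale)
  then show "basis_form k S (xs[i := x + y]) = basis_form k S (xs[i := x]) + basis_form k S (xs[i := y])"
    and "basis_form k S (xs[i := c *\<^sub>R x]) = c * basis_form k S (xs[i := x])"
    using x y up by (auto simp: linear_add[OF lin] linear_scale[OF lin] algebra_simps sum.distrib sum_distrib_left)
next
  let ?s = "\<lambda>p i. sorted_list_of_set S ! p i"
  fix xs j i
  assume xs: "xs \<in> arg_lists g k" and j: "j < k" and i: "i < j"
  define \<tau> where "\<tau> = Transposition.transpose i j"
  have \<tau>: "\<tau> permutes {..<k}" using i j by (simp add: \<tau>_def permutes_swap_id)
  let ?ys = "xs[i := xs ! j, j := xs ! i]"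
  have len: "length xs = k" using xs by (simp add: arg_lists_def)
  have ys: "?ys \<in> arg_lists g k"
    using xs i j by (auto simp: arg_lists_def set_swap)
  have nth: "?ys ! l = xs ! \<tau> l" if "l < k" for l
    using that i j len by (auto simp: \<tau>_def Transposition.transpose_def nth_list_update)
  have "basis_form k S ?ys = (\<Sum>p | p permutes {..<k}. of_int (sign p) * (\<Prod>l<k. cf (?s p l) (xs ! \<tau> l)))"
    using ys nth by (simp add: basis_form_def)
  \<comment> \<open>Reindexing by \<open>p \<circ> \<tau>\<close> turns the permuted arguments into
    a mere reordering of the factors and leaves the sign of \<open>\<tau>\<close>.\<close>
  also have "\<dots> = (\<Sum>p | p permutes {..<k}. of_int (sign (p \<circ> \<tau>)) * (\<Prod>l<k. cf (?s (p \<circ> \<tau>) l) (xs ! \<tau> l)))"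
    by (rule sum_permutations_compose_right[OF \<tau>])
  also have "\<dots> = (\<Sum>p | p permutes {..<k}. - (of_int (sign p) * (\<Prod>l<k. cf (?s p l) (xs ! l))))"
  proof (rule sum.cong[OF refl])
    fix p assume "p \<in> {p. p permutes {..<k}}"
    then have "permutation p" by (auto intro: permutes_imp_permutation[of "{..<k}"])
    then have "sign (p \<circ> \<tau>) = - sign p"
      using i by (simp add: sign_compose \<tau>_def permutation_swap_id sign_swap_id)
    moreover have "(\<Prod>l<k. cf (?s (p \<circ> \<tau>) l) (xs ! \<tau> l)) = (\<Prod>l<k. cf (?s p l) (xs ! l))"
      using prod.permute[OF \<tau>, of "\<lambda>l. cf (?s p l) (xs ! l)"] by (simp add: comp_def)
    ultimately show "of_int (sign (p \<circ> \<tau>)) * (\<Prod>l<k. cf (?s (p \<circ> \<tau>) l) (xs ! \<tau> l)) =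
        - (of_int (sign p) * (\<Prod>l<k. cf (?s p l) (xs ! l)))" by simp
  qed
  also have "\<dots> = - basis_form k S xs"
    using xs by (simp add: basis_form_def sum_negf)
  finally show "basis_form k S ?ys = - basis_form k S xs" .
qed

text \<open>A Leibniz term survives only if the permuted list of \<open>S\<close> equals the list of
  \<open>T\<close>. This forces \<open>S = T\<close>, and then the identity permutation because the
  entries are distinct.\<close>

lemma coord_basis_form:
  assumes S: "S \<in> ksubs n k"
  shows "coord k (basis_form k S) = indicator {S}"
proof
  fix T
  show "coord k (basis_form k S) T = indicator {S} T"
  proof (cases "T \<in> ksubs n k")
    case False
    then show ?thesis using S by (auto simp: coord_def indicator_def)
  next
    case T: True
    let ?s = "sorted_list_of_set S" and ?t = "sorted_list_of_set T"
    have fin: "finite S" "finite T" using S T finite_subset by (auto simp: ksubs_def)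
    have len: "length ?s = k" "length ?t = k" using S T by (auto simp: ksubs_def)
    have arg: "map e ?t \<in> arg_lists g k"
      using T fin len by (intro map_e_arg) (auto simp: ksubs_def)
    have fact: "(\<Prod>i<k. cf (?s ! p i) (map e ?t ! i)) = (if \<forall>i<k. ?s ! p i = ?t ! i then 1 else 0)"
      if "p permutes {..<k}" for p
    proof -
      have p: "p i < k" if "i < k" for i
        using \<open>p permutes {..<k}\<close> that permutes_in_image[of p "{..<k}" i] by simp
      have "(\<Prod>i<k. cf (?s ! p i) (map e ?t ! i)) = (\<Prod>i<k. if ?s ! p i = ?t ! i then 1 else 0)"
        using p len nth_sorted_list_ksubs(2)[OF S] nth_sorted_list_ksubs(2)[OF T]
        by (intro prod.cong) (auto simp: cf_e)
      then show ?thesis by auto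
    qed
    have id: "S = T \<and> p = id" if p: "p permutes {..<k}" and eq: "\<forall>i<k. ?s ! p i = ?t ! i" for p
    proof -
      have pk: "p i < k" if "i < k" for i
        using p that permutes_in_image[of p "{..<k}" i] by simp
      have "T \<subseteq> S"
      proof
        fix x assume "x \<in> T"
        then obtain i where "i < k" "x = ?t ! i"
          using fin(2) len(2) by (metis in_set_conv_nth set_sorted_list_of_set)
        then show "x \<in> S" using eq nth_sorted_list_ksubs(1)[OF S pk] by metis
      qed
      moreover have "card S = card T" using S T by (simp add: ksubs_def)
      ultimately have ST: "S = T" using card_subset_eq[OF fin(1)] by metis
      have "p i = i" for i
      proof (cases "i < k")
        case True
        then have "?s ! p i = ?s ! i" using eq ST by simp
        then show ?thesis using True pk len by (simp add: nth_eq_iff_index_eq)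
      next
        case False
        then show ?thesis using p by (simp add: permutes_def)
      qed
      then show ?thesis using ST by auto
    qed
    have "coord k (basis_form k S) T = (\<Sum>p | p permutes {..<k}. of_int (sign p) *
        (if \<forall>i<k. ?s ! p i = ?t ! i then 1 else 0))"
      using T arg fact by (simp add: coord_def basis_form_def)
    also have "\<dots> = (\<Sum>p | p permutes {..<k}. if p = id then (if S = T then 1 else 0) else 0)"
      using id by (intro sum.cong) (auto simp: sign_id)
    also have "\<dots> = (if S = T then 1 else 0)"
      by (subst sum.delta) (auto simp: finite_permutations permutes_id)
    finally show ?thesis by (auto simp: indicator_def)
  qed
qed

lemma cochain_eq_sum:
  assumes f: "f \<in> cochains g k"
  shows "f = (\<Sum>S\<in>ksubs n k. coord k f S *\<^sub>R basis_form k S)"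
proof -
  let ?h = "\<Sum>S\<in>ksubs n k. coord k f S *\<^sub>R basis_form k S"
  have mem: "?h \<in> cochains g k"
    using basis_form_cochain by (intro subspace_sum[OF subspace_cochains] subspace_scale[OF subspace_cochains])
  have eq: "coord k ?h = coord k f"
    using sum_indicator_supported[OF finite_ksubs coord_supported[of k f]]
    by (simp add: linear_sum[OF linear_coord] linear_scale[OF linear_coord] coord_basis_form)
  show ?thesis
    by (rule inj_onD[OF inj_on_coord eq[symmetric] f mem])
qed

lemma cochains_span: "cochains g k \<subseteq> span (basis_form k ` ksubs n k)"
proof
  fix f assume "f \<in> cochains g k"
  show "f \<in> span (basis_form k ` ksubs n k)"
    by (subst cochain_eq_sum[OF \<open>f \<in> cochains g k\<close>])
      (intro span_sum span_scale span_base imageI)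
qed

lemma coord_image: "coord k ` cochains g k = supported (ksubs n k)"
proof
  show "coord k ` cochains g k \<subseteq> supported (ksubs n k)" using coord_supported by auto
  show "supported (ksubs n k) \<subseteq> coord k ` cochains g k"
  proof
    fix \<phi> :: "nat set \<Rightarrow> real" assume \<phi>: "\<phi> \<in> supported (ksubs n k)"
    let ?h = "\<Sum>S\<in>ksubs n k. \<phi> S *\<^sub>R basis_form k S"
    have mem: "?h \<in> cochains g k"
      using basis_form_cochain by (intro subspace_sum[OF subspace_cochains] subspace_scale[OF subspace_cochains])
    have eq: "coord k ?h = \<phi>"
      using sum_indicator_supported[OF finite_ksubs \<phi>]
      by (simp add: linear_sum[OF linear_coord] linear_scale[OF linear_coord] coord_basis_form)
    show "\<phi> \<in> coord k ` cochains g k" by (rule image_eqI[where f = "coord k", OF eq[symmetric] mem])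
  qed
qed

lemma dim_cochains: "dim (cochains g k) = n choose k"
  using dim_image_inj[OF linear_coord subspace_cochains cochains_span _ inj_on_coord]
  by (simp add: coord_image dim_supported card_ksubs)

text \<open>\<open>D\<close> is a single operator on functions of subsets, valid in all degrees.
  Through the injectivity of \<open>coord\<close>, \<open>D\<close> carries over both the ranks and
  the inclusion of coboundaries in cocycles. The case split records that nothing enters degree
  0.\<close>

lemma betti_plus_ranks:
  assumes comm: "\<And>k f. f \<in> cochains g k \<Longrightarrow> coord (Suc k) (ce_diff g k f) = D (coord k f)"
    and DD: "\<And>\<phi>. D (D \<phi>) = 0"
  shows "betti g k + dim (D ` supported (ksubs n k)) +
    (case k of 0 \<Rightarrow> 0 | Suc l \<Rightarrow> dim (D ` supported (ksubs n l))) = n choose k"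
proof -
  have fin: "finite (basis_form k ` ksubs n k)" for k by simp
  have rank: "dim (ce_diff g k ` cochains g k) = dim (D ` supported (ksubs n k))" for k
  proof -
    have sub: "ce_diff g k ` cochains g k \<subseteq> cochains g (Suc k)"
      using ce_diff_cochain[OF lie] by auto
    have "dim (coord (Suc k) ` ce_diff g k ` cochains g k) = dim (ce_diff g k ` cochains g k)"
      by (rule dim_image_inj[OF linear_coord _ order_trans[OF sub cochains_span] fin
            inj_on_subset[OF inj_on_coord sub]])
        (rule linear_subspace_image[OF linear_ce_diff subspace_cochains])
    moreover have "coord (Suc k) ` ce_diff g k ` cochains g k = D ` coord k ` cochains g k"
      using comm by (simp add: image_image)
    ultimately show ?thesis by (simp add: coord_image)
  qed
  have Z: "subspace (cocycles g k)"
    using subspace_inter[OF subspace_cochains linear_subspace_vimage[OF linear_ce_diff subspace_single_0, of g k], of g k]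
    by (simp add: cocycles_def vimage_def Int_def)
  have Zspan: "cocycles g k \<subseteq> span (basis_form k ` ksubs n k)"
    using cochains_span[of k] by (auto simp: cocycles_def)
  have "dim (cocycles g k) + dim (ce_diff g k ` cochains g k) = n choose k"
    using rank_nullity[OF linear_ce_diff[of g k] subspace_cochains cochains_span[of k] fin]
    by (simp add: cocycles_def dim_cochains)
  moreover have "betti g k + dim (coboundaries g k) = dim (cocycles g k)"
    unfolding betti_def
  proof (rule quotient_dim_plus_dim[OF Z _ _ Zspan fin])
    show "subspace (coboundaries g k)"
      using linear_subspace_image[OF linear_ce_diff subspace_cochains, of g]
      by (cases k) (simp_all add: coboundaries_def subspace_single_0)
    show "coboundaries g k \<subseteq> cocycles g k"
    proof (cases k)
      case 0
      then show ?thesis using subspace_0[OF Z] by (simp add: coboundaries_def)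
    next
      case (Suc l)
      have "ce_diff g (Suc l) (ce_diff g l f) = 0" if f: "f \<in> cochains g l" for f
      proof (rule coord_eq_0)
        note d = ce_diff_cochain[OF lie f]
        show "ce_diff g (Suc l) (ce_diff g l f) \<in> cochains g (Suc (Suc l))"
          by (rule ce_diff_cochain[OF lie d])
        show "coord (Suc (Suc l)) (ce_diff g (Suc l) (ce_diff g l f)) = 0"
          by (simp add: comm[OF d] comm[OF f] DD)
      qed
      then show ?thesis
        unfolding Suc coboundaries_def cocycles_def nat.case
        using ce_diff_cochain[OF lie] by blast
    qed
  qed
  moreover have "dim (coboundaries g k) = (case k of 0 \<Rightarrow> 0 | Suc l \<Rightarrow> dim (D ` supported (ksubs n l)))"
  proof (cases k)
    case 0
    have "dim {0 :: 'a list \<Rightarrow> real} = 0"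
      using dim_le_card[of "{0 :: 'a list \<Rightarrow> real}" "{}"] by simp
    then show ?thesis by (simp add: 0 coboundaries_def)
  next
    case (Suc l)
    then show ?thesis by (simp add: coboundaries_def rank)
  qed
  ultimately show ?thesis by (simp add: rank)
qed

end

section \<open>The differential in coordinates\<close>

lemma sorted_list_of_set_insert_less:
  assumes "finite S" "\<And>x. x \<in> S \<Longrightarrow> a < (x :: nat)"
  shows "sorted_list_of_set (insert a S) = a # sorted_list_of_set S"
proof -
  have "a \<notin> S" using assms(2) by blast
  then have "sorted_list_of_set (insert a S) = insort a (sorted_list_of_set S)"
    using assms(1) by simp
  also have "\<dots> = a # sorted_list_of_set S"
    using assms by (intro insort_is_Cons) (auto simp: less_imp_le)
  finally show ?thesis .
qed

text \<open>Entries of a sorted list of a set are distinct, so deleting positions is deleting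
  elements.\<close>

lemma nths_Compl_pair_sorted_list:
  assumes "finite S" "i < card S" "j < card S"
  shows "nths (sorted_list_of_set S) (- {i, j}) =
    sorted_list_of_set (S - {sorted_list_of_set S ! i, sorted_list_of_set S ! j :: nat})"
proof (rule sorted_distinct_set_unique)
  let ?s = "sorted_list_of_set S"
  show "sorted (nths ?s (- {i, j}))" by (simp add: sorted_nths)
  show "distinct (nths ?s (- {i, j}))" by simp
  have dist: "?s ! l = ?s ! l' \<longleftrightarrow> l = l'" if "l < card S" "l' < card S" for l l'
    using that assms(1) by (simp add: nth_eq_iff_index_eq)
  have "set (nths ?s (- {i, j})) = {?s ! l | l. l < card S \<and> l \<notin> {i, j}}"
    by (simp add: set_nths)
  also have "\<dots> = {?s ! l | l. l < card S} - {?s ! i, ?s ! j}"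
    using dist assms by auto
  also have "{?s ! l | l. l < card S} = S"
    using set_conv_nth[of ?s] assms(1) by simp
  finally show "set (nths ?s (- {i, j})) = set (sorted_list_of_set (S - {?s ! i, ?s ! j}))"
    using assms(1) by simp
qed simp_all

text \<open>Recovers the position of an element from the set alone; the sign of a summand can then
  be written without reference to positions.\<close>

lemma card_less_nth_sorted_list:
  assumes "finite S" "i < card S"
  shows "card {x \<in> S. x < sorted_list_of_set S ! i} = i"
proof -
  let ?s = "sorted_list_of_set S"
  have len: "length ?s = card S" using assms(1) by simp
  have sw: "sorted_wrt (<) ?s" using assms(1) by simp
  have lt: "?s ! l < ?s ! l' \<longleftrightarrow> l < l'" if "l < card S" "l' < card S" for l l'
    using that sorted_wrt_nth_less[OF sw, of l l'] sorted_wrt_nth_less[OF sw, of l' l] len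
    by (metis less_asym linorder_neqE_nat)
  have "{x \<in> S. x < ?s ! i} = (\<lambda>l. ?s ! l) ` {..<i}"
  proof (intro equalityI subsetI)
    fix x assume x: "x \<in> {x \<in> S. x < ?s ! i}"
    then have "x \<in> set ?s" using assms(1) by simp
    then obtain l where l: "l < card S" "x = ?s ! l" unfolding in_set_conv_nth len by blast
    then show "x \<in> (\<lambda>l. ?s ! l) ` {..<i}" using x lt[of l i] assms(2) by simp
  next
    fix x assume "x \<in> (\<lambda>l. ?s ! l) ` {..<i}"
    then obtain l where l: "l < i" "x = ?s ! l" by auto
    then have "l < card S" using assms(2) by simp
    moreover from this have "?s ! l \<in> S" using nth_mem[of l ?s] assms(1) len by simp
    ultimately show "x \<in> {x \<in> S. x < ?s ! i}" using l lt[of l i] assms(2) by simp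
  qed
  moreover have "inj_on (\<lambda>l. ?s ! l) {..<i}"
    using assms len by (intro inj_on_nth) auto
  ultimately show ?thesis by (simp add: card_image)
qed

context lie_basis
begin

lemma coord_ce_diff:
  assumes S: "S \<in> ksubs n (Suc k)"
  shows "coord (Suc k) (ce_diff g k f) S =
    (\<Sum>(p, q) \<in> {(p, q). p \<in> S \<and> q \<in> S \<and> p < q}.
      (-1) ^ (card {x \<in> S. x < p} + card {x \<in> S. x < q}) *
        f (brk g (e p) (e q) # map e (sorted_list_of_set (S - {p, q}))))"
proof -
  let ?s = "sorted_list_of_set S"
  have fin: "finite S" and card: "card S = Suc k" and sub: "S \<subseteq> {..<n}"
    using S finite_subset by (auto simp: ksubs_def)
  have len: "length ?s = Suc k" using fin card by simp
  have "coord (Suc k) (ce_diff g k f) S = sum (ce_term g f (map e ?s)) (index_pairs k)"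
    using S ce_diff_eq[OF map_e_arg[OF len]] fin sub by (simp add: coord_def)
  also have "\<dots> = (\<Sum>(p, q) \<in> {(p, q). p \<in> S \<and> q \<in> S \<and> p < q}.
      (-1) ^ (card {x \<in> S. x < p} + card {x \<in> S. x < q}) *
        f (brk g (e p) (e q) # map e (sorted_list_of_set (S - {p, q}))))"
  proof (rule sum.reindex_bij_witness[where j = "\<lambda>(i, j). (?s ! i, ?s ! j)"
        and i = "\<lambda>(p, q). (card {x \<in> S. x < p}, card {x \<in> S. x < q})"])
    fix a assume "a \<in> index_pairs k"
    then obtain i j where a: "a = (i, j)" and ij: "i < j" "j \<le> k" by (auto simp: index_pairs_def)
    then have lt: "i < card S" "j < card S" using card by auto
    note c = card_less_nth_sorted_list[OF fin lt(1)] card_less_nth_sorted_list[OF fin lt(2)]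
    show "(case case a of (i, j) \<Rightarrow> (?s ! i, ?s ! j) of
        (p, q) \<Rightarrow> (card {x \<in> S. x < p}, card {x \<in> S. x < q})) = a"
      by (simp add: a c)
    have "?s ! i \<in> S" "?s ! j \<in> S"
      using nth_mem[of i ?s] nth_mem[of j ?s] lt fin by auto
    moreover have "?s ! i < ?s ! j"
      using sorted_wrt_nth_less[of "(<)" ?s i j] fin lt ij by simp
    ultimately show "(case a of (i, j) \<Rightarrow> (?s ! i, ?s ! j)) \<in> {(p, q). p \<in> S \<and> q \<in> S \<and> p < q}"
      by (simp add: a)
    show "(case case a of (i, j) \<Rightarrow> (?s ! i, ?s ! j) of (p, q) \<Rightarrow>
        (-1) ^ (card {x \<in> S. x < p} + card {x \<in> S. x < q}) *
        f (brk g (e p) (e q) # map e (sorted_list_of_set (S - {p, q})))) = ce_term g f (map e ?s) a"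
      using lt fin by (simp add: a c ce_term_def nths_map nths_Compl_pair_sorted_list)
  next
    fix b assume "b \<in> {(p, q). p \<in> S \<and> q \<in> S \<and> p < q}"
    then obtain p q where b: "b = (p, q)" "p \<in> S" "q \<in> S" "p < q" by auto
    obtain i where i: "i < card S" "p = ?s ! i"
      using b(2) fin by (metis in_set_conv_nth set_sorted_list_of_set length_sorted_list_of_set)
    obtain j where j: "j < card S" "q = ?s ! j"
      using b(3) fin by (metis in_set_conv_nth set_sorted_list_of_set length_sorted_list_of_set)
    have c: "card {x \<in> S. x < p} = i" "card {x \<in> S. x < q} = j"
      using card_less_nth_sorted_list[OF fin] i j by auto
    have "i < j"
    proof (rule ccontr)
      assume "\<not> i < j"
      then have "?s ! j \<le> ?s ! i" using i j fin by (intro sorted_nth_mono) auto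
      then show False using i j b(4) by simp
    qed
    moreover have "j \<le> k" using j(1) card by simp
    ultimately show "(case b of (p, q) \<Rightarrow> (card {x \<in> S. x < p}, card {x \<in> S. x < q})) \<in> index_pairs k"
      unfolding b(1) prod.case c by (simp add: index_pairs_def)
    show "(case case b of (p, q) \<Rightarrow> (card {x \<in> S. x < p}, card {x \<in> S. x < q}) of
        (i, j) \<Rightarrow> (?s ! i, ?s ! j)) = b"
      unfolding b(1) prod.case c using i j by simp
  qed
  finally show ?thesis .
qed

lemma cochain_Cons_0:
  assumes "f \<in> cochains g k"
  shows "f (0 # xs) = 0"
proof (cases "0 # xs \<in> arg_lists g k")
  case True
  then show ?thesis
    using cochain_lin[OF subspace_carr assms, of "[]" 0 xs 0 0 0] subspace_0[OF subspace_carr] by simp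
next
  case False
  then show ?thesis using assms by (simp add: cochains_def)
qed

end

section \<open>The differential of the affine algebra\<close>

text \<open>Index 0 is \<open>X\<close> and index 1 is \<open>Y\<close>. In a set containing both
  they hold positions 0 and 1, whence the minus sign; since \<open>[X, Y] = Y\<close>, only
  \<open>X\<close> disappears from the arguments.\<close>

definition aff_coboundary :: "(nat set \<Rightarrow> real) \<Rightarrow> nat set \<Rightarrow> real" where
  "aff_coboundary \<phi> S = (if {0, 1} \<subseteq> S then - \<phi> (S - {0}) else 0)"

lemma (in lie_basis) coord_ce_diff_aff:
  assumes brk: "\<And>p q. p < q \<Longrightarrow> q < n \<Longrightarrow> brk g (e p) (e q) = (if p = 0 \<and> q = 1 then e 1 else 0)"
    and n: "2 \<le> n" and f: "f \<in> cochains g k"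
  shows "coord (Suc k) (ce_diff g k f) = aff_coboundary (coord k f)"
proof
  fix S
  show "coord (Suc k) (ce_diff g k f) S = aff_coboundary (coord k f) S"
  proof (cases "S \<in> ksubs n (Suc k)")
    case S: True
    then have fin: "finite S" and sub: "S \<subseteq> {..<n}" and card: "card S = Suc k"
      using finite_subset by (auto simp: ksubs_def)
    let ?P = "{(p, q). p \<in> S \<and> q \<in> S \<and> p < q}"
    let ?F = "\<lambda>(p, q). (-1) ^ (card {x \<in> S. x < p} + card {x \<in> S. x < q}) *
        f (brk g (e p) (e q) # map e (sorted_list_of_set (S - {p, q})))"
    have finP: "finite ?P"
      by (rule finite_subset[of _ "S \<times> S"]) (use fin in auto)
    have zero: "?F a = 0" if "a \<in> ?P" "a \<noteq> (0, 1)" for a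
    proof -
      from that(1) obtain p q where b: "a = (p, q)" "p \<in> S" "q \<in> S" "p < q" by blast
      moreover have "q < n" using b sub by auto
      ultimately have "brk g (e p) (e q) = 0" using brk[of p q] that(2) by auto
      then show ?thesis by (simp add: b cochain_Cons_0[OF f])
    qed
    show ?thesis
    proof (cases "{0, 1} \<subseteq> S")
      case True
      have "coord (Suc k) (ce_diff g k f) S = sum ?F {(0, 1)}"
        unfolding coord_ce_diff[OF S]
        by (rule sum.mono_neutral_right[OF finP]) (use True zero in auto)
      also have "\<dots> = - f (e 1 # map e (sorted_list_of_set (S - {0, 1})))"
      proof -
        have "{x \<in> S. x < 1} = {0}" using True by auto
        then have "card {x \<in> S. x < 1} = 1" by simp
        then show ?thesis using brk[of 0 1] n by simp
      qed
      \<comment> \<open>Once 0 is gone, the bracket value \<open>Y\<close> at the head is already in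
        its sorted place, so no further sign arises.\<close>
      also have "e 1 # map e (sorted_list_of_set (S - {0, 1})) = map e (sorted_list_of_set (S - {0}))"
      proof -
        have "S - {0} = insert 1 (S - {0, 1})" using True by auto
        moreover have "sorted_list_of_set (insert 1 (S - {0, 1})) = 1 # sorted_list_of_set (S - {0, 1})"
          by (rule sorted_list_of_set_insert_less) (use fin in auto)
        ultimately show ?thesis by simp
      qed
      also have "f \<dots> = coord k f (S - {0})"
        using S True fin by (auto simp: coord_def ksubs_def)
      finally show ?thesis using True by (simp add: aff_coboundary_def)
    next
      case False
      have "(\<Sum>a\<in>?P. ?F a) = 0"
      proof (intro sum.neutral ballI)
        fix a assume "a \<in> ?P"
        moreover from this False have "a \<noteq> (0, 1)" by auto
        ultimately show "?F a = 0" by (rule zero)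
      qed
      then show ?thesis unfolding coord_ce_diff[OF S] aff_coboundary_def by (simp only: False if_False)
    qed
  next
    case False
    \<comment> \<open>Off the (k+1)-subsets the right-hand side has to vanish too: if
      \<open>S - {0}\<close> were a k-subset, \<open>S\<close> would be a (k+1)-subset.\<close>
    have "coord k f (S - {0}) = 0" if "{0, 1} \<subseteq> S"
    proof -
      have "S - {0} \<notin> ksubs n k"
      proof
        assume a: "S - {0} \<in> ksubs n k"
        then have "finite (S - {0})" using finite_subset[of "S - {0}" "{..<n}"] by (simp add: ksubs_def)
        then have "finite S" by simp
        from card.remove[OF this, of 0] have "card S = Suc k" using a that by (simp add: ksubs_def)
        moreover have "S \<subseteq> insert 0 {..<n}" using a unfolding ksubs_def by blast
        then have "S \<subseteq> {..<n}" using n by (simp add: insert_absorb)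
        ultimately show False using False by (simp add: ksubs_def)
      qed
      then show ?thesis by (simp add: coord_def)
    qed
    then show ?thesis using False by (auto simp: coord_def aff_coboundary_def)
  qed
qed

text \<open>The basis of \<open>\<hh>\<^bsub>2m+1\<^esub>\<close> is taken in the order \<open>Z, X\<^sub>1, X\<^bsub>m+1\<^esub>, X\<^sub>2, X\<^bsub>m+2\<^esub>, \<dots>\<close>
  with \<open>Z\<close> at index \<open>0\<close>. Basis vectors with non-zero bracket are then adjacent, so that all signs in
  the coordinate form of the differential agree.\<close>

definition hpair :: "nat \<Rightarrow> nat set" where
  "hpair a = {2 * a + 1, 2 * a + 2}"

text \<open>The coefficient at \<open>S\<close> of the product of \<open>\<phi>\<close> with
  \<omega>, the sum of the products of the two dual forms indexed by each \<open>hpair a\<close>.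
  Two neighbouring indices pass any other index by an even number of transpositions, hence no
  signs.\<close>

definition pair_sum :: "nat \<Rightarrow> (nat set \<Rightarrow> real) \<Rightarrow> nat set \<Rightarrow> real" where
  "pair_sum m \<phi> S = (\<Sum>a | a < m \<and> hpair a \<subseteq> S. \<phi> (S - hpair a))"

text \<open>The form dual to \<open>Z\<close> has differential minus \<omega>, and the other dual
  basis forms are closed. Evaluating at \<open>insert 0 T\<close> extracts the part of
  \<open>\<phi>\<close> that contains the form dual to \<open>Z\<close>.\<close>

definition heis_coboundary :: "nat \<Rightarrow> nat \<Rightarrow> (nat set \<Rightarrow> real) \<Rightarrow> nat set \<Rightarrow> real" where
  "heis_coboundary m n \<phi> S = (if S \<subseteq> {1..<n} then - pair_sum m (\<lambda>T. \<phi> (insert 0 T)) S else 0)"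

lemma (in lie_basis) coord_ce_diff_heis:
  assumes brk: "\<And>p q. p < q \<Longrightarrow> q < n \<Longrightarrow>
      brk g (e p) (e q) = (if \<exists>a<m. p = 2 * a + 1 \<and> q = 2 * a + 2 then e 0 else 0)"
    and n: "2 * m + 1 \<le> n" and f: "f \<in> cochains g k"
  shows "coord (Suc k) (ce_diff g k f) = heis_coboundary m n (coord k f)"
proof
  fix S
  have card_pair: "card (hpair a) = 2" for a by (simp add: hpair_def)
  have n0: "0 < n" using n by simp
  show "coord (Suc k) (ce_diff g k f) S = heis_coboundary m n (coord k f) S"
  proof (cases "S \<in> ksubs n (Suc k)")
    case S: True
    then have fin: "finite S" and sub: "S \<subseteq> {..<n}" and card: "card S = Suc k"
      using finite_subset by (auto simp: ksubs_def)
    let ?P = "{(p, q). p \<in> S \<and> q \<in> S \<and> p < q}"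
    let ?F = "\<lambda>(p, q). (-1) ^ (card {x \<in> S. x < p} + card {x \<in> S. x < q}) *
        f (brk g (e p) (e q) # map e (sorted_list_of_set (S - {p, q})))"
    let ?pr = "\<lambda>a. (2 * a + 1, 2 * a + 2)"
    let ?A = "{a. a < m \<and> hpair a \<subseteq> S}"
    have finP: "finite ?P"
      by (rule finite_subset[of _ "S \<times> S"]) (use fin in auto)
    have zero: "?F b = 0" if b0: "b \<in> ?P - ?pr ` ?A" for b
    proof -
      obtain p q where b: "b = (p, q)" "p \<in> S" "q \<in> S" "p < q" using b0 by blast
      have nx: "\<not> (\<exists>a<m. p = 2 * a + 1 \<and> q = 2 * a + 2)"
        using b0 b by (auto simp: hpair_def)
      have "q < n" using b sub by auto
      from brk[OF b(4) this] have "brk g (e p) (e q) = 0" by (simp only: nx if_False)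
      then show ?thesis by (simp add: b cochain_Cons_0[OF f])
    qed
    \<comment> \<open>The two elements of the pair are neighbours in \<open>S\<close>, so their
      positions differ by one and the exponent is odd.\<close>
    have val: "?F (?pr a) = - f (e 0 # map e (sorted_list_of_set (S - hpair a)))" if "a \<in> ?A" for a
    proof -
      have "{x \<in> S. x < 2 * a + 2} = insert (2 * a + 1) {x \<in> S. x < 2 * a + 1}"
        using that by (auto simp: hpair_def)
      then have "card {x \<in> S. x < 2 * a + 2} = Suc (card {x \<in> S. x < 2 * a + 1})"
        using fin by simp
      moreover have "brk g (e (2 * a + 1)) (e (2 * a + 2)) = e 0"
        using that n by (subst brk) auto
      ultimately show ?thesis by (simp add: hpair_def)
    qed
    have "coord (Suc k) (ce_diff g k f) S = sum ?F (?pr ` ?A)"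
      unfolding coord_ce_diff[OF S]
      by (rule sum.mono_neutral_right[OF finP]) (use zero in \<open>auto simp: hpair_def\<close>)
    also have "\<dots> = (\<Sum>a\<in>?A. ?F (?pr a))"
      by (subst sum.reindex) (auto simp: inj_on_def)
    also have "\<dots> = (\<Sum>a\<in>?A. - f (e 0 # map e (sorted_list_of_set (S - hpair a))))"
      by (intro sum.cong refl val)
    also have "\<dots> = heis_coboundary m n (coord k f) S"
    proof (cases "0 \<in> S")
      case True
      \<comment> \<open>The bracket value \<open>Z\<close> meets a second \<open>Z\<close> among the
        remaining arguments.\<close>
      have "f (e 0 # map e (sorted_list_of_set (S - hpair a))) = 0" if "a \<in> ?A" for a
      proof -
        have "0 \<in> set (sorted_list_of_set (S - hpair a))"
          using True fin by (simp add: hpair_def)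
        then obtain ws vs where w: "sorted_list_of_set (S - hpair a) = ws @ 0 # vs"
          by (meson split_list)
        have "set (0 # sorted_list_of_set (S - hpair a)) \<subseteq> {..<n}"
          using fin sub n0 by auto
        moreover have "length (0 # sorted_list_of_set (S - hpair a)) = k"
        proof -
          have "2 \<le> card S" using card_mono[OF fin, of "hpair a"] that card_pair by simp
          moreover have "finite (hpair a)" by (simp add: hpair_def)
          then have "card (S - hpair a) = card S - 2"
            using that card_Diff_subset[of "hpair a" S] card_pair by simp
          ultimately show ?thesis using fin card by simp
        qed
        ultimately have "[] @ e 0 # map e ws @ e 0 # map e vs \<in> arg_lists g k"
          using map_e_arg[of "0 # ws @ 0 # vs" k] unfolding w by simp
        from cochain_dup[OF f this] show ?thesis by (simp add: w)
      qed
      then have "(\<Sum>a\<in>?A. - f (e 0 # map e (sorted_list_of_set (S - hpair a)))) = 0" by simp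
      moreover have "\<not> S \<subseteq> {1..<n}" using True by auto
      ultimately show ?thesis by (simp add: heis_coboundary_def)
    next
      case False
      then have S1: "S \<subseteq> {1..<n}" using sub by (auto simp: Suc_le_eq intro: gr0I)
      have "f (e 0 # map e (sorted_list_of_set (S - hpair a))) = coord k f (insert 0 (S - hpair a))"
        if "a \<in> ?A" for a
      proof -
        have "sorted_list_of_set (insert 0 (S - hpair a)) = 0 # sorted_list_of_set (S - hpair a)"
          by (rule sorted_list_of_set_insert_less) (use fin S1 in auto)
        moreover have "insert 0 (S - hpair a) \<in> ksubs n k"
        proof -
          have "2 \<le> card S" using card_mono[OF fin, of "hpair a"] that card_pair by simp
          then have "card (insert 0 (S - hpair a)) = k"
            using fin False that card by (simp add: card_Diff_subset card_pair hpair_def)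
          then show ?thesis using sub n0 by (auto simp: ksubs_def)
        qed
        ultimately show ?thesis by (simp add: coord_def)
      qed
      then show ?thesis using S1 by (simp add: heis_coboundary_def pair_sum_def sum_negf)
    qed
    finally show ?thesis .
  next
    case False
    have "coord k f (insert 0 (S - hpair a)) = 0" if S: "S \<subseteq> {1..<n}" "hpair a \<subseteq> S" for a
    proof -
      have fin: "finite S" using S(1) finite_subset by blast
      have "2 \<le> card S" using card_mono[OF fin S(2)] card_pair by simp
      moreover have "0 \<notin> S" using S(1) by auto
      ultimately have "Suc (card (insert 0 (S - hpair a))) = card S"
        using fin S(2) by (simp add: card_Diff_subset card_pair hpair_def)
      moreover have "S \<subseteq> {..<n}" using S(1) by auto
      ultimately have "insert 0 (S - hpair a) \<notin> ksubs n k"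
        using False by (auto simp: ksubs_def)
      then show ?thesis by (simp add: coord_def)
    qed
    then show ?thesis using False by (auto simp: coord_def heis_coboundary_def pair_sum_def)
  qed
qed

section \<open>Rank of the multiplication by the symplectic form\<close>

text \<open>The image of a basis is independent and has \<open>dim V\<close> elements, so nothing is
  left to complete it with.\<close>

lemma linear_inj_endo_surj:
  fixes f :: "'v::real_vector \<Rightarrow> 'v"
  assumes f: "linear f" and V: "subspace V" "V \<subseteq> span W" "finite W"
    and inj: "inj_on f V" and im: "f ` V \<subseteq> V"
  shows "f ` V = V"
proof
  show "f ` V \<subseteq> V" by (fact im)
  obtain D where D: "D \<subseteq> V" "independent D" "V \<subseteq> span D" "card D = dim V"
    by (rule basis_exists)
  have sp: "span D = V"
    using D(1,3) V(1) by (simp add: span_minimal subset_antisym)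
  have ind: "independent (f ` D)"
    using linear_independent_injective_image[OF f D(2)] inj sp by simp
  have sub: "f ` D \<subseteq> V" using D(1) im by auto
  obtain E where E: "f ` D \<inter> E = {}" "f ` D \<union> E \<subseteq> V" "independent (f ` D \<union> E)"
    "V \<subseteq> span (f ` D \<union> E)" "finite (f ` D)" "finite E" "card (f ` D) + card E = dim V"
    by (rule finite_basis_extend[OF V ind sub])
  have "card (f ` D) = card D"
    using inj D(1) by (meson card_image inj_on_subset)
  then have "E = {}" using E(6,7) D(4) by simp
  then have "V \<subseteq> span (f ` D)" using E(4) by simp
  also have "span (f ` D) = f ` V" using linear_span_image[OF f, of D] sp by simp
  finally show "V \<subseteq> f ` V" .
qed

section \<open>Multiplication by \<omega>, its adjoint and their commutator\<close>

text \<open>Contraction with the bivector dual to \<omega>.\<close>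

definition pair_drop :: "nat \<Rightarrow> (nat set \<Rightarrow> real) \<Rightarrow> nat set \<Rightarrow> real" where
  "pair_drop m \<phi> S = (\<Sum>a | a < m \<and> hpair a \<inter> S = {}. \<phi> (S \<union> hpair a))"

definition level :: "nat \<Rightarrow> nat set \<Rightarrow> nat" where
  "level m S = card (S \<inter> {1..2 * m})"

text \<open>With a guard instead of a restricted range, the range no longer depends on
  \<open>S\<close> and sums can be interchanged.\<close>

lemma pair_sum_alt: "pair_sum m \<phi> S = (\<Sum>a<m. if hpair a \<subseteq> S then \<phi> (S - hpair a) else 0)"
  unfolding pair_sum_def by (intro sum.mono_neutral_cong_left) auto

lemma pair_drop_alt: "pair_drop m \<phi> S = (\<Sum>a<m. if hpair a \<inter> S = {} then \<phi> (S \<union> hpair a) else 0)"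
  unfolding pair_drop_def by (intro sum.mono_neutral_cong_left) auto

lemma linear_pair_sum: "linear (pair_sum m)"
  by (rule linearI) (auto simp: fun_eq_iff pair_sum_def sum.distrib sum_distrib_left)

lemma linear_pair_drop: "linear (pair_drop m)"
  by (rule linearI) (auto simp: fun_eq_iff pair_drop_def sum.distrib sum_distrib_left)

lemma hpair_subset: "a < m \<Longrightarrow> hpair a \<subseteq> {1..2 * m}"
  by (auto simp: hpair_def)

lemma finite_hpair [simp]: "finite (hpair a)" and card_hpair [simp]: "card (hpair a) = 2"
  by (simp_all add: hpair_def)

lemma hpair_disjoint: "a \<noteq> b \<Longrightarrow> hpair a \<inter> hpair b = {}"
  by (auto simp: hpair_def)

lemma level_eq_sum: "level m S = (\<Sum>a<m. card (S \<inter> hpair a))"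
proof (induction m)
  case 0
  then show ?case by (simp add: level_def)
next
  case (Suc m)
  have "S \<inter> {1..2 * Suc m} = (S \<inter> {1..2 * m}) \<union> (S \<inter> hpair m)"
    by (auto simp: hpair_def)
  moreover have "(S \<inter> {1..2 * m}) \<inter> (S \<inter> hpair m) = {}"
    by (auto simp: hpair_def)
  ultimately have "level (Suc m) S = level m S + card (S \<inter> hpair m)"
    unfolding level_def by (simp add: card_Un_disjoint)
  then show ?case using Suc by simp
qed

lemma level_Diff_hpair:
  assumes "a < m" "hpair a \<subseteq> S"
  shows "level m (S - hpair a) + 2 = level m S"
proof -
  have "(S - hpair a) \<inter> {1..2 * m} = S \<inter> {1..2 * m} - hpair a" by auto
  moreover have "hpair a \<subseteq> S \<inter> {1..2 * m}" using assms hpair_subset by auto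
  moreover from this have "2 \<le> card (S \<inter> {1..2 * m})"
    using card_mono[of "S \<inter> {1..2 * m}" "hpair a"] by simp
  ultimately show ?thesis by (simp add: level_def card_Diff_subset)
qed

lemma level_Un_hpair:
  assumes "a < m" "hpair a \<inter> S = {}"
  shows "level m (S \<union> hpair a) = level m S + 2"
  using level_Diff_hpair[of a m "S \<union> hpair a"] assms by (simp add: Un_Diff Int_commute Diff_triv)

text \<open>For each \<open>a\<close>, removal of the pair is a bijection from the sets containing
  it onto the sets disjoint from it. The hypothesis on \<open>{1..2 * m}\<close> keeps the inverse
  inside \<open>Pow V\<close>.\<close>

lemma pair_sum_adjoint:
  assumes V: "finite V" "{1..2 * m} \<subseteq> V"
  shows "(\<Sum>S\<in>Pow V. pair_sum m \<phi> S * \<psi> S) = (\<Sum>S\<in>Pow V. \<phi> S * pair_drop m \<psi> S)"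
proof -
  have "(\<Sum>S\<in>Pow V. if hpair a \<subseteq> S then \<phi> (S - hpair a) * \<psi> S else 0) =
      (\<Sum>S\<in>Pow V. if hpair a \<inter> S = {} then \<phi> S * \<psi> (S \<union> hpair a) else 0)" if "a < m" for a
  proof -
    have aV: "hpair a \<subseteq> V" using hpair_subset[OF that] V(2) by auto
    have "(\<Sum>S\<in>Pow V. if hpair a \<subseteq> S then \<phi> (S - hpair a) * \<psi> S else 0) =
        (\<Sum>S\<in>{S \<in> Pow V. hpair a \<subseteq> S}. \<phi> (S - hpair a) * \<psi> S)"
      using V(1) by (intro sum.mono_neutral_cong_right) auto
    also have "\<dots> = (\<Sum>S\<in>{S \<in> Pow V. hpair a \<inter> S = {}}. \<phi> S * \<psi> (S \<union> hpair a))"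
    proof (rule sum.reindex_bij_witness[where j = "\<lambda>S. S - hpair a" and i = "\<lambda>S. S \<union> hpair a"])
      fix S assume "S \<in> {S \<in> Pow V. hpair a \<subseteq> S}"
      then have "S \<subseteq> V" and eq: "S - hpair a \<union> hpair a = S" by auto
      then show "S - hpair a \<in> {S \<in> Pow V. hpair a \<inter> S = {}}" by auto
      show "S - hpair a \<union> hpair a = S" by (rule eq)
      show "\<phi> (S - hpair a) * \<psi> (S - hpair a \<union> hpair a) = \<phi> (S - hpair a) * \<psi> S"
        by (simp only: eq)
    qed (use aV in auto)
    also have "\<dots> = (\<Sum>S\<in>Pow V. if hpair a \<inter> S = {} then \<phi> S * \<psi> (S \<union> hpair a) else 0)"
      using V(1) by (intro sum.mono_neutral_cong_left) auto
    finally show ?thesis .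
  qed
  then have "(\<Sum>a<m. \<Sum>S\<in>Pow V. if hpair a \<subseteq> S then \<phi> (S - hpair a) * \<psi> S else 0) =
      (\<Sum>a<m. \<Sum>S\<in>Pow V. if hpair a \<inter> S = {} then \<phi> S * \<psi> (S \<union> hpair a) else 0)"
    by (rule sum.cong[OF refl]) (simp only: lessThan_iff)
  then show ?thesis
    unfolding pair_sum_alt pair_drop_alt sum_distrib_left sum_distrib_right
    by (subst sum.swap, subst (2) sum.swap) (simp add: if_distrib[of "\<lambda>x. x * _"] if_distrib[of "(*) _"] cong: if_cong)
qed

text \<open>Adding one pair and removing another commute, so only the diagonal terms differ. There
  each pair contributes 1 if it misses \<open>S\<close>, -1 if it lies in \<open>S\<close>, and 0 if
  it meets \<open>S\<close> in one point, that is \<open>1 - card (S \<inter> hpair a)\<close>; the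
  sum over all pairs is \<open>m - level m S\<close>.\<close>

lemma pair_commutator:
  "pair_drop m (pair_sum m \<phi>) S = pair_sum m (pair_drop m \<phi>) S + (real m - real (level m S)) * \<phi> S"
proof -
  define A where "A a b = (if hpair a \<inter> S = {} \<and> hpair b \<subseteq> S \<union> hpair a
    then \<phi> (S \<union> hpair a - hpair b) else 0)" for a b
  define B where "B a b = (if hpair b \<subseteq> S \<and> hpair a \<inter> (S - hpair b) = {}
    then \<phi> ((S - hpair b) \<union> hpair a) else 0)" for a b
  have A: "pair_drop m (pair_sum m \<phi>) S = (\<Sum>a<m. \<Sum>b<m. A a b)"
    unfolding pair_sum_alt pair_drop_alt A_def by (intro sum.cong) auto
  have "pair_sum m (pair_drop m \<phi>) S = (\<Sum>b<m. \<Sum>a<m. B a b)"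
    unfolding pair_sum_alt pair_drop_alt B_def by (intro sum.cong) auto
  then have B: "pair_sum m (pair_drop m \<phi>) S = (\<Sum>a<m. \<Sum>b<m. B a b)"
    by (simp add: sum.swap[of B])
  have AB: "A a b = B a b + (if b = a then (1 - real (card (S \<inter> hpair a))) * \<phi> S else 0)" for a b
  proof (cases "a = b")
    case False
    have "hpair b \<subseteq> S \<union> hpair a \<longleftrightarrow> hpair b \<subseteq> S" "hpair a \<inter> (S - hpair b) = {} \<longleftrightarrow> hpair a \<inter> S = {}"
      "S \<union> hpair a - hpair b = (S - hpair b) \<union> hpair a"
      using hpair_disjoint[OF False] by blast+
    then show ?thesis using False by (auto simp: A_def B_def)
  next
    case True
    have "A a a = (if hpair a \<inter> S = {} then \<phi> S else 0)"
    proof -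
      have "S \<union> hpair a - hpair a = S" if "hpair a \<inter> S = {}" using that by auto
      then show ?thesis by (auto simp: A_def)
    qed
    moreover have "B a a = (if hpair a \<subseteq> S then \<phi> S else 0)"
    proof -
      have "S - hpair a \<union> hpair a = S" if "hpair a \<subseteq> S" using that by auto
      then show ?thesis by (auto simp: B_def)
    qed
    moreover have "hpair a \<inter> S = {} \<and> \<not> hpair a \<subseteq> S \<and> card (S \<inter> hpair a) = 0 \<or>
        hpair a \<inter> S \<noteq> {} \<and> hpair a \<subseteq> S \<and> card (S \<inter> hpair a) = 2 \<or>
        hpair a \<inter> S \<noteq> {} \<and> \<not> hpair a \<subseteq> S \<and> card (S \<inter> hpair a) = 1"
      by (auto simp: hpair_def Int_insert_right)
    ultimately show ?thesis using True by auto
  qed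
  have "(\<Sum>a<m. (1 - real (card (S \<inter> hpair a))) * \<phi> S) = (real m - real (level m S)) * \<phi> S"
    by (simp add: level_eq_sum sum_distrib_right[symmetric] sum_subtractf)
  then show ?thesis
    unfolding A B AB by (simp add: sum.distrib)
qed

text \<open>For \<open>U = pair_sum m\<close> and \<open>D = pair_drop m\<close> this is
  \<open>\<parallel>U \<phi>\<parallel>\<^sup>2 = \<parallel>D \<phi>\<parallel>\<^sup>2 + \<Sum>\<^sub>S (m - level S) \<phi>(S)\<^sup>2\<close>: \<open>U\<close> is injective below the middle level
  and \<open>D\<close> is injective above it.\<close>

lemma pair_sum_norm:
  assumes V: "finite V" "{1..2 * m} \<subseteq> V"
  shows "(\<Sum>S\<in>Pow V. pair_sum m \<phi> S * pair_sum m \<phi> S) =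
    (\<Sum>S\<in>Pow V. pair_drop m \<phi> S * pair_drop m \<phi> S) +
    (\<Sum>S\<in>Pow V. (real m - real (level m S)) * (\<phi> S * \<phi> S))"
proof -
  have "(\<Sum>S\<in>Pow V. pair_sum m \<phi> S * pair_sum m \<phi> S) =
      (\<Sum>S\<in>Pow V. \<phi> S * pair_drop m (pair_sum m \<phi>) S)"
    by (rule pair_sum_adjoint[OF V])
  also have "\<dots> = (\<Sum>S\<in>Pow V. pair_sum m (pair_drop m \<phi>) S * \<phi> S) +
      (\<Sum>S\<in>Pow V. (real m - real (level m S)) * (\<phi> S * \<phi> S))"
    by (simp add: pair_commutator algebra_simps sum.distrib sum_subtractf)
  also have "(\<Sum>S\<in>Pow V. pair_sum m (pair_drop m \<phi>) S * \<phi> S) =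
      (\<Sum>S\<in>Pow V. pair_drop m \<phi> S * pair_drop m \<phi> S)"
    by (rule pair_sum_adjoint[OF V])
  finally show ?thesis .
qed

text \<open>On the right of the norm identity both terms are non-negative and add up to zero, while
  the weights on \<open>X\<close> are positive.\<close>

lemma pair_sum_eq_0:
  assumes V: "finite V" "{1..2 * m} \<subseteq> V"
    and X: "\<And>S. S \<in> X \<Longrightarrow> S \<subseteq> V \<and> level m S < m"
    and \<phi>: "\<phi> \<in> supported X" and z: "pair_sum m \<phi> = 0"
  shows "\<phi> = 0"
proof
  fix S
  let ?w = "\<lambda>S. (real m - real (level m S)) * (\<phi> S * \<phi> S)"
  have nn: "0 \<le> ?w S" for S
    using X[of S] \<phi> by (cases "S \<in> X") (auto simp: supported_def)
  have "0 \<le> (\<Sum>S\<in>Pow V. pair_drop m \<phi> S * pair_drop m \<phi> S)" by (intro sum_nonneg) simp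
  moreover have "0 \<le> sum ?w (Pow V)" using nn by (intro sum_nonneg) simp
  ultimately have "sum ?w (Pow V) = 0" using pair_sum_norm[OF V, of \<phi>] z by simp
  then have w: "\<forall>S\<in>Pow V. ?w S = 0"
    using V(1) nn by (subst (asm) sum_nonneg_eq_0_iff) auto
  show "\<phi> S = 0 S"
  proof (cases "S \<in> X")
    case True
    then show ?thesis using bspec[OF w, of S] X[of S] by simp
  next
    case False
    then show ?thesis using \<phi> by (simp add: supported_def)
  qed
qed

text \<open>The norm identity with weights of opposite sign. Vanishing on subsets of
  \<open>V\<close> is enough because the norms are sums over \<open>Pow V\<close>.\<close>

lemma pair_drop_eq_0:
  assumes V: "finite V" "{1..2 * m} \<subseteq> V"
    and Y: "\<And>S. S \<in> Y \<Longrightarrow> S \<subseteq> V \<and> m < level m S"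
    and \<phi>: "\<phi> \<in> supported Y" and z: "\<And>S. S \<subseteq> V \<Longrightarrow> pair_drop m \<phi> S = 0"
  shows "\<phi> = 0"
proof
  fix S
  let ?w = "\<lambda>S. (real (level m S) - real m) * (\<phi> S * \<phi> S)"
  have nn: "0 \<le> ?w S" for S
    using Y[of S] \<phi> by (cases "S \<in> Y") (auto simp: supported_def)
  have "0 \<le> (\<Sum>S\<in>Pow V. pair_sum m \<phi> S * pair_sum m \<phi> S)" by (intro sum_nonneg) simp
  also have "\<dots> = - sum ?w (Pow V)"
    using pair_sum_norm[OF V, of \<phi>] z by (simp add: sum_negf[symmetric] algebra_simps)
  finally have "sum ?w (Pow V) = 0" using nn by (intro antisym sum_nonneg) auto
  then have w: "\<forall>S\<in>Pow V. ?w S = 0"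
    using V(1) nn by (subst (asm) sum_nonneg_eq_0_iff) auto
  show "\<phi> S = 0 S"
  proof (cases "S \<in> Y")
    case True
    then show ?thesis using bspec[OF w, of S] Y[of S] by simp
  next
    case False
    then show ?thesis using \<phi> by (simp add: supported_def)
  qed
qed

definition zero_off :: "'b set \<Rightarrow> ('b \<Rightarrow> real) \<Rightarrow> 'b \<Rightarrow> real" where
  "zero_off X \<phi> = (\<lambda>S. if S \<in> X then \<phi> S else 0)"

lemma linear_zero_off: "linear (zero_off X)"
  by (rule linearI) (auto simp: fun_eq_iff zero_off_def)

lemma supported_subset: "\<phi> \<in> supported A \<Longrightarrow> A \<subseteq> B \<Longrightarrow> \<phi> \<in> supported B"
  by (auto simp: supported_def)

lemma zero_off_supported: "\<phi> \<in> supported A \<Longrightarrow> zero_off X \<phi> \<in> supported (X \<inter> A)"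
  by (auto simp: zero_off_def supported_def)

lemma pair_sum_supported:
  assumes "\<phi> \<in> supported X"
    and "\<And>S a. a < m \<Longrightarrow> hpair a \<subseteq> S \<Longrightarrow> S - hpair a \<in> X \<Longrightarrow> S \<in> Y"
  shows "pair_sum m \<phi> \<in> supported Y"
  using assms unfolding supported_def pair_sum_def by (auto intro!: sum.neutral)

lemma pair_drop_supported:
  assumes "\<phi> \<in> supported Y"
    and "\<And>S a. a < m \<Longrightarrow> hpair a \<inter> S = {} \<Longrightarrow> S \<union> hpair a \<in> Y \<Longrightarrow> S \<in> X"
  shows "pair_drop m \<phi> \<in> supported X"
  using assms unfolding supported_def pair_drop_def by (auto intro!: sum.neutral)

section \<open>The image of multiplication by \<omega>\<close>

definition low :: "nat \<Rightarrow> nat set \<Rightarrow> nat \<Rightarrow> nat set set" where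
  "low m V j = {S. S \<subseteq> V \<and> card S = j \<and> level m S < m}"

definition high :: "nat \<Rightarrow> nat set \<Rightarrow> nat \<Rightarrow> nat set set" where
  "high m V j = {S. S \<subseteq> V \<and> card S = j \<and> m \<le> level m S}"

lemma card_Diff_hpair:
  assumes "finite S" "hpair a \<subseteq> S"
  shows "card (S - hpair a) + 2 = card S"
  using assms card_mono[of S "hpair a"] by (simp add: card_Diff_subset)

definition top_high :: "nat \<Rightarrow> nat set \<Rightarrow> nat \<Rightarrow> nat set set" where
  "top_high m V j = {S. S \<subseteq> V \<and> card S = j \<and> m + 2 \<le> level m S}"

text \<open>The image is the direct sum of an injective copy of the functions on \<open>low\<close>
  and of all functions on \<open>top_high\<close>. Sets in \<open>high\<close> are those that
  \<open>U\<close> sends into \<open>top_high\<close>; the degree rises from \<open>j\<close> to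
  \<open>j + 2\<close>.\<close>

lemma dim_pair_sum_image:
  assumes V: "finite V" "{1..2 * m} \<subseteq> V"
  shows "dim (pair_sum m ` supported {S. S \<subseteq> V \<and> card S = j}) =
    card (low m V j) + card (top_high m V (j + 2))"
proof -
  let ?L = "{S. S \<subseteq> V \<and> card S = j}" and ?X = "low m V j" and ?X' = "high m V j"
    and ?Y = "top_high m V (j + 2)"
  let ?U = "pair_sum m" and ?D = "pair_drop m"
  have fin: "finite ?X" "finite ?Y"
    using V(1) by (auto simp: low_def top_high_def intro!: finite_subset[of _ "Pow V"])
  have disj: "?X \<inter> ?Y = {}" by (auto simp: low_def top_high_def)
  have XX': "?L = ?X \<union> ?X'" "?X \<inter> ?X' = {}" by (auto simp: low_def high_def)
  have UX': "?U \<phi> \<in> supported ?Y" if "\<phi> \<in> supported ?X'" for \<phi>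
  proof (rule pair_sum_supported[OF that])
    fix S a assume a: "a < m" "hpair a \<subseteq> S" "S - hpair a \<in> ?X'"
    then have "hpair a \<subseteq> V" using hpair_subset V(2) by blast
    then have S: "S \<subseteq> V" using a by (auto simp: high_def)
    then have "finite S" using V(1) finite_subset by blast
    then show "S \<in> ?Y"
      using S card_Diff_hpair[OF _ a(2)] level_Diff_hpair[OF a(1,2)] a(3)
      by (auto simp: high_def top_high_def)
  qed
  have DY: "?D \<psi> \<in> supported ?X'" if "\<psi> \<in> supported ?Y" for \<psi>
  proof (rule pair_drop_supported[OF that])
    fix S a assume a: "a < m" "hpair a \<inter> S = {}" "S \<union> hpair a \<in> ?Y"
    then have S: "S \<subseteq> V" by (auto simp: top_high_def)
    then have "finite S" using V(1) finite_subset by blast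
    then have "card (S \<union> hpair a) = card S + 2" using a(2) by (subst card_Un_disjoint) auto
    then show "S \<in> ?X'"
      using S level_Un_hpair[OF a(1,2)] a(3) by (auto simp: high_def top_high_def)
  qed
  \<comment> \<open>It suffices that \<open>U\<close> after \<open>D\<close> is injective on
    functions on \<open>?Y\<close>, a finite-dimensional space that it preserves. If it kills
    \<open>\<psi>\<close>, adjointness makes the norm of \<open>D \<psi>\<close> zero, and
    \<open>D\<close> is injective above the middle level.\<close>
  have surj: "supported ?Y \<subseteq> ?U ` supported ?X'"
  proof -
    have lin: "linear (?U \<circ> ?D)" by (rule linear_compose[OF linear_pair_drop linear_pair_sum])
    have zero: "\<psi> = 0" if \<psi>: "\<psi> \<in> supported ?Y" and z: "?U (?D \<psi>) = 0" for \<psi>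
    proof -
      have "(\<Sum>S\<in>Pow V. ?D \<psi> S * ?D \<psi> S) = 0"
        using pair_sum_adjoint[OF V, of "?D \<psi>" \<psi>] z by simp
      then have "\<forall>S\<in>Pow V. ?D \<psi> S * ?D \<psi> S = 0"
        using V(1) by (subst (asm) sum_nonneg_eq_0_iff) auto
      then show ?thesis
        by (intro pair_drop_eq_0[OF V _ \<psi>]) (auto simp: top_high_def)
    qed
    have "inj_on (?U \<circ> ?D) (supported ?Y)"
    proof (rule inj_onI)
      fix x y assume xy: "x \<in> supported ?Y" "y \<in> supported ?Y" "(?U \<circ> ?D) x = (?U \<circ> ?D) y"
      then have "(?U \<circ> ?D) (x - y) = 0" using linear_diff[OF lin, of x y] by simp
      with xy zero[of "x - y"] show "x = y"
        using subspace_diff[OF subspace_supported] by auto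
    qed
    then have "(?U \<circ> ?D) ` supported ?Y = supported ?Y"
      using linear_inj_endo_surj[OF lin subspace_supported supported_span[OF fin(2)]] fin UX' DY
      by (metis (no_types, lifting) comp_apply finite_imageI image_subsetI)
    then show ?thesis using DY by (metis (no_types, lifting) image_comp image_mono image_subsetI)
  qed
  \<comment> \<open>A parametrization of the image: the part on \<open>?X\<close> is pushed through
    \<open>U\<close>, the part on \<open>?Y\<close> is taken as it is.\<close>
  define \<Psi> where "\<Psi> \<psi> = ?U (zero_off ?X \<psi>) + zero_off ?Y \<psi>" for \<psi>
  have lin: "linear \<Psi>"
    unfolding \<Psi>_def using linear_compose[OF linear_zero_off linear_pair_sum]
    by (intro linear_compose_add linear_zero_off) (simp add: comp_def)
  have zero: "\<psi> = 0" if \<psi>: "\<psi> \<in> supported (?X \<union> ?Y)" and z: "\<Psi> \<psi> = 0" for \<psi>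
  proof -
    have "zero_off ?X \<psi> \<in> supported (?X \<inter> (?X \<union> ?Y))" by (rule zero_off_supported[OF \<psi>])
    then have mX: "zero_off ?X \<psi> \<in> supported ?X" by (rule supported_subset) blast
    \<comment> \<open>Levels up to \<open>m + 1\<close> on one side and from \<open>m + 2\<close> on
      the other: the two summands of \<open>\<Psi>\<close> have disjoint supports and vanish
      separately.\<close>
    have "?U (zero_off ?X \<psi>) \<in> supported {S. level m S \<le> m + 1}"
    proof (rule pair_sum_supported[OF mX])
      fix S a assume "a < m" "hpair a \<subseteq> S" "S - hpair a \<in> ?X"
      then show "S \<in> {S. level m S \<le> m + 1}"
        using level_Diff_hpair[of a m S] by (simp add: low_def)
    qed
    moreover have "?U (zero_off ?X \<psi>) S = - zero_off ?Y \<psi> S" for S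
      using fun_cong[OF z, of S] by (simp add: \<Psi>_def)
    then have "?U (zero_off ?X \<psi>) S = 0" if "level m S \<le> m + 1" for S
      using that by (simp add: zero_off_def top_high_def)
    ultimately have "?U (zero_off ?X \<psi>) S = 0" for S by (auto simp: supported_def)
    then have U0: "?U (zero_off ?X \<psi>) = 0" by auto
    have "zero_off ?X \<psi> = 0"
      by (rule pair_sum_eq_0[OF V _ mX U0]) (auto simp: low_def)
    moreover have "zero_off ?Y \<psi> = 0" using z U0 by (simp add: \<Psi>_def)
    ultimately have "\<psi> S = 0" for S
      using \<psi> by (auto simp: supported_def zero_off_def fun_eq_iff) metis
    then show ?thesis by auto
  qed
  have inj: "inj_on \<Psi> (supported (?X \<union> ?Y))"
  proof (rule inj_onI)
    fix x y assume xy: "x \<in> supported (?X \<union> ?Y)" "y \<in> supported (?X \<union> ?Y)" "\<Psi> x = \<Psi> y"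
    then have "\<Psi> (x - y) = 0" by (simp add: linear_diff[OF lin])
    with xy zero[of "x - y"] show "x = y"
      using subspace_diff[OF subspace_supported] by auto
  qed
  have image: "\<Psi> ` supported (?X \<union> ?Y) = ?U ` supported ?L"
  proof (intro equalityI image_subsetI)
    fix \<psi> assume \<psi>: "\<psi> \<in> supported (?X \<union> ?Y)"
    have "zero_off ?X \<psi> \<in> supported (?X \<inter> (?X \<union> ?Y))" by (rule zero_off_supported[OF \<psi>])
    then have 1: "zero_off ?X \<psi> \<in> supported ?L" by (rule supported_subset) (use XX' in blast)
    have "zero_off ?Y \<psi> \<in> supported (?Y \<inter> (?X \<union> ?Y))" by (rule zero_off_supported[OF \<psi>])
    then have "zero_off ?Y \<psi> \<in> supported ?Y" by (rule supported_subset) blast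
    then obtain \<phi> where \<phi>: "\<phi> \<in> supported ?X'" "zero_off ?Y \<psi> = ?U \<phi>" using surj by blast
    have 2: "\<phi> \<in> supported ?L" by (rule supported_subset[OF \<phi>(1)]) (use XX' in blast)
    have "\<Psi> \<psi> = ?U (zero_off ?X \<psi> + \<phi>)"
      by (simp only: \<Psi>_def \<phi>(2) linear_add[OF linear_pair_sum])
    moreover have "zero_off ?X \<psi> + \<phi> \<in> supported ?L" by (rule subspace_add[OF subspace_supported 1 2])
    ultimately show "\<Psi> \<psi> \<in> ?U ` supported ?L" by blast
  next
    fix \<phi> assume \<phi>: "\<phi> \<in> supported ?L"
    let ?u = "?U (zero_off ?X' \<phi>)" and ?v = "zero_off ?X \<phi>"
    have "zero_off ?X' \<phi> \<in> supported (?X' \<inter> ?L)" by (rule zero_off_supported[OF \<phi>])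
    then have "zero_off ?X' \<phi> \<in> supported ?X'" by (rule supported_subset) blast
    then have u: "?u \<in> supported ?Y" by (rule UX')
    have "?v \<in> supported (?X \<inter> ?L)" by (rule zero_off_supported[OF \<phi>])
    then have v: "?v \<in> supported ?X" by (rule supported_subset) blast
    have "zero_off ?X (?v + ?u) = ?v" "zero_off ?Y (?v + ?u) = ?u"
      using u v disj by (auto simp: zero_off_def supported_def fun_eq_iff)
    then have "\<Psi> (?v + ?u) = ?U ?v + ?u" by (simp add: \<Psi>_def)
    also have "\<dots> = ?U (?v + zero_off ?X' \<phi>)" by (simp add: linear_add[OF linear_pair_sum])
    also have "?v + zero_off ?X' \<phi> = \<phi>"
      using \<phi> XX' by (auto simp: zero_off_def supported_def fun_eq_iff)
    finally have "?U \<phi> = \<Psi> (?v + ?u)" by (rule sym)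
    moreover have "?v + ?u \<in> supported (?X \<union> ?Y)"
      by (intro subspace_add[OF subspace_supported] supported_subset[OF v] supported_subset[OF u]) auto
    ultimately show "?U \<phi> \<in> \<Psi> ` supported (?X \<union> ?Y)" by blast
  qed
  have "dim (\<Psi> ` supported (?X \<union> ?Y)) = card (?X \<union> ?Y)"
    using dim_image_inj[OF lin subspace_supported supported_span _ inj] fin
    by (simp add: dim_supported)
  then show ?thesis using image card_Un_disjoint[OF fin disj] by simp
qed

section \<open>Betti numbers from ranks\<close>

text \<open>The cutoff moves from the result to the argument: all pairs lie in
  \<open>{1..<n}\<close>, so adding or removing one does not affect membership there.\<close>

lemma heis_coboundary_pair_sum:
  assumes "2 * m + 1 \<le> n"
  shows "heis_coboundary m n \<phi> = pair_sum m (\<lambda>T. if T \<subseteq> {1..<n} then - \<phi> (insert 0 T) else 0)"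
proof
  fix S
  have pV: "hpair a \<subseteq> {1..<n}" if "a < m" for a
    using hpair_subset[OF that] assms by (auto simp: subset_iff)
  show "heis_coboundary m n \<phi> S =
      pair_sum m (\<lambda>T. if T \<subseteq> {1..<n} then - \<phi> (insert 0 T) else 0) S"
  proof (cases "S \<subseteq> {1..<n}")
    case True
    then have "S - hpair a \<subseteq> {1..<n}" for a by auto
    then show ?thesis using True by (simp add: heis_coboundary_def pair_sum_def sum_negf)
  next
    case False
    then have "\<not> S - hpair a \<subseteq> {1..<n}" if "a < m" for a using pV[OF that] by blast
    then show ?thesis using False by (auto simp: heis_coboundary_def pair_sum_def)
  qed
qed

lemma dim_heis_coboundary_image:
  assumes n: "2 * m + 1 \<le> n"
  shows "dim (heis_coboundary m n ` supported (ksubs n k)) =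
    (case k of 0 \<Rightarrow> 0 | Suc j \<Rightarrow> card (low m {1..<n} j) + card (top_high m {1..<n} (j + 2)))"
proof -
  define r where "r \<phi> T = (if T \<subseteq> {1..<n} then - \<phi> (insert 0 T) else 0 :: real)"
    for \<phi> :: "nat set \<Rightarrow> real" and T
  have hr: "heis_coboundary m n \<phi> = pair_sum m (r \<phi>)" for \<phi>
    unfolding heis_coboundary_pair_sum[OF n] r_def ..
  have fin: "finite T" "0 \<notin> T" if "T \<subseteq> {1..<n}" for T
    using that finite_subset by auto
  have ksub: "insert 0 T \<in> ksubs n k \<longleftrightarrow> Suc (card T) = k" if "T \<subseteq> {1..<n}" for T k
    using that fin[OF that] n by (auto simp: ksubs_def)
  show ?thesis
  proof (cases k)
    case 0
    have "heis_coboundary m n \<phi> = 0" if "\<phi> \<in> supported (ksubs n k)" for \<phi>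
    proof -
      have "r \<phi> = 0"
        using that ksub[of _ k] 0 by (auto simp: r_def supported_def fun_eq_iff)
      then show ?thesis by (simp add: hr linear_0[OF linear_pair_sum])
    qed
    then have "heis_coboundary m n ` supported (ksubs n k) \<subseteq> {0}" by auto
    then have "heis_coboundary m n ` supported (ksubs n k) \<subseteq> span {}" by simp
    from dim_le_card[OF this] show ?thesis by (simp add: 0)
  next
    case (Suc j)
    \<comment> \<open>Contraction with \<open>Z\<close> maps the k-forms onto all forms of degree
      \<open>j\<close> in the other variables, so the rank is that of \<open>pair_sum\<close> in
      degree \<open>j\<close>.\<close>
    have "r ` supported (ksubs n k) = supported {S. S \<subseteq> {1..<n} \<and> card S = j}"
    proof (intro equalityI subsetI)
      fix \<psi> assume "\<psi> \<in> r ` supported (ksubs n k)"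
      then obtain \<phi> where \<phi>: "\<phi> \<in> supported (ksubs n k)" "\<psi> = r \<phi>" by blast
      have "\<psi> T = 0" if "\<not> (T \<subseteq> {1..<n} \<and> card T = j)" for T
        using that ksub[of T k] \<phi>(1) Suc unfolding \<phi>(2) r_def supported_def
        by (cases "T \<subseteq> {1..<n}") (simp_all only: if_True if_False, simp)
      then show "\<psi> \<in> supported {S. S \<subseteq> {1..<n} \<and> card S = j}"
        by (simp only: supported_def mem_Collect_eq) blast
    next
      fix \<psi> :: "nat set \<Rightarrow> real" assume \<psi>: "\<psi> \<in> supported {S. S \<subseteq> {1..<n} \<and> card S = j}"
      define \<phi> where "\<phi> S = (if S \<in> ksubs n k then - \<psi> (S - {0}) else 0)" for S
      have "\<psi> = r \<phi>"
      proof
        fix T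
        show "\<psi> T = r \<phi> T"
        proof (cases "T \<subseteq> {1..<n}")
          case True
          then have "insert 0 T - {0} = T" using fin(2)[OF True] by auto
          then show ?thesis using True ksub[OF True, of k] \<psi> Suc
            by (auto simp: r_def \<phi>_def supported_def)
        next
          case False
          then show ?thesis using \<psi> by (simp add: r_def supported_def)
        qed
      qed
      moreover have "\<phi> \<in> supported (ksubs n k)" by (simp add: \<phi>_def supported_def)
      ultimately show "\<psi> \<in> r ` supported (ksubs n k)" by (rule image_eqI)
    qed
    moreover have "heis_coboundary m n = pair_sum m \<circ> r"
      by (rule ext) (simp only: hr comp_apply)
    ultimately have "heis_coboundary m n ` supported (ksubs n k) =
        pair_sum m ` supported {S. S \<subseteq> {1..<n} \<and> card S = j}"
      by (simp only: image_comp[symmetric])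
    moreover have "{1..2 * m} \<subseteq> {1..<n}" using n by auto
    ultimately show ?thesis
      using dim_pair_sum_image[of "{1..<n}" m j] by (simp add: Suc)
  qed
qed

section \<open>Binomial coefficients and counting subsets by level\<close>

lemma binom_neg: "b < 0 \<Longrightarrow> binom a b = 0"
  by (simp add: binom_def)

lemma binom_of_nat: "binom (int a) (int b) = int (a choose b)"
  by (auto simp: binom_def)

lemma binom_sym: "0 \<le> a \<Longrightarrow> binom a (a - b) = binom a b"
  using binomial_symmetric[of "nat b" "nat a"]
  by (auto simp: binom_def nat_diff_distrib')

text \<open>The bound on \<open>a\<close> excludes \<open>a = -1\<close>, where at
  \<open>b = 0\<close> the left side is 1 and the right side is 0.\<close>

lemma binom_pascal: "0 \<le> a \<Longrightarrow> binom (a + 1) b = binom a b + binom a (b - 1)"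
proof -
  assume "0 \<le> a"
  then obtain c where a: "a = int c" using nonneg_int_cases by blast
  consider "b < 0" | "b = 0" | d where "b = int (Suc d)"
    by (metis linorder_cases not0_implies_Suc of_nat_0 pos_int_cases)
  then show ?thesis
  proof cases
    case 3
    have "binom (int (Suc c)) (int (Suc d)) = binom (int c) (int (Suc d)) + binom (int c) (int d)"
      unfolding binom_of_nat by simp
    then show ?thesis by (simp add: 3 a add.commute)
  qed (simp_all add: a binom_def)
qed

lemma card_subsets_Int:
  assumes "finite A" "finite B" "A \<inter> B = {}"
  shows "card {S. S \<subseteq> A \<union> B \<and> card (S \<inter> A) = i \<and> card S = i + j} = (card A choose i) * (card B choose j)"
proof -
  have "bij_betw (\<lambda>(X, Y). X \<union> Y) ({X. X \<subseteq> A \<and> card X = i} \<times> {Y. Y \<subseteq> B \<and> card Y = j})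
      {S. S \<subseteq> A \<union> B \<and> card (S \<inter> A) = i \<and> card S = i + j}"
  proof (rule bij_betwI[where g = "\<lambda>S. (S \<inter> A, S \<inter> B)"])
    show "(\<lambda>(X, Y). X \<union> Y) \<in> {X. X \<subseteq> A \<and> card X = i} \<times> {Y. Y \<subseteq> B \<and> card Y = j} \<rightarrow>
        {S. S \<subseteq> A \<union> B \<and> card (S \<inter> A) = i \<and> card S = i + j}"
    proof (intro funcsetI)
      fix p assume "p \<in> {X. X \<subseteq> A \<and> card X = i} \<times> {Y. Y \<subseteq> B \<and> card Y = j}"
      then obtain X Y where p: "p = (X, Y)" and XY: "X \<subseteq> A" "Y \<subseteq> B" "card X = i" "card Y = j"
        by blast
      then have fin: "finite X" "finite Y" and disj: "X \<inter> Y = {}" "(X \<union> Y) \<inter> A = X"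
        using assms by (auto intro: finite_subset)
      then show "(case p of (X, Y) \<Rightarrow> X \<union> Y) \<in> {S. S \<subseteq> A \<union> B \<and> card (S \<inter> A) = i \<and> card S = i + j}"
        using XY card_Un_disjoint[OF fin disj(1)] by (auto simp: p)
    qed
    show "(\<lambda>S. (S \<inter> A, S \<inter> B)) \<in> {S. S \<subseteq> A \<union> B \<and> card (S \<inter> A) = i \<and> card S = i + j} \<rightarrow>
        {X. X \<subseteq> A \<and> card X = i} \<times> {Y. Y \<subseteq> B \<and> card Y = j}"
    proof (intro funcsetI)
      fix S assume S: "S \<in> {S. S \<subseteq> A \<union> B \<and> card (S \<inter> A) = i \<and> card S = i + j}"
      then have "S = (S \<inter> A) \<union> (S \<inter> B)" "(S \<inter> A) \<inter> (S \<inter> B) = {}" using assms(3) by auto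
      then have "card S = card (S \<inter> A) + card (S \<inter> B)"
        using assms(1,2) card_Un_disjoint[of "S \<inter> A" "S \<inter> B"] by simp
      then show "(S \<inter> A, S \<inter> B) \<in> {X. X \<subseteq> A \<and> card X = i} \<times> {Y. Y \<subseteq> B \<and> card Y = j}"
        using S by simp
    qed
  qed (use assms(3) in auto)
  from bij_betw_same_card[OF this] show ?thesis
    using assms by (simp add: n_subsets card_cartesian_product)
qed

text \<open>A set is split into its symplectic part, of size \<open>i\<close>, and its part among
  the \<open>n - 2 * m - 1\<close> abelian indices. Integer \<open>t\<close> and \<open>Q\<close>
  allow shifted sizes, possibly negative, to be treated uniformly.\<close>

lemma card_by_level:
  assumes n: "2 * m + 1 \<le> n"
  shows "int (card {S. S \<subseteq> {1..<n} \<and> int (card S) = t \<and> Q (int (level m S))}) =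
    (\<Sum>i\<le>2 * m. if Q (int i) then binom (2 * int m) (int i) * binom (int (n - 2 * m - 1)) (t - int i) else 0)"
proof -
  let ?A = "{1..2 * m}" and ?B = "{2 * m + 1..<n}"
  have AB: "{1..<n} = ?A \<union> ?B" "?A \<inter> ?B = {}" using n by auto
  let ?T = "\<lambda>i. {S. S \<subseteq> {1..<n} \<and> int (card S) = t \<and> level m S = i}"
  have fin: "finite (?T i)" for i
    by (rule finite_subset[of _ "Pow {1..<n}"]) auto
  have lev: "level m S \<le> 2 * m" for S
    using card_mono[of ?A "S \<inter> ?A"] by (simp add: level_def)
  have "{S. S \<subseteq> {1..<n} \<and> int (card S) = t \<and> Q (int (level m S))} = (\<Union>i\<in>{i. i \<le> 2 * m \<and> Q (int i)}. ?T i)"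
    using lev by auto
  then have "card {S. S \<subseteq> {1..<n} \<and> int (card S) = t \<and> Q (int (level m S))} =
      (\<Sum>i\<in>{i. i \<le> 2 * m \<and> Q (int i)}. card (?T i))"
    using fin by (simp only:) (intro card_UN_disjoint; auto)
  also have "\<dots> = (\<Sum>i\<le>2 * m. if Q (int i) then card (?T i) else 0)"
    by (intro sum.mono_neutral_cong_left) auto
  also have "int \<dots> = (\<Sum>i\<le>2 * m. if Q (int i) then int (card (?T i)) else 0)"
    by (simp add: if_distrib[of int] cong: if_cong)
  also have "\<dots> = (\<Sum>i\<le>2 * m. if Q (int i) then binom (2 * int m) (int i) * binom (int (n - 2 * m - 1)) (t - int i) else 0)"
  proof -
    have "int (card (?T i)) = binom (2 * int m) (int i) * binom (int (n - 2 * m - 1)) (t - int i)" for i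
    proof (cases "0 \<le> t - int i")
      case True
      then obtain j where "t - int i = int j" using nonneg_int_cases by blast
      then have t: "t = int (i + j)" by simp
      have "?T i = {S. S \<subseteq> ?A \<union> ?B \<and> card (S \<inter> ?A) = i \<and> card S = i + j}"
        unfolding AB(1)[symmetric] level_def t of_nat_eq_iff by auto
      then have "card (?T i) = (card ?A choose i) * (card ?B choose j)"
        using card_subsets_Int[OF _ _ AB(2), of i j] by simp
      then show ?thesis
        using binom_of_nat[of "2 * m" i] binom_of_nat[of "n - 2 * m - 1" j] t by simp
    next
      \<comment> \<open>No set has a level above its size, and the binomial coefficient has a
        negative lower entry: both sides are 0.\<close>
      case False
      have "card S \<ge> level m S" if "S \<subseteq> {1..<n}" for S
        unfolding level_def using that finite_subset by (intro card_mono) auto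
      then have "?T i = {}" using False by force
      then show ?thesis using False by (simp add: binom_neg)
    qed
    then show ?thesis by (simp only:)
  qed
  finally show ?thesis .
qed

text \<open>Both windows contain the support of \<open>F\<close>. This lets sums over differently
  shifted levels be brought to a common index.\<close>

lemma sum_shift_int:
  fixes F :: "int \<Rightarrow> int"
  assumes "\<And>z. F z \<noteq> 0 \<Longrightarrow> c \<le> z \<and> z \<le> c + int N" "\<And>z. F z \<noteq> 0 \<Longrightarrow> d \<le> z \<and> z \<le> d + int M"
  shows "(\<Sum>i\<le>N. F (int i + c)) = (\<Sum>i\<le>M. F (int i + d))"
proof -
  have re: "(\<Sum>i\<le>N. F (int i + c)) = sum F {c..c + int N}" for N c
    by (rule sum.reindex_bij_witness[where j = "\<lambda>i. int i + c" and i = "\<lambda>z. nat (z - c)"]) auto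
  let ?Z = "{c..c + int N} \<inter> {d..d + int M}"
  have zero: "F z = 0" if "\<not> (c \<le> z \<and> z \<le> c + int N) \<or> \<not> (d \<le> z \<and> z \<le> d + int M)" for z
    using assms that by blast
  have "sum F {c..c + int N} = sum F ?Z"
    by (intro sum.mono_neutral_right) (auto intro!: zero)
  also have "\<dots> = sum F {d..d + int M}"
    by (intro sum.mono_neutral_left) (auto intro!: zero)
  finally show ?thesis by (simp only: re)
qed

text \<open>The expected Betti numbers of the Heisenberg algebra. The second branch is the image of
  the first under Poincare duality, \<open>i\<close> going to \<open>2 * m + 1 - i\<close>.\<close>

definition heis_betti :: "nat \<Rightarrow> int \<Rightarrow> int" where
  "heis_betti m i = (if i \<le> int m then binom (2 * int m) i - binom (2 * int m) (i - 2)
     else binom (2 * int m) (i - 1) - binom (2 * int m) (i + 1))"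

lemma heis_betti_sym: "heis_betti m (2 * int m + 1 - i) = heis_betti m i"
proof -
  have s: "binom (2 * int m) (2 * int m - j) = binom (2 * int m) j" for j
    by (rule binom_sym) simp
  show ?thesis
    using s[of i] s[of "i - 2"] s[of "i - 1"] s[of "i + 1"]
    by (simp add: heis_betti_def algebra_simps)
qed

context lie_basis
begin

text \<open>The binomial coefficient and the two ranks become six counts of subsets of
  \<open>{1..<n}\<close>. Each is a sum over levels; aligning these sums makes the factor for the
  abelian part common, and what multiplies it collapses to \<open>heis_betti\<close>.\<close>

lemma betti_heis:
  assumes brk: "\<And>p q. p < q \<Longrightarrow> q < n \<Longrightarrow>
      brk g (e p) (e q) = (if \<exists>a<m. p = 2 * a + 1 \<and> q = 2 * a + 2 then e 0 else 0)"
    and n: "2 * m + 1 \<le> n"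
  shows "int (betti g k) =
    (\<Sum>i\<le>2 * m + 1. heis_betti m (int i) * binom (int (n - 2 * m - 1)) (int k - int i))"
proof -
  define c where "c t Q = int (card {S. S \<subseteq> {1..<n} \<and> int (card S) = t \<and> Q (int (level m S))})" for t Q
  let ?r = "int (n - 2 * m - 1)" and ?M = "2 * int m"
  let ?lo = "\<lambda>z. z < int m" and ?hi = "\<lambda>z. int m + 2 \<le> z"
  define G where "G t Q z = (if Q z then binom ?M z * binom ?r (t - z) else 0)" for t Q z
  have cG: "c t Q = (\<Sum>i\<le>2 * m. G t Q (int i + 0))" for t Q
    unfolding c_def G_def card_by_level[OF n] add_0_right ..
  have shift: "c t Q = (\<Sum>i\<le>2 * m + 1. G t Q (int i + d))"
    if "\<And>z. Q z \<Longrightarrow> 0 \<le> z \<Longrightarrow> z \<le> 2 * int m \<Longrightarrow> d \<le> z \<and> z \<le> d + int (2 * m + 1)" for t Q d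
    unfolding cG
  proof (rule sum_shift_int)
    fix z assume "G t Q z \<noteq> 0"
    then have "Q z" "0 \<le> z" "z \<le> 2 * int m"
      by (auto simp: G_def binom_def split: if_splits)
    then show "0 \<le> z \<and> z \<le> 0 + int (2 * m)" "d \<le> z \<and> z \<le> d + int (2 * m + 1)"
      using that by auto
  qed
  have le: "level m S \<le> card S" if "S \<subseteq> {1..<n}" for S
    unfolding level_def using that finite_subset by (intro card_mono) auto
  \<comment> \<open>Sizes up to 1 cannot reach level \<open>m + 2\<close>. This makes the formula
    \<open>R\<close> right in degree 0, where the rank is 0.\<close>
  have chi: "c t ?hi = 0" if "t \<le> 1" for t
  proof -
    have "\<not> int m + 2 \<le> int (level m S)" if "S \<subseteq> {1..<n}" "int (card S) = t" for S
      using le[OF that(1)] that(2) \<open>t \<le> 1\<close> by linarith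
    then have "{S. S \<subseteq> {1..<n} \<and> int (card S) = t \<and> int m + 2 \<le> int (level m S)} = {}"
      by blast
    then show ?thesis by (simp only: c_def card.empty of_nat_0)
  qed
  have cneg: "c t Q = 0" if "t < 0" for t Q
    using that by (simp add: c_def)
  define R where "R k = c (int k - 1) ?lo + c (int k + 1) ?hi" for k
  have dimR: "int (dim (heis_coboundary m n ` supported (ksubs n k))) = R k" for k
  proof (cases k)
    case 0
    then show ?thesis by (simp add: dim_heis_coboundary_image[OF n] R_def chi cneg)
  next
    case (Suc j)
    have "low m {1..<n} j = {S. S \<subseteq> {1..<n} \<and> int (card S) = int k - 1 \<and> int (level m S) < int m}"
      by (auto simp: low_def Suc)
    moreover have "top_high m {1..<n} (j + 2) =
        {S. S \<subseteq> {1..<n} \<and> int (card S) = int k + 1 \<and> int m + 2 \<le> int (level m S)}"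
      by (auto simp: top_high_def Suc)
    ultimately show ?thesis by (simp add: dim_heis_coboundary_image[OF n] R_def c_def Suc)
  qed
  have cT: "c t (\<lambda>_. True) = binom (int n - 1) t" for t
  proof (cases "0 \<le> t")
    case True
    then obtain j where t: "t = int j" using nonneg_int_cases by blast
    have "int n - 1 = int (n - 1)" using n by simp
    moreover have "c t (\<lambda>_. True) = int (n - 1 choose j)"
      using n_subsets[of "{1..<n}" j] by (simp add: c_def t)
    ultimately show ?thesis by (simp only: t binom_of_nat)
  next
    case False
    then show ?thesis by (simp add: c_def binom_neg)
  qed
  \<comment> \<open>Pascal's rule: the subset avoids the index 0 of \<open>Z\<close> or contains
    it.\<close>
  have nk: "int (n choose k) = c (int k) (\<lambda>_. True) + c (int k - 1) (\<lambda>_. True)"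
    unfolding cT using binom_pascal[of "int n - 1" "int k"] n by (simp flip: binom_of_nat)
  have "betti g k + dim (heis_coboundary m n ` supported (ksubs n k)) +
      (case k of 0 \<Rightarrow> 0 | Suc l \<Rightarrow> dim (heis_coboundary m n ` supported (ksubs n l))) = n choose k"
  proof (rule betti_plus_ranks)
    show "coord (Suc k) (ce_diff g k f) = heis_coboundary m n (coord k f)" if "f \<in> cochains g k" for k f
      by (rule coord_ce_diff_heis[OF brk n that])
    \<comment> \<open>The outer operator evaluates the inner one at sets containing 0, where it is
      0.\<close>
    show "heis_coboundary m n (heis_coboundary m n \<phi>) = 0" for \<phi>
      by (rule ext) (simp add: heis_coboundary_def pair_sum_def)
  qed
  from arg_cong[OF this, of int] have "int (betti g k) = int (n choose k) - R k - (case k of 0 \<Rightarrow> 0 | Suc l \<Rightarrow> R l)"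
    unfolding dimR[symmetric] by (cases k) simp_all
  also have "(case k of 0 \<Rightarrow> 0 | Suc l \<Rightarrow> R l) = c (int k - 2) ?lo + c (int k) ?hi"
    by (cases k) (simp_all add: R_def chi cneg add.commute)
  finally have "int (betti g k) = c (int k) (\<lambda>_. True) + c (int k - 1) (\<lambda>_. True)
      - (c (int k - 1) ?lo + c (int k + 1) ?hi) - (c (int k - 2) ?lo + c (int k) ?hi)"
    by (simp add: nk R_def)
  \<comment> \<open>A count of sets of size \<open>k + d\<close> is summed over levels
    \<open>i + d\<close>, so that the abelian part always has size \<open>k - i\<close>.\<close>
  also have "c (int k) (\<lambda>_. True) = (\<Sum>i\<le>2 * m + 1. G (int k) (\<lambda>_. True) (int i + 0))"
    by (rule shift) auto
  also have "c (int k - 1) (\<lambda>_. True) = (\<Sum>i\<le>2 * m + 1. G (int k - 1) (\<lambda>_. True) (int i + (- 1)))"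
    by (rule shift) auto
  also have "c (int k - 1) ?lo = (\<Sum>i\<le>2 * m + 1. G (int k - 1) ?lo (int i + (- 1)))"
    by (rule shift) auto
  also have "c (int k + 1) ?hi = (\<Sum>i\<le>2 * m + 1. G (int k + 1) ?hi (int i + 1))"
    by (rule shift) auto
  also have "c (int k - 2) ?lo = (\<Sum>i\<le>2 * m + 1. G (int k - 2) ?lo (int i + (- 2)))"
    by (rule shift) auto
  also have "c (int k) ?hi = (\<Sum>i\<le>2 * m + 1. G (int k) ?hi (int i + 0))"
    by (rule shift) auto
  finally have "int (betti g k) = (\<Sum>i\<le>2 * m + 1. G (int k) (\<lambda>_. True) (int i + 0)
      + G (int k - 1) (\<lambda>_. True) (int i + (- 1))
      - (G (int k - 1) ?lo (int i + (- 1)) + G (int k + 1) ?hi (int i + 1))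
      - (G (int k - 2) ?lo (int i + (- 2)) + G (int k) ?hi (int i + 0)))"
    by (simp only: sum.distrib sum_subtractf)
  also have "\<dots> = (\<Sum>i\<le>2 * m + 1. heis_betti m (int i) * binom ?r (int k - int i))"
  proof (rule sum.cong[OF refl])
    fix i
    have arg: "int k - 1 - (int i + (- 1)) = int k - int i" "int k + 1 - (int i + 1) = int k - int i"
      "int k - 2 - (int i + (- 2)) = int k - int i" "int k - (int i + 0) = int k - int i"
      by simp_all
    \<comment> \<open>Needed at \<open>i = m + 1\<close>, where neither rank cancels the
      coefficients at \<open>m + 1\<close> and \<open>m - 1\<close>; they cancel each other by
      symmetry.\<close>
    have mid: "binom ?M (int m + 1) = binom ?M (int m - 1)"
      using binom_sym[of ?M "int m - 1"] by simp
    consider "i \<le> m" | "i = m + 1" | "m + 2 \<le> i" by linarith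
    then show "G (int k) (\<lambda>_. True) (int i + 0) + G (int k - 1) (\<lambda>_. True) (int i + (- 1))
      - (G (int k - 1) ?lo (int i + (- 1)) + G (int k + 1) ?hi (int i + 1))
      - (G (int k - 2) ?lo (int i + (- 2)) + G (int k) ?hi (int i + 0)) =
      heis_betti m (int i) * binom ?r (int k - int i)"
    proof cases
      case 1
      then show ?thesis unfolding G_def arg by (simp add: heis_betti_def algebra_simps)
    next
      case 2
      then show ?thesis unfolding G_def arg using mid by (simp add: heis_betti_def algebra_simps)
    next
      case 3
      then show ?thesis unfolding G_def arg by (simp add: heis_betti_def algebra_simps)
    qed
  qed
  finally show ?thesis .
qed

text \<open>The image consists of all functions on the (k+1)-subsets that contain both 0 and 1, and
  such a subset is a choice of \<open>k - 1\<close> among the other \<open>n - 2\<close>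
  indices.\<close>

lemma dim_aff_coboundary_image:
  assumes n: "2 \<le> n"
  shows "int (dim (aff_coboundary ` supported (ksubs n k))) = binom (int n - 2) (int k - 1)"
proof -
  let ?E = "{S. {0, 1} \<subseteq> S \<and> S \<in> ksubs n (Suc k)}"
  have drop0: "S - {0} \<in> ksubs n k" if "S \<in> ?E" for S
    using that finite_subset[of S "{..<n}"] by (auto simp: ksubs_def card_Diff_singleton)
  have "aff_coboundary ` supported (ksubs n k) = supported ?E"
  proof (intro equalityI subsetI)
    fix \<psi> assume "\<psi> \<in> aff_coboundary ` supported (ksubs n k)"
    then obtain \<phi> where \<phi>: "\<phi> \<in> supported (ksubs n k)" "\<psi> = aff_coboundary \<phi>" by blast
    have mem: "S \<in> ksubs n (Suc k)" if "{0, 1} \<subseteq> S" "S - {0} \<in> ksubs n k" for S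
    proof -
      have "finite (S - {0})" using that(2) finite_subset[of "S - {0}" "{..<n}"] by (simp add: ksubs_def)
      then have "finite S" by simp
      from card.remove[OF this, of 0] have "card S = Suc k" using that by (simp add: ksubs_def)
      moreover have "S \<subseteq> insert 0 {..<n}" using that(2) unfolding ksubs_def by blast
      then have "S \<subseteq> {..<n}" using n by (simp add: insert_absorb)
      ultimately show ?thesis by (simp add: ksubs_def)
    qed
    have "\<psi> S = 0" if "S \<notin> ?E" for S
    proof (cases "{0, 1} \<subseteq> S")
      case True
      then have "S - {0} \<notin> ksubs n k" using mem that by blast
      then show ?thesis using \<phi> by (simp add: aff_coboundary_def supported_def)
    next
      case False
      then show ?thesis unfolding \<phi>(2) aff_coboundary_def by (simp only: if_False)
    qed
    then show "\<psi> \<in> supported ?E" by (simp add: supported_def)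
  next
    fix \<psi> :: "nat set \<Rightarrow> real" assume \<psi>: "\<psi> \<in> supported ?E"
    \<comment> \<open>A preimage living on the sets without 0, the only ones at which
      \<open>aff_coboundary\<close> reads its argument.\<close>
    define \<phi> where "\<phi> T = (if T \<in> ksubs n k \<and> 0 \<notin> T then - \<psi> (insert 0 T) else 0)" for T
    have "\<psi> S = aff_coboundary \<phi> S" for S
    proof (cases "S \<in> ?E")
      case True
      then have "insert 0 (S - {0}) = S" by auto
      then show ?thesis using True drop0[OF True] by (simp add: aff_coboundary_def \<phi>_def)
    next
      case False
      have "\<phi> (S - {0}) = 0" if "{0, 1} \<subseteq> S"
      proof -
        have "insert 0 (S - {0}) = S" using that by auto
        moreover have "\<psi> S = 0" using \<psi> False by (auto simp: supported_def)
        ultimately show ?thesis by (simp add: \<phi>_def)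
      qed
      moreover have "\<psi> S = 0" using \<psi> False by (auto simp: supported_def)
      ultimately show ?thesis unfolding aff_coboundary_def by simp
    qed
    then have "\<psi> = aff_coboundary \<phi>" by blast
    moreover have "\<phi> \<in> supported (ksubs n k)" by (simp add: \<phi>_def supported_def)
    ultimately show "\<psi> \<in> aff_coboundary ` supported (ksubs n k)" by (rule image_eqI)
  qed
  moreover have "finite ?E" by (rule finite_subset[of _ "ksubs n (Suc k)"]) auto
  ultimately have "dim (aff_coboundary ` supported (ksubs n k)) = card ?E"
    by (simp add: dim_supported)
  also have "int (card ?E) = binom (int n - 2) (int k - 1)"
  proof (cases k)
    case 0
    have "2 \<le> card S" if "{0, 1} \<subseteq> S" "S \<subseteq> {..<n}" for S
      using card_mono[of S "{0, 1}"] that finite_subset[of S "{..<n}"] by simp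
    then have "?E = {}" unfolding 0 ksubs_def by fastforce
    then show ?thesis by (simp add: 0 binom_neg)
  next
    case (Suc j)
    have "bij_betw (\<lambda>T. T \<union> {0, 1}) {T. T \<subseteq> {2..<n} \<and> card T = j} ?E"
    proof (rule bij_betwI[where g = "\<lambda>S. S - {0, 1}"])
      show "(\<lambda>T. T \<union> {0, 1}) \<in> {T. T \<subseteq> {2..<n} \<and> card T = j} \<rightarrow> ?E"
      proof (intro funcsetI)
        fix T assume T: "T \<in> {T. T \<subseteq> {2..<n} \<and> card T = j}"
        then have "finite T" "T \<inter> {0, 1} = {}" using finite_subset by auto
        then have "card (T \<union> {0, 1}) = j + 2" using T card_Un_disjoint[of T "{0, 1}"] by simp
        then show "T \<union> {0, 1} \<in> ?E" using T n unfolding ksubs_def Suc by auto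
      qed
      show "(\<lambda>S. S - {0, 1}) \<in> ?E \<rightarrow> {T. T \<subseteq> {2..<n} \<and> card T = j}"
      proof (intro funcsetI)
        fix S assume S: "S \<in> ?E"
        then have "card (S - {0, 1}) = j"
          by (simp add: ksubs_def Suc card_Diff_subset del: insert_subset)
        moreover have "S - {0, 1} \<subseteq> {2..<n}" using S by (auto simp: ksubs_def)
        ultimately show "S - {0, 1} \<in> {T. T \<subseteq> {2..<n} \<and> card T = j}" by simp
      qed
    qed auto
    from bij_betw_same_card[OF this] have "card ?E = (n - 2 choose j)"
      using n_subsets[of "{2..<n}" j] by simp
    moreover have "int n - 2 = int (n - 2)" "int k - 1 = int j" using n by (simp_all add: Suc)
    ultimately show ?thesis by (simp only: binom_of_nat)
  qed
  finally show ?thesis .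
qed

text \<open>The two ranks add up, by Pascal's rule, to \<open>binom (n - 1) (k - 1)\<close>, and a
  second use of the rule leaves \<open>binom (n - 1) k\<close>.\<close>

lemma betti_aff:
  assumes brk: "\<And>p q. p < q \<Longrightarrow> q < n \<Longrightarrow> brk g (e p) (e q) = (if p = 0 \<and> q = 1 then e 1 else 0)"
    and n: "2 \<le> n"
  shows "int (betti g k) = binom (int n - 1) (int k)"
proof -
  have "betti g k + dim (aff_coboundary ` supported (ksubs n k)) +
      (case k of 0 \<Rightarrow> 0 | Suc l \<Rightarrow> dim (aff_coboundary ` supported (ksubs n l))) = n choose k"
  proof (rule betti_plus_ranks)
    show "coord (Suc k) (ce_diff g k f) = aff_coboundary (coord k f)" if "f \<in> cochains g k" for k f
      by (rule coord_ce_diff_aff[OF brk n that])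
    show "aff_coboundary (aff_coboundary \<phi>) = 0" for \<phi>
      by (rule ext) (simp add: aff_coboundary_def)
  qed
  from arg_cong[OF this, of int] have "int (betti g k) = int (n choose k) - binom (int n - 2) (int k - 1)
      - (case k of 0 \<Rightarrow> 0 | Suc l \<Rightarrow> binom (int n - 2) (int l - 1))"
    unfolding dim_aff_coboundary_image[OF n, symmetric]
    by (cases k) simp_all
  also have "(case k of 0 \<Rightarrow> 0 | Suc l \<Rightarrow> binom (int n - 2) (int l - 1)) = binom (int n - 2) (int k - 2)"
    by (cases k) (simp_all add: binom_neg)
  also have "int (n choose k) = binom (int n - 1) (int k) + binom (int n - 1) (int k - 1)"
    using binom_pascal[of "int n - 1" "int k"] n by (simp flip: binom_of_nat)
  also have "binom (int n - 1) (int k - 1) = binom (int n - 2) (int k - 1) + binom (int n - 2) (int k - 2)"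
    using binom_pascal[of "int n - 2" "int k - 1"] n by simp
  finally show ?thesis by simp
qed

end

section \<open>The algebras of the classification\<close>

lemma linear_nth_coord: "linear (\<lambda>v :: 'b \<Rightarrow> real. v i)"
  by (rule linearI) simp_all

lemma sum_lessThan_add: "(\<Sum>i<n + (r :: nat). f i) = (\<Sum>i<n. f i) + (\<Sum>i<r. f (n + i) :: 'b :: comm_monoid_add)"
  by (induction r) (simp_all add: add.assoc)

lemma sum_coord_vec:
  assumes "v \<in> coord_space d"
  shows "v = (\<Sum>i<d. v i *\<^sub>R coord_vec i)"
proof
  fix l
  have "(\<Sum>i<d. v i *\<^sub>R coord_vec i) l = (\<Sum>i<d. if i = l then v i else 0)"
    unfolding sum_fun_apply by (intro sum.cong) (auto simp: coord_vec_def)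
  also have "\<dots> = v l"
    using assms by (auto simp: coord_space_def)
  finally show "v l = (\<Sum>i<d. v i *\<^sub>R coord_vec i) l" ..
qed

lemma coord_vec_mem: "i < d \<Longrightarrow> coord_vec i \<in> coord_space d"
  by (auto simp: coord_vec_def coord_space_def)

text \<open>The abelian basis is appended at the end, so the indices below \<open>n\<close> and
  their bracket table stay as they were.\<close>

lemma lie_basis_dsum_abelian:
  assumes "lie_basis g n e cf"
  shows "lie_basis (g \<oplus>\<^sub>L abelian_lie r) (n + r)
    (\<lambda>i. if i < n then (e i, 0) else (0, coord_vec (i - n)))
    (\<lambda>i x. if i < n then cf i (fst x) else snd x (i - n))"
    (is "lie_basis ?g ?n ?e ?cf")
proof -
  interpret lie_basis g n e cf by (fact assms)
  have carr: "carr ?g = carr g \<times> coord_space r"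
    by (simp add: dsum_lie_def abelian_lie_def)
  show ?thesis
  proof (rule lie_basis.intro)
    show "lie_algebra ?g" by (rule lie_algebra_dsum[OF lie lie_algebra_abelian])
  next
    fix i assume i: "i < ?n"
    show "?e i \<in> carr ?g"
      using i e_carr subspace_0[OF subspace_carr] subspace_0[OF subspace_coord_space]
      by (auto simp: carr intro: coord_vec_mem)
    show "linear (?cf i)"
    proof (cases "i < n")
      case True
      then show ?thesis
        using linear_compose[OF linear_fst cf_linear[OF True]] by (simp add: comp_def)
    next
      case False
      then show ?thesis
        using linear_compose[OF linear_snd linear_nth_coord[of "i - n"]] by (simp add: comp_def)
    qed
    fix j assume j: "j < ?n"
    show "?cf i (?e j) = (if i = j then 1 else 0)"
      using i j cf_e linear_0[OF cf_linear] by (auto simp: coord_vec_def)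
  next
    fix x assume "x \<in> carr ?g"
    then obtain y v where x: "x = (y, v)" "y \<in> carr g" "v \<in> coord_space r"
      by (auto simp: carr)
    have "(\<Sum>i<n + r. ?cf i x *\<^sub>R ?e i) = (\<Sum>i<n. ?cf i x *\<^sub>R ?e i) + (\<Sum>i<r. ?cf (n + i) x *\<^sub>R ?e (n + i))"
      by (rule sum_lessThan_add)
    also have "(\<Sum>i<n. ?cf i x *\<^sub>R ?e i) = (\<Sum>i<n. (cf i y *\<^sub>R e i, 0))"
      by (intro sum.cong) (auto simp: x)
    also have "\<dots> = (\<Sum>i<n. cf i y *\<^sub>R e i, 0)"
      by (simp add: sum_prod)
    also have "(\<Sum>i<r. ?cf (n + i) x *\<^sub>R ?e (n + i)) = (\<Sum>i<r. (0, v i *\<^sub>R coord_vec i))"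
      by (intro sum.cong) (auto simp: x)
    also have "\<dots> = (0, \<Sum>i<r. v i *\<^sub>R coord_vec i)"
      by (simp add: sum_prod)
    finally show "x = (\<Sum>i<n + r. ?cf i x *\<^sub>R ?e i)"
      using expand[OF x(2)] sum_coord_vec[OF x(3)] x(1) by (simp add: zero_fun_def)
  qed
qed

lemma brk_zero:
  assumes "lie_algebra g" "x \<in> carr g"
  shows "brk g x 0 = 0" "brk g 0 x = 0"
proof -
  have 0: "0 \<in> carr g" using assms(1) by (simp add: lie_algebra_def subspace_0)
  show "brk g x 0 = 0" using brk_lin2[OF assms(1) 0 0 assms(2), of 0 0] by simp
  show "brk g 0 x = 0" using brk_lin1[OF assms(1) 0 0 assms(2), of 0 0] by simp
qed

lemma brk_dsum_abelian_basis:
  assumes "lie_basis g n e cf" "p < q"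
  shows "brk (g \<oplus>\<^sub>L abelian_lie r)
    (if p < n then (e p, 0) else (0, coord_vec (p - n))) (if q < n then (e q, 0) else (0, coord_vec (q - n)))
    = (if q < n then (brk g (e p) (e q), 0) else 0)"
proof -
  interpret lie_basis g n e cf by (fact assms)
  have 0: "0 \<in> carr g" by (rule subspace_0[OF subspace_carr])
  show ?thesis
    using assms(2) brk_zero[OF lie e_carr] brk_zero[OF lie 0]
    by (auto simp: dsum_lie_def abelian_lie_def zero_prod_def)
qed

lemma lie_basis_aff:
  "lie_basis aff_lie 2 (\<lambda>i. if i = 0 then (1, 0) else (0, 1)) (\<lambda>i. if i = 0 then fst else snd)"
proof (rule lie_basis.intro)
  show "lie_algebra aff_lie" by (rule lie_algebra_aff)
  show "linear (if i = 0 then fst else snd :: real \<times> real \<Rightarrow> real)" for i :: nat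
    by (simp add: linear_fst linear_snd)
  show "x = (\<Sum>i<2. (if i = 0 then fst else snd) x *\<^sub>R (if i = (0::nat) then (1, 0) else (0, 1)))"
    for x :: "real \<times> real"
    by (simp add: numeral_2_eq_2 prod_eq_iff)
qed (auto simp: aff_lie_def)

lemma betti_aff_lie: "int (betti aff_lie k) = binom 1 (int k)"
proof -
  interpret lie_basis aff_lie 2 "\<lambda>i. if i = 0 then (1, 0) else (0, 1)" "\<lambda>i. if i = 0 then fst else snd"
    by (rule lie_basis_aff)
  have "int (betti aff_lie k) = binom (int 2 - 1) (int k)"
    by (rule betti_aff) (auto simp: aff_lie_def)
  then show ?thesis by simp
qed

lemma betti_aff_dsum_abelian: "int (betti (aff_lie \<oplus>\<^sub>L abelian_lie r) k) = binom (int r + 1) (int k)"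
proof -
  note b = lie_basis_aff
  interpret lie_basis "aff_lie \<oplus>\<^sub>L abelian_lie r" "2 + r"
    "\<lambda>i. if i < 2 then (if i = 0 then (1, 0) else (0, 1), 0) else (0, coord_vec (i - 2))"
    "\<lambda>i x. if i < 2 then (if i = 0 then fst else snd) (fst x) else snd x (i - 2)"
    by (rule lie_basis_dsum_abelian[OF b])
  have "int (betti (aff_lie \<oplus>\<^sub>L abelian_lie r) k) = binom (int (2 + r) - 1) (int k)"
  proof (rule betti_aff)
    fix p q :: nat assume pq: "p < q"
    have "brk aff_lie (if p = 0 then (1, 0) else (0, 1)) (if q = 0 then (1, 0) else (0, 1)) =
        (if p = 0 \<and> q = 1 then (0, 1) else 0)" if "q < 2"
      using pq that by (auto simp: aff_lie_def zero_prod_def)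
    \<comment> \<open>The conditionals on the right are the basis vector with index 1 of the
      extended basis, left unevaluated to match the form of the locale parameter.\<close>
    then show "brk (aff_lie \<oplus>\<^sub>L abelian_lie r)
        (if p < 2 then (if p = 0 then (1, 0) else (0, 1), 0) else (0, coord_vec (p - 2)))
        (if q < 2 then (if q = 0 then (1, 0) else (0, 1), 0) else (0, coord_vec (q - 2))) =
        (if p = 0 \<and> q = 1 then (if (1::nat) < 2 then (if (1::nat) = 0 then (1, 0) else (0, 1), 0)
          else (0, coord_vec (1 - 2))) else 0)"
      unfolding brk_dsum_abelian_basis[OF b pq] by (auto simp: zero_prod_def)
  qed simp
  then show ?thesis by (simp add: add.commute)
qed

section \<open>The interleaved basis of the Heisenberg algebra\<close>

text \<open>Sends a place in the interleaved order to the coordinate of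
  \<open>heisenberg_lie\<close>: \<open>2 * a + 1\<close> to that of \<open>X\<close> with index
  \<open>a + 1\<close>, and \<open>2 * a + 2\<close> to that of its partner with index
  \<open>m + a + 1\<close>.\<close>

definition heis_index :: "nat \<Rightarrow> nat \<Rightarrow> nat" where
  "heis_index m i = (if i = 0 then 0 else if odd i then (i + 1) div 2 else m + i div 2)"

definition heis_index_inv :: "nat \<Rightarrow> nat \<Rightarrow> nat" where
  "heis_index_inv m j = (if j = 0 then 0 else if j \<le> m then 2 * j - 1 else 2 * (j - m))"

lemma heis_index_cases:
  assumes "i < 2 * m + 1"
  obtains "i = 0" "heis_index m i = 0"
  | a where "a < m" "i = 2 * a + 1" "heis_index m i = a + 1"
  | a where "a < m" "i = 2 * a + 2" "heis_index m i = m + a + 1"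
proof -
  consider "i = 0" | a where "i = 2 * a + 1" | a where "i = 2 * a + 2"
    by (metis Suc_eq_plus1 add_2_eq_Suc' evenE not0_implies_Suc oddE even_Suc mult_Suc_right add.commute)
  then show thesis
    using that assms by cases (auto simp: heis_index_def)
qed

lemma heis_index_less: "i < 2 * m + 1 \<Longrightarrow> heis_index m i < 2 * m + 1"
  by (erule heis_index_cases) auto

lemma heis_index_inv_index: "i < 2 * m + 1 \<Longrightarrow> heis_index_inv m (heis_index m i) = i"
  by (erule heis_index_cases) (auto simp: heis_index_inv_def)

lemma heis_index_index_inv: "j < 2 * m + 1 \<Longrightarrow> heis_index m (heis_index_inv m j) = j"
  by (auto simp: heis_index_inv_def heis_index_def)

lemma heis_index_inv_less: "j < 2 * m + 1 \<Longrightarrow> heis_index_inv m j < 2 * m + 1"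
  by (auto simp: heis_index_inv_def)

text \<open>Interleaving does not preserve the order of the coordinates, so the bracket is computed
  for arbitrary \<open>i\<close> and \<open>j\<close>, with a term for either orientation of a
  pair.\<close>

lemma brk_heisenberg_basis:
  assumes "p < q" "q < 2 * m + 1"
  shows "brk (heisenberg_lie m) (coord_vec (heis_index m p)) (coord_vec (heis_index m q)) =
    (if \<exists>a<m. p = 2 * a + 1 \<and> q = 2 * a + 2 then coord_vec (heis_index m 0) else 0)"
proof -
  define i j where "i = heis_index m p" and "j = heis_index m q"
  have "(\<Sum>l=1..m. coord_vec i l * coord_vec j (m + l) - coord_vec i (m + l) * coord_vec j l) =
      (\<Sum>l=1..m. (if l = i then (if j = m + i then 1 else 0) else 0) -
        (if l = j then (if i = m + j then 1 else 0) else 0))"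
    by (intro sum.cong) (auto simp: coord_vec_def)
  also have "\<dots> = (if i \<in> {1..m} \<and> j = m + i then 1 else 0) - (if j \<in> {1..m} \<and> i = m + j then 1 else 0)"
    by (simp add: sum_subtractf)
  finally have b: "brk (heisenberg_lie m) (coord_vec i) (coord_vec j) =
      ((if i \<in> {1..m} \<and> j = m + i then 1 else 0) - (if j \<in> {1..m} \<and> i = m + j then 1 else 0)) *\<^sub>R coord_vec 0"
    by (simp add: heisenberg_lie_def)
  have p: "p < 2 * m + 1" using assms by simp
  have 1: "i \<in> {1..m} \<and> j = m + i \<longleftrightarrow> (\<exists>a<m. p = 2 * a + 1 \<and> q = 2 * a + 2)"
    using assms(1)
    by (cases rule: heis_index_cases[OF p]; cases rule: heis_index_cases[OF assms(2)])
      (auto simp: i_def j_def, presburger)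
  \<comment> \<open>Within a pair the interleaved order puts the lower index first, so the negative
    orientation cannot occur for \<open>p < q\<close>.\<close>
  have 2: "\<not> (j \<in> {1..m} \<and> i = m + j)"
    using assms(1)
    by (cases rule: heis_index_cases[OF p]; cases rule: heis_index_cases[OF assms(2)])
      (auto simp: i_def j_def)
  show ?thesis
  proof (cases "\<exists>a<m. p = 2 * a + 1 \<and> q = 2 * a + 2")
    case True
    moreover have "heis_index m 0 = 0" by (simp add: heis_index_def)
    ultimately show ?thesis
      using b unfolding 1 i_def[symmetric] j_def[symmetric] by (simp only: 2 if_True if_False) simp
  next
    case False
    then show ?thesis
      using b unfolding 1 i_def[symmetric] j_def[symmetric] by (simp only: 2 if_False) simp
  qed
qed

lemma lie_basis_heisenberg:
  "lie_basis (heisenberg_lie m) (2 * m + 1) (\<lambda>i. coord_vec (heis_index m i)) (\<lambda>i v. v (heis_index m i))"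
proof (rule lie_basis.intro)
  have carr: "carr (heisenberg_lie m) = coord_space (2 * m + 1)"
    by (simp add: heisenberg_lie_def)
  show "lie_algebra (heisenberg_lie m)" by (rule lie_algebra_heisenberg)
  show "linear (\<lambda>v :: nat \<Rightarrow> real. v (heis_index m i))" for i by (rule linear_nth_coord)
  fix i assume i: "i < 2 * m + 1"
  show "coord_vec (heis_index m i) \<in> carr (heisenberg_lie m)"
    unfolding carr by (rule coord_vec_mem[OF heis_index_less[OF i]])
  fix j assume j: "j < 2 * m + 1"
  have "heis_index m i = heis_index m j \<longleftrightarrow> i = j"
    using heis_index_inv_index i j by metis
  then show "coord_vec (heis_index m j) (heis_index m i) = (if i = j then 1 else 0)"
    by (simp add: coord_vec_def)
next
  fix v assume "v \<in> carr (heisenberg_lie m)"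
  then have "v \<in> coord_space (2 * m + 1)" by (simp add: heisenberg_lie_def)
  then have "v = (\<Sum>j<2 * m + 1. v j *\<^sub>R coord_vec j)" by (rule sum_coord_vec)
  also have "\<dots> = (\<Sum>i<2 * m + 1. v (heis_index m i) *\<^sub>R coord_vec (heis_index m i))"
    by (rule sum.reindex_bij_witness[where i = "heis_index m" and j = "heis_index_inv m"])
      (simp_all add: heis_index_less heis_index_inv_less heis_index_inv_index heis_index_index_inv
        del: add_2_eq_Suc' One_nat_def add_Suc_right)
  finally show "v = (\<Sum>i<2 * m + 1. v (heis_index m i) *\<^sub>R coord_vec (heis_index m i))" .
qed

lemma betti_heisenberg_lie:
  "int (betti (heisenberg_lie m) k) = (\<Sum>i\<le>2 * m + 1. heis_betti m (int i) * binom 0 (int k - int i))"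
proof -
  interpret lie_basis "heisenberg_lie m" "2 * m + 1" "\<lambda>i. coord_vec (heis_index m i)"
    "\<lambda>i v. v (heis_index m i)"
    by (rule lie_basis_heisenberg)
  have "int (betti (heisenberg_lie m) k) =
    (\<Sum>i\<le>2 * m + 1. heis_betti m (int i) * binom (int (2 * m + 1 - 2 * m - 1)) (int k - int i))"
    by (rule betti_heis[OF brk_heisenberg_basis order_refl])
  then show ?thesis by simp
qed

lemma betti_heisenberg_dsum_abelian:
  "int (betti (heisenberg_lie m \<oplus>\<^sub>L abelian_lie r) k) =
    (\<Sum>i\<le>2 * m + 1. heis_betti m (int i) * binom (int r) (int k - int i))"
proof -
  note b = lie_basis_heisenberg[of m]
  let ?n = "2 * m + 1"
  let ?e = "\<lambda>i. if i < ?n then (coord_vec (heis_index m i), 0) else (0, coord_vec (i - ?n))"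
  interpret lie_basis "heisenberg_lie m \<oplus>\<^sub>L abelian_lie r" "?n + r" ?e
    "\<lambda>i x. if i < ?n then fst x (heis_index m i) else snd x (i - ?n)"
    by (rule lie_basis_dsum_abelian[OF b])
  have "int (betti (heisenberg_lie m \<oplus>\<^sub>L abelian_lie r) k) =
    (\<Sum>i\<le>2 * m + 1. heis_betti m (int i) * binom (int (?n + r - 2 * m - 1)) (int k - int i))"
  proof (rule betti_heis)
    fix p q :: nat assume pq: "p < q"
    show "brk (heisenberg_lie m \<oplus>\<^sub>L abelian_lie r) (?e p) (?e q) =
        (if \<exists>a<m. p = 2 * a + 1 \<and> q = 2 * a + 2 then ?e 0 else 0)"
    proof (cases "q < ?n")
      case True
      then show ?thesis
        unfolding brk_dsum_abelian_basis[OF b pq] brk_heisenberg_basis[OF pq True]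
        by (cases "\<exists>a<m. p = 2 * a + 1 \<and> q = 2 * a + 2") (simp_all only: if_True if_False zero_prod_def, simp)
    next
      case False
      then have "\<not> (\<exists>a<m. p = 2 * a + 1 \<and> q = 2 * a + 2)" by auto
      with False show ?thesis
        unfolding brk_dsum_abelian_basis[OF b pq] by (simp only: if_False)
    qed
  qed simp
  then show ?thesis by simp
qed

section \<open>Closed forms of the Betti sums\<close>

text \<open>Reflection of the summation index: both factors are symmetric, around the dimensions
  \<open>2 * m + 1\<close> and \<open>r\<close>.\<close>

lemma heis_betti_sum_duality:
  assumes "k \<le> 2 * m + 1 + r"
  shows "(\<Sum>i\<le>2 * m + 1. heis_betti m (int i) * binom (int r) (int (2 * m + 1 + r - k) - int i)) =
    (\<Sum>i\<le>2 * m + 1. heis_betti m (int i) * binom (int r) (int k - int i))"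
proof (rule sum.reindex_bij_witness[where i = "\<lambda>i. 2 * m + 1 - i" and j = "\<lambda>i. 2 * m + 1 - i"])
  fix i assume "i \<in> {..2 * m + 1}"
  then have i: "int (2 * m + 1 - i) = 2 * int m + 1 - int i" by auto
  have "int (2 * m + 1 + r - k) - int i = int r - (int k - (2 * int m + 1 - int i))"
    using assms by auto
  then have "binom (int r) (int (2 * m + 1 + r - k) - int i) = binom (int r) (int k - (2 * int m + 1 - int i))"
    by (simp only: binom_sym of_nat_0_le_iff)
  then show "heis_betti m (int (2 * m + 1 - i)) * binom (int r) (int k - int (2 * m + 1 - i)) =
      heis_betti m (int i) * binom (int r) (int (2 * m + 1 + r - k) - int i)"
    unfolding i heis_betti_sym by simp
qed auto

text \<open>The subsets of size \<open>t\<close> are counted at once and by level.\<close>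

lemma vandermonde_binom:
  "binom (2 * int m + int r) t = (\<Sum>i\<le>2 * m. binom (2 * int m) (int i) * binom (int r) (t - int i))"
proof -
  have "int (card {S. S \<subseteq> {1..<2 * m + 1 + r} \<and> int (card S) = t}) = binom (2 * int m + int r) t"
  proof (cases "0 \<le> t")
    case True
    then obtain j where t: "t = int j" using nonneg_int_cases by blast
    have "card {S. S \<subseteq> {1..<2 * m + 1 + r} \<and> card S = j} = (2 * m + r choose j)"
      using n_subsets[of "{1..<2 * m + 1 + r}" j] by simp
    then show ?thesis using binom_of_nat[of "2 * m + r" j] by (simp add: t)
  next
    case False
    then show ?thesis by (simp add: binom_neg)
  qed
  then show ?thesis
    using card_by_level[of m "2 * m + 1 + r" t "\<lambda>_. True"] by simp
qed

text \<open>For \<open>k \<le> m\<close> only indices \<open>i \<le> m\<close> contribute, where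
  \<open>heis_betti\<close> is a difference of two binomial coefficients; each part is a Vandermonde
  sum.\<close>

lemma heis_betti_sum_low:
  assumes "k \<le> m"
  shows "(\<Sum>i\<le>2 * m + 1. heis_betti m (int i) * binom (int r) (int k - int i)) =
    binom (2 * int m + int r) (int k) - binom (2 * int m + int r) (int k - 2)"
proof -
  define F where "F t z = binom (2 * int m) z * binom (int r) (t - z)" for t z
  have F0: "0 \<le> z \<and> z \<le> 2 * int m \<and> z \<le> t" if "F t z \<noteq> 0" for t z
    using that by (auto simp: F_def binom_def split: if_splits)
  have v: "binom (2 * int m + int r) t = (\<Sum>i\<le>2 * m. F t (int i + 0))" for t
    unfolding F_def vandermonde_binom by simp
  have "binom (2 * int m + int r) (int k) = (\<Sum>i\<le>2 * m + 1. F (int k) (int i + 0))"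
    unfolding v by (rule sum_shift_int; drule F0; simp)
  \<comment> \<open>The window shifted by -2 ends at level \<open>2 * m - 1\<close>; the bound on
    \<open>k\<close> ensures that the support stops before that.\<close>
  moreover have "binom (2 * int m + int r) (int k - 2) = (\<Sum>i\<le>2 * m + 1. F (int k - 2) (int i + (- 2)))"
    unfolding v by (rule sum_shift_int; drule F0; use assms in simp)
  moreover have "F (int k) (int i + 0) - F (int k - 2) (int i + (- 2)) =
      heis_betti m (int i) * binom (int r) (int k - int i)" for i
    using assms by (cases "i \<le> m") (auto simp: F_def heis_betti_def binom_neg algebra_simps)
  ultimately show ?thesis by (simp only: sum_subtractf[symmetric])
qed

text \<open>The Betti numbers 1, 2, 2, 1 correspond to the polynomial identity 1 + 2x + 2x^2 + x^3 =
  (1 + x)^2 + x^2 (1 + x), multiplied by (1 + x)^r.\<close>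

lemma heis_betti_1_sum:
  "(\<Sum>i\<le>2 * 1 + 1. heis_betti 1 (int i) * binom (int r) (int k - int i)) =
    binom (int r + 2) (int k) + binom (int r + 1) (int k - 2)"
proof -
  have pascal: "binom (int r + 1) b = binom (int r) b + binom (int r) (b - 1)"
    "binom (int r + 2) b = binom (int r + 1) b + binom (int r + 1) (b - 1)" for b
    using binom_pascal[of "int r" b] binom_pascal[of "int r + 1" b] by (simp_all add: add.assoc)
  have b: "heis_betti 1 0 = 1" "heis_betti 1 1 = 2" "heis_betti 1 2 = 2" "heis_betti 1 3 = 1"
    by (simp_all add: heis_betti_def binom_def)
  have "(\<Sum>i\<le>2 * 1 + 1. heis_betti 1 (int i) * binom (int r) (int k - int i)) =
      binom (int r) (int k) + 2 * binom (int r) (int k - 1) + 2 * binom (int r) (int k - 2)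
      + binom (int r) (int k - 3)"
  proof -
    have "{..2 * 1 + 1} = {0, 1, 2, 3 :: nat}" by auto
    then show ?thesis by (simp only: sum.insert_if finite.intros sum.empty) (simp add: b[unfolded One_nat_def])
  qed
  then show ?thesis by (simp add: pascal)
qed

text \<open>In the range of summation the quotient by \<open>m + 1\<close> is 0 or 1 and selects the
  branch of \<open>heis_betti\<close>: the entries are \<open>i\<close>, \<open>i - 2\<close> or
  \<open>i - 1\<close>, \<open>i + 1\<close>. The terms cut off by \<open>min\<close> have
  \<open>i > k\<close> and vanish.\<close>

lemma heis_betti_sum_div:
  "(\<Sum>i=0..min k (2 * m + 1).
      (binom (2 * int m) (int i - int (i div (m + 1))) -
       binom (2 * int m) (int i + 3 * int (i div (m + 1)) - 2)) * binom (int r) (int k - int i)) =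
    (\<Sum>i\<le>2 * m + 1. heis_betti m (int i) * binom (int r) (int k - int i))"
proof (rule sum.mono_neutral_cong_left)
  show "\<forall>i\<in>{..2 * m + 1} - {0..min k (2 * m + 1)}. heis_betti m (int i) * binom (int r) (int k - int i) = 0"
    by (auto simp: binom_neg)
  fix i assume "i \<in> {0..min k (2 * m + 1)}"
  then have "i \<le> 2 * m + 1" by simp
  then have "i div (m + 1) = (if i \<le> m then 0 else 1)"
    by (auto simp: div_nat_eqI)
  then show "(binom (2 * int m) (int i - int (i div (m + 1))) -
       binom (2 * int m) (int i + 3 * int (i div (m + 1)) - 2)) * binom (int r) (int k - int i) =
      heis_betti m (int i) * binom (int r) (int k - int i)"
    by (simp add: heis_betti_def add.commute)
qed auto

theorem theorem2p2p1:
  shows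
    "(betti aff_lie 1 = 1 \<and> betti aff_lie 2 = 0) \<and>
     (\<forall>n k. n > 2 \<and> k \<le> n \<longrightarrow>
        int (betti (aff_lie \<oplus>\<^sub>L abelian_lie (n - 2)) k) = binom (int n - 1) (int k)) \<and>
     (\<forall>m n k. m \<ge> 1 \<and> n = 2 * m + 1 \<and> k \<le> m \<longrightarrow>
        betti (heisenberg_lie m) k = betti (heisenberg_lie m) (n - k) \<and>
        int (betti (heisenberg_lie m) k) =
          binom (2 * int m) (int k) - binom (2 * int m) (int k - 2)) \<and>
     (\<forall>n k. n > 3 \<and> k \<le> n \<longrightarrow>
        int (betti (heisenberg_lie 1 \<oplus>\<^sub>L abelian_lie (n - 3)) k) =
          binom (int n - 1) (int k) + binom (int n - 2) (int k - 2)) \<and>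
     (\<forall>m n k. n > 2 * m + 1 \<and> 2 * m + 1 > 3 \<and> k \<le> m \<longrightarrow>
        betti (heisenberg_lie m \<oplus>\<^sub>L abelian_lie (n - 2 * m - 1)) k =
          betti (heisenberg_lie m \<oplus>\<^sub>L abelian_lie (n - 2 * m - 1)) (n - k) \<and>
        int (betti (heisenberg_lie m \<oplus>\<^sub>L abelian_lie (n - 2 * m - 1)) k) =
          binom (int n - 1) (int k) - binom (int n - 1) (int k - 2)) \<and>
     (\<forall>m n k. n > 2 * m + 1 \<and> 2 * m + 1 > 3 \<and> m + 1 \<le> k \<and> k \<le> n div 2 \<longrightarrow>
        betti (heisenberg_lie m \<oplus>\<^sub>L abelian_lie (n - 2 * m - 1)) k =
          betti (heisenberg_lie m \<oplus>\<^sub>L abelian_lie (n - 2 * m - 1)) (n - k) \<and>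
        int (betti (heisenberg_lie m \<oplus>\<^sub>L abelian_lie (n - 2 * m - 1)) k) =
          (\<Sum>i=0..min k (2 * m + 1).
             (binom (2 * int m) (int i - int (i div (m + 1))) -
              binom (2 * int m) (int i + 3 * int (i div (m + 1)) - 2)) *
             binom (int n - 2 * int m - 1) (int k - int i)))"
proof (intro conjI allI impI; (elim conjE)?)
  show "betti aff_lie 1 = 1" "betti aff_lie 2 = 0"
    using betti_aff_lie[of 1] betti_aff_lie[of 2] by (simp_all add: binom_def)
next
  fix n k :: nat assume n: "n > 2"
  then have "int (n - 2) + 1 = int n - 1" by simp
  then show "int (betti (aff_lie \<oplus>\<^sub>L abelian_lie (n - 2)) k) = binom (int n - 1) (int k)"
    by (simp only: betti_aff_dsum_abelian)
next
  fix m n k :: nat assume n: "n = 2 * m + 1" and k: "k \<le> m"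
  have "int (betti (heisenberg_lie m) (n - k)) = int (betti (heisenberg_lie m) k)"
    unfolding betti_heisenberg_lie using heis_betti_sum_duality[of k m 0] n k by simp
  then show "betti (heisenberg_lie m) k = betti (heisenberg_lie m) (n - k)" by simp
  show "int (betti (heisenberg_lie m) k) = binom (2 * int m) (int k) - binom (2 * int m) (int k - 2)"
    unfolding betti_heisenberg_lie using heis_betti_sum_low[OF k, of 0] by simp
next
  fix n k :: nat assume n: "n > 3"
  then have "int (n - 3) + 2 = int n - 1" "int (n - 3) + 1 = int n - 2" by simp_all
  then show "int (betti (heisenberg_lie 1 \<oplus>\<^sub>L abelian_lie (n - 3)) k) =
      binom (int n - 1) (int k) + binom (int n - 2) (int k - 2)"
    by (simp only: betti_heisenberg_dsum_abelian heis_betti_1_sum)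
next
  fix m n k :: nat assume n: "n > 2 * m + 1"
  define r where "r = n - 2 * m - 1"
  have r: "n = 2 * m + 1 + r" "2 * int m + int r = int n - 1" "int r = int n - 2 * int m - 1"
    using n by (auto simp: r_def)
  \<comment> \<open>Duality in every degree up to \<open>n\<close>, shared by the low and the middle
    range of \<open>k\<close>.\<close>
  have dual: "betti (heisenberg_lie m \<oplus>\<^sub>L abelian_lie (n - 2 * m - 1)) k =
      betti (heisenberg_lie m \<oplus>\<^sub>L abelian_lie (n - 2 * m - 1)) (n - k)" if "k \<le> n"
  proof -
    have "int (betti (heisenberg_lie m \<oplus>\<^sub>L abelian_lie r) (n - k)) =
        int (betti (heisenberg_lie m \<oplus>\<^sub>L abelian_lie r) k)"
      unfolding betti_heisenberg_dsum_abelian using heis_betti_sum_duality[of k m r] that r(1) by simp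
    then show ?thesis by (simp add: r_def)
  qed
  {
    assume k: "k \<le> m"
    then show "betti (heisenberg_lie m \<oplus>\<^sub>L abelian_lie (n - 2 * m - 1)) k =
        betti (heisenberg_lie m \<oplus>\<^sub>L abelian_lie (n - 2 * m - 1)) (n - k)"
      using n by (intro dual) simp
    show "int (betti (heisenberg_lie m \<oplus>\<^sub>L abelian_lie (n - 2 * m - 1)) k) =
        binom (int n - 1) (int k) - binom (int n - 1) (int k - 2)"
      unfolding r_def[symmetric] betti_heisenberg_dsum_abelian heis_betti_sum_low[OF k] r(2) ..
  next
    assume k: "k \<le> n div 2"
    then show "betti (heisenberg_lie m \<oplus>\<^sub>L abelian_lie (n - 2 * m - 1)) k =
        betti (heisenberg_lie m \<oplus>\<^sub>L abelian_lie (n - 2 * m - 1)) (n - k)"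
      by (intro dual) simp
    show "int (betti (heisenberg_lie m \<oplus>\<^sub>L abelian_lie (n - 2 * m - 1)) k) =
        (\<Sum>i=0..min k (2 * m + 1).
           (binom (2 * int m) (int i - int (i div (m + 1))) -
            binom (2 * int m) (int i + 3 * int (i div (m + 1)) - 2)) *
           binom (int n - 2 * int m - 1) (int k - int i))"
      unfolding r_def[symmetric] betti_heisenberg_dsum_abelian r(3)[symmetric] heis_betti_sum_div ..
  }
qed

end
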